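(* Let $p\in\{2,3,4,5\}$ and $\alpha>0$, and let $f$, $\mathcal{D}_s^{\alpha+p}f$ and their Fourier transforms belong to $L_1(\mathbb{R})$. For a step size $h>0$ put $$A^{p,\alpha}f(x)=\frac{1}{h^{\alpha}}\sum_{m=0}^{\infty}g_m^{p,\alpha}f(x-mh),$$ where the coefficients $g_m^{p,\alpha}$ are defined by $$\left(\sum_{i=1}^p\frac1i\left(1-\frac{\zeta}{e^{\sigma h}}\right)^i\right)^{\alpha}=\sum_{m=0}^{\infty}g_m^{p,\alpha}\zeta^m .$$ Then $$\mathcal{D}_s^{\alpha}f(x)=A^{p,\alpha}f(x)+\mathcal{O}(h^p)\qquad (h\to 0).$$
   Context: $\sigma$ is a constant (a quantity not depending on $x$). For $\nu>0$, $$\mathcal{I}_s^\nu f(x)=\frac{1}{\Gamma(\nu)}\int_{-\infty}^x (x-\tau)^{\nu-1}e^{-\sigma(x-\tau)}f(\tau)\,d\tau .$$ For $\nu>0$, let $m$ be the smallest integer that exceeds $\nu$; then $\mathcal{D}_s^\nu f(x)=D_s^m[\mathcal{I}_s^{m-\nu}f(x)]$, where $D_s=\frac{\partial}{\partial x}+\sigma$ and $D_s^m$ is its $m$-fold composition. The Fourier transform is $\widehat f(\omega)=\int_{\mathbb{R}}e^{i\omega x}f(x)\,dx$. *)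

theory Defs
  imports "HOL-Complex_Analysis.Complex_Analysis"
begin

text \<open>
  Functions \<open>f :: real \<Rightarrow> complex\<close> and a complex constant \<open>\<sigma>\<close> are used throughout; real-valued
  functions and real \<open>\<sigma>\<close> (of either sign) are special cases.  Membership in \<open>L\<^sub>1(\<real>)\<close> is
  \<open>integrable lebesgue\<close>.
\<close>

definition fourier :: "(real \<Rightarrow> complex) \<Rightarrow> real \<Rightarrow> complex" where
  "fourier f \<omega> = (LINT x|lebesgue. exp (\<i> * of_real (\<omega> * x)) * f x)"

definition subst_integrand ::
    "complex \<Rightarrow> real \<Rightarrow> (real \<Rightarrow> complex) \<Rightarrow> real \<Rightarrow> real \<Rightarrow> complex" where
  "subst_integrand \<sigma> \<nu> f x \<tau> =
     of_real ((x - \<tau>) powr (\<nu> - 1)) * exp (- \<sigma> * of_real (x - \<tau>)) * f \<tau>"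

definition subst_integral ::
    "complex \<Rightarrow> real \<Rightarrow> (real \<Rightarrow> complex) \<Rightarrow> real \<Rightarrow> complex" where
  "subst_integral \<sigma> \<nu> f x =
     of_real (1 / Gamma \<nu>) * (LINT \<tau>:{..x}|lebesgue. subst_integrand \<sigma> \<nu> f x \<tau>)"

definition subst_D :: "complex \<Rightarrow> (real \<Rightarrow> complex) \<Rightarrow> real \<Rightarrow> complex" where
  "subst_D \<sigma> F x = vector_derivative F (at x) + \<sigma> * F x"

definition subst_order :: "real \<Rightarrow> nat" where
  "subst_order \<nu> = (LEAST m. \<nu> < real m)"

definition subst_frac_deriv ::
    "complex \<Rightarrow> real \<Rightarrow> (real \<Rightarrow> complex) \<Rightarrow> real \<Rightarrow> complex" where
  "subst_frac_deriv \<sigma> \<nu> f =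
     (subst_D \<sigma> ^^ subst_order \<nu>) (subst_integral \<sigma> (real (subst_order \<nu>) - \<nu>) f)"

text \<open>
  In HOL the Lebesgue integral and the derivative are total, with arbitrary values where they do
  not exist.  The next predicate says that the defining expression of \<open>subst_frac_deriv \<sigma> \<nu> f\<close>
  makes sense at every point: the integral converges absolutely and \<open>subst_D \<sigma>\<close> is applied to
  differentiable functions only.
\<close>

definition has_subst_frac_deriv :: "complex \<Rightarrow> real \<Rightarrow> (real \<Rightarrow> complex) \<Rightarrow> bool" where
  "has_subst_frac_deriv \<sigma> \<nu> f \<longleftrightarrow>
     (let m = subst_order \<nu> in
       (\<forall>x. set_integrable lebesgue {..x} (subst_integrand \<sigma> (real m - \<nu>) f x)) \<and>
       (\<forall>k<m. \<forall>x. ((subst_D \<sigma> ^^ k) (subst_integral \<sigma> (real m - \<nu>) f)) differentiable (at x)))"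

definition gen_fun :: "nat \<Rightarrow> real \<Rightarrow> complex \<Rightarrow> real \<Rightarrow> complex \<Rightarrow> complex" where
  "gen_fun p \<alpha> \<sigma> h \<zeta> =
     (\<Sum>i=1..p. 1 / of_nat i * (1 - \<zeta> / exp (\<sigma> * of_real h)) ^ i) powr of_real \<alpha>"

text \<open>
  The identity defining the coefficients is one of power series at \<open>\<zeta> = 0\<close>.  The base of the power
  is the positive number \<open>1 + 1/2 + \<dots> + 1/p\<close> there, so the principal branch is analytic at \<open>0\<close>;
  lemma \<open>approx_coeff_sums\<close> confirms the generating identity.
\<close>

definition approx_coeff :: "nat \<Rightarrow> real \<Rightarrow> complex \<Rightarrow> real \<Rightarrow> nat \<Rightarrow> complex" where
  "approx_coeff p \<alpha> \<sigma> h m = fps_nth (fps_expansion (gen_fun p \<alpha> \<sigma> h) 0) m"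

lemma approx_coeff_sums:
  assumes "p \<ge> 1"
  shows "\<forall>\<^sub>F \<zeta> in nhds 0. (\<lambda>m. approx_coeff p \<alpha> \<sigma> h m * \<zeta> ^ m) sums gen_fun p \<alpha> \<sigma> h \<zeta>"
proof -
  let ?B = "\<lambda>\<zeta>. \<Sum>i=1..p. 1 / of_nat i * (1 - \<zeta> / exp (\<sigma> * of_real h)) ^ i :: complex"
  have "(\<Sum>i=1..p. 1 / real i) > 0"
    using assms by (intro sum_pos) auto
  moreover have "?B 0 = of_real (\<Sum>i=1..p. 1 / real i)"
    by simp
  ultimately have "?B 0 \<notin> \<real>\<^sub>\<le>\<^sub>0"
    by (metis complex_nonpos_Reals_iff Re_complex_of_real not_le)
  moreover have "?B analytic_on {0}"
    by (intro analytic_intros) auto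
  ultimately have "gen_fun p \<alpha> \<sigma> h analytic_on {0}"
    unfolding gen_fun_def by (intro analytic_intros) auto
  hence ex: "gen_fun p \<alpha> \<sigma> h has_fps_expansion fps_expansion (gen_fun p \<alpha> \<sigma> h) 0"
    by (rule analytic_at_imp_has_fps_expansion_0)
  let ?F = "fps_expansion (gen_fun p \<alpha> \<sigma> h) 0"
  from ex have r: "fps_conv_radius ?F > 0"
    and ev: "\<forall>\<^sub>F \<zeta> in nhds 0. eval_fps ?F \<zeta> = gen_fun p \<alpha> \<sigma> h \<zeta>"
    by (auto simp: has_fps_expansion_def)
  have "\<forall>\<^sub>F \<zeta> in nhds 0. \<zeta> \<in> eball (0::complex) (fps_conv_radius ?F)"
    using r by (intro eventually_nhds_in_open) (auto simp: zero_ereal_def)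
  with ev show ?thesis
  proof eventually_elim
    case (elim \<zeta>)
    thus ?case
      using sums_eval_fps[of \<zeta> ?F] by (simp add: approx_coeff_def)
  qed
qed

definition approx_term ::
    "nat \<Rightarrow> real \<Rightarrow> complex \<Rightarrow> real \<Rightarrow> (real \<Rightarrow> complex) \<Rightarrow> real \<Rightarrow> nat \<Rightarrow> complex" where
  "approx_term p \<alpha> \<sigma> h f x m = approx_coeff p \<alpha> \<sigma> h m * f (x - real m * h)"

definition approx_A ::
    "nat \<Rightarrow> real \<Rightarrow> complex \<Rightarrow> real \<Rightarrow> (real \<Rightarrow> complex) \<Rightarrow> real \<Rightarrow> complex" where
  "approx_A p \<alpha> \<sigma> h f x = of_real (1 / h powr \<alpha>) * (\<Sum>m. approx_term p \<alpha> \<sigma> h f x m)"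

text \<open>
  Convergence of the series is part of the claim.  An element of \<open>L\<^sub>1(\<real>)\<close> is determined only up to
  null sets, while \<open>approx_A\<close> uses the values \<open>f (x - m h)\<close>; so for an arbitrary representative the
  error estimate can be expected for almost every \<open>x\<close> only (for each \<open>h\<close>), and for every \<open>x\<close> when \<open>f\<close>
  is the continuous representative, which exists because the Fourier transform of \<open>f\<close> is integrable.
\<close>

definition approx_within ::
    "nat \<Rightarrow> real \<Rightarrow> complex \<Rightarrow> (real \<Rightarrow> complex) \<Rightarrow> real \<Rightarrow> real \<Rightarrow> real \<Rightarrow> bool" where
  "approx_within p \<alpha> \<sigma> f h x e \<longleftrightarrow>
     summable (approx_term p \<alpha> \<sigma> h f x) \<and>
     norm (subst_frac_deriv \<sigma> \<alpha> f x - approx_A p \<alpha> \<sigma> h f x) \<le> e"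

end

theory Submission
  imports Defs "HOL-Probability.Probability"
begin

text \<open>
  Write \<open>z = \<sigma> - \<i> \<omega>\<close>, \<open>n = subst_order \<alpha>\<close> and \<open>\<nu> = n - \<alpha>\<close>, so that both derivatives in the statement
  are iterates of \<open>subst_D\<close> on the same function \<open>\<phi> = subst_integral \<sigma> \<nu> f\<close>.  In Fourier space the
  difference operator has the symbol \<open>h powr - \<alpha> * G (z h)\<close>, where \<open>G u\<close> is the value of the
  coefficient series at \<open>exp (- u)\<close>, and \<open>G u = u powr \<alpha> + O(u powr (\<alpha> + p))\<close>; the error is
  therefore bounded by \<open>h ^ p\<close> times the \<open>L\<^sub>1\<close>-norm of the transform of the derivative of order \<open>\<alpha> + p\<close>.

  The function \<open>\<phi>\<close> need not be integrable when \<open>Re \<sigma> = 0\<close>, but its twisted differences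
  \<open>\<phi> x - exp (- \<sigma> \<delta>) \<phi> (x - \<delta>)\<close> are convolutions of \<open>f\<close> with an integrable kernel.  They identify the
  transform of the derivative of order \<open>\<alpha> + p\<close> as \<open>z powr (\<alpha> + p)\<close> times that of \<open>f\<close>, and as \<open>\<delta> \<rightarrow> 0\<close>
  they represent the derivative of order \<open>\<alpha>\<close> as an inverse transform at every point.

  When \<open>Re \<sigma> < 0\<close> the kernel grows.  For integer order the operators are local and the argument
  persists; for fractional order the branch cut of \<open>z powr - \<nu>\<close> enters the strip in which the
  transforms are analytic, and the hypotheses force \<open>f = 0\<close> almost everywhere.
\<close>

section \<open>Fourier inversion on the line\<close>

text \<open>Nothing is assumed about the integrability of the intermediate derivatives, so they are
  never transformed. Instead the transform of \<open>n + p\<close> unit differences of \<phi> is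
  computed twice: from below, where one difference goes to the kernel and the others to
  \<open>f\<close>, and from above, where each difference is a local mean of the next derivative
  until the one of order \<alpha> + \<open>p\<close> is reached. Comparing the two gives its symbol.
  The coefficients come from the principal power at \<zeta> = 0, but consistency concerns \<zeta> =
  \<open>exp (- u)\<close> near 1. The two points are linked by a holomorphic logarithm of the
  polynomial with its zero at 1 divided out; that this cofactor has no zero in the closed unit disc
  is checked for each \<open>p\<close>. The other factor, the power of 1 - \<zeta>, has absolutely
  summable coefficients because \<alpha> > 0. In the degenerate case a kernel with half-line
  spectrum is applied to a function and to its conjugate; the two relations are independent because
  \<open>exp (- \<i> \<pi> \<nu>)\<close> is not real for 0 < \<nu> < 1.\<close>

definition ft :: "(real \<Rightarrow> complex) \<Rightarrow> real \<Rightarrow> complex" where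
  "ft g \<omega> = (LINT x|lborel. iexp (\<omega> * x) * g x)"

definition ift :: "(real \<Rightarrow> complex) \<Rightarrow> real \<Rightarrow> complex" where
  "ift g x = of_real (1 / (2 * pi)) * (LINT \<omega>|lborel. iexp (- (\<omega> * x)) * g \<omega>)"

definition conv :: "(real \<Rightarrow> complex) \<Rightarrow> (real \<Rightarrow> complex) \<Rightarrow> real \<Rightarrow> complex" where
  "conv a b x = (LINT t|lborel. a (x - t) * b t)"

lemma norm_iexp [simp]: "norm (iexp x) = 1"
  by simp

lemma norm_powr_of_real: "norm (z powr of_real a) = norm z powr a" for z :: complex
  by (cases "z = 0") (auto simp: powr_def)

lemma integrable_bounded_mult:
  fixes a b :: "'a \<Rightarrow> complex"
  assumes "integrable M a" "b \<in> borel_measurable M" "\<And>x. norm (b x) \<le> C"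
  shows "integrable M (\<lambda>x. b x * a x)"
proof (rule Bochner_Integration.integrable_bound)
  show "integrable M (\<lambda>x. C * norm (a x))" using assms by simp
  show "AE x in M. norm (b x * a x) \<le> norm (C * norm (a x))"
    using assms(3) by (intro AE_I2) (simp add: norm_mult abs_mult mult_mono' order_trans[OF assms(3) abs_ge_self])
qed (use assms in auto)

lemma integrable_iexp_mult [intro]:
  assumes "integrable lborel g"
  shows "integrable lborel (\<lambda>x. iexp (\<omega> * x) * g x)" "integrable lborel (\<lambda>x. iexp (- (\<omega> * x)) * g x)"
  by (rule integrable_bounded_mult[where C = 1]; use assms in simp)+

lemma ft_measurable [measurable]:
  assumes [measurable]: "g \<in> borel_measurable borel"
  shows "ft g \<in> borel_measurable borel"
  unfolding ft_def by measurable

lemma norm_ft_le: "norm (ft g \<omega>) \<le> (LINT x|lborel. norm (g x))"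
  unfolding ft_def by (rule order_trans[OF integral_norm_bound]) (simp add: norm_mult)

lemma ft_cong_AE:
  assumes "AE x in lborel. f x = g x" "f \<in> borel_measurable borel" "g \<in> borel_measurable borel"
  shows "ft f = ft g"
  unfolding ft_def by (rule ext, rule integral_cong_AE) (use assms in auto)

lemma isCont_ft:
  assumes "integrable lborel g"
  shows "isCont (ft g) \<omega>"
  unfolding isCont_def tendsto_at_iff_sequentially o_def
proof (intro allI impI)
  fix X :: "nat \<Rightarrow> real" assume X: "X \<longlonglongrightarrow> \<omega>"
  show "(\<lambda>n. ft g (X n)) \<longlonglongrightarrow> ft g \<omega>"
    unfolding ft_def
  proof (rule integral_dominated_convergence[where w = "\<lambda>x. norm (g x)"])
    show "AE x in lborel. (\<lambda>n. iexp (X n * x) * g x) \<longlonglongrightarrow> iexp (\<omega> * x) * g x"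
      by (intro AE_I2 tendsto_intros X)
    show "\<And>n. AE x in lborel. norm (iexp (X n * x) * g x) \<le> norm (g x)"
      by (intro AE_I2) (simp add: norm_mult)
  qed (use assms in auto)
qed

lemma ft_add:
  assumes "integrable lborel f" "integrable lborel g"
  shows "ft (\<lambda>x. f x + g x) \<omega> = ft f \<omega> + ft g \<omega>"
  unfolding ft_def distrib_left
  by (rule Bochner_Integration.integral_add) (use assms in \<open>auto simp del: of_real_mult\<close>)

lemma ft_diff:
  assumes "integrable lborel f" "integrable lborel g"
  shows "ft (\<lambda>x. f x - g x) \<omega> = ft f \<omega> - ft g \<omega>"
  unfolding ft_def right_diff_distrib
  by (rule Bochner_Integration.integral_diff) (use assms in \<open>auto simp del: of_real_mult\<close>)

lemma ft_cmult: "ft (\<lambda>x. c * g x) \<omega> = c * ft g \<omega>"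
  unfolding ft_def by (simp add: mult.left_commute)

lemma ft_cnj: "ft (\<lambda>x. cnj (g x)) \<omega> = cnj (ft g (- \<omega>))"
  unfolding ft_def by (subst Bochner_Integration.integral_cnj[symmetric]) (simp add: exp_cnj)

lemma ift_eq_ft: "ift g x = of_real (1 / (2 * pi)) * ft g (- x)"
  by (simp add: ift_def ft_def mult.commute)

lemma isCont_ift: "integrable lborel g \<Longrightarrow> isCont (ift g) x"
  unfolding ift_eq_ft by (intro continuous_intros isCont_o2[OF _ isCont_ft])

section \<open>Injectivity of the Fourier transform\<close>

text \<open>Frequency 0 shows that the positive and negative parts of \<open>g\<close> have the same
  mass; normalised, they are probability densities with equal characteristic functions, and Levy's
  uniqueness theorem identifies them. Mass 0 cannot be normalised and is treated apart.\<close>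

lemma ft_zero_real_imp_AE_zero:
  fixes g :: "real \<Rightarrow> real"
  assumes int: "integrable lborel g" and 0: "\<And>\<omega>. ft (\<lambda>x. of_real (g x)) \<omega> = 0"
  shows "AE x in lborel. g x = 0"
proof -
  define P where "P = (\<lambda>x. max 0 (g x))"
  define N where "N = (\<lambda>x. max 0 (- g x))"
  have [measurable]: "g \<in> borel_measurable borel" using int by auto
  have intP: "integrable lborel P" and intN: "integrable lborel N"
    unfolding P_def N_def using int by auto
  have gPN: "g x = P x - N x" for x by (simp add: P_def N_def)
  have P0: "P x \<ge> 0" and N0: "N x \<ge> 0" for x by (auto simp: P_def N_def)
  define m where "m = (LINT x|lborel. P x)"
  have "complex_of_real (LINT x|lborel. g x) = 0"
    using 0[of 0] by (simp add: ft_def)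
  hence mN: "(LINT x|lborel. N x) = m"
    using intP intN by (simp add: gPN m_def)
  have m0: "m \<ge> 0" unfolding m_def using P0 by simp
  show ?thesis
  proof (cases "m = 0")
    case True
    have "AE x in lborel. P x = 0" "AE x in lborel. N x = 0"
      using integral_nonneg_eq_0_iff_AE[OF intP] integral_nonneg_eq_0_iff_AE[OF intN] P0 N0 True mN m_def by auto
    thus ?thesis by eventually_elim (simp add: gPN)
  next
    case False
    with m0 have m: "m > 0" by simp
    have R: "real_distribution (density lborel (\<lambda>x. ennreal (Q x / m)))"
      and C: "char (density lborel (\<lambda>x. ennreal (Q x / m))) t = ft (\<lambda>x. of_real (Q x)) t / m"
      if Q: "integrable lborel Q" "\<And>x. Q x \<ge> 0" "(LINT x|lborel. Q x) = m" for Q t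
    proof -
      have [measurable]: "Q \<in> borel_measurable borel" using Q by auto
      have "emeasure (density lborel (\<lambda>x. ennreal (Q x / m))) UNIV = (\<integral>\<^sup>+x. ennreal (Q x / m) \<partial>lborel)"
        by (subst emeasure_density) auto
      also have "\<dots> = ennreal (LINT x|lborel. Q x / m)"
        using Q m by (intro nn_integral_eq_integral) auto
      also have "\<dots> = 1" using Q m by simp
      finally show "real_distribution (density lborel (\<lambda>x. ennreal (Q x / m)))"
        by (intro real_distribution.intro prob_spaceI real_distribution_axioms.intro) auto
      show "char (density lborel (\<lambda>x. ennreal (Q x / m))) t = ft (\<lambda>x. of_real (Q x)) t / m"
        unfolding char_def ft_def using Q m
        by (subst integral_density) (auto simp: scaleR_conv_of_real field_simps)
    qed
    have "char (density lborel (\<lambda>x. ennreal (P x / m))) = char (density lborel (\<lambda>x. ennreal (N x / m)))"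
    proof
      fix t
      have "ft (\<lambda>x. of_real (P x)) t - ft (\<lambda>x. of_real (N x)) t = ft (\<lambda>x. of_real (g x)) t"
        unfolding gPN of_real_diff using intP intN by (subst ft_diff) auto
      thus "char (density lborel (\<lambda>x. ennreal (P x / m))) t = char (density lborel (\<lambda>x. ennreal (N x / m))) t"
        using C[OF intP P0 m_def[symmetric]] C[OF intN N0 mN] 0 by simp
    qed
    hence "density lborel (\<lambda>x. ennreal (P x / m)) = density lborel (\<lambda>x. ennreal (N x / m))"
      by (intro Levy_uniqueness R intP intN P0 N0 mN m_def[symmetric])
    hence "AE x in lborel. ennreal (P x / m) = ennreal (N x / m)"
      using intP intN by (intro sigma_finite_measure.density_unique) (auto intro: sigma_finite_lborel)
    thus ?thesis
      by eventually_elim (use m P0 N0 in \<open>auto simp: gPN divide_nonneg_pos\<close>)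
  qed
qed

text \<open>Conjugation reflects the frequency, so the conjugate of \<open>g\<close> has vanishing
  transform too, and with it the real and imaginary parts.\<close>

theorem ft_zero_imp_AE_zero:
  assumes int: "integrable lborel g" and 0: "\<And>\<omega>. ft g \<omega> = 0"
  shows "AE x in lborel. g x = 0"
proof -
  have int': "integrable lborel (\<lambda>x. cnj (g x))" using int by simp
  have "of_real (Re (g x)) = 1 / 2 * (g x + cnj (g x))" for x by (simp add: complex_add_cnj)
  hence "ft (\<lambda>x. of_real (Re (g x))) \<omega> = 0" for \<omega>
    by (simp only: ft_cmult ft_add[OF int int'] ft_cnj 0) simp
  hence 1: "AE x in lborel. Re (g x) = 0"
    using int by (intro ft_zero_real_imp_AE_zero) auto
  have "of_real (Im (g x)) = 1 / (2 * \<i>) * (g x - cnj (g x))" for x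
    by (simp add: complex_diff_cnj complex_eq_iff)
  hence "ft (\<lambda>x. of_real (Im (g x))) \<omega> = 0" for \<omega>
    by (simp only: ft_cmult ft_diff[OF int int'] ft_cnj 0) simp
  hence 2: "AE x in lborel. Im (g x) = 0"
    using int by (intro ft_zero_real_imp_AE_zero) auto
  from 1 2 show ?thesis by eventually_elim (simp add: complex_eq_iff)
qed

section \<open>Convolution and the product formula\<close>

lemma conv_pair_integrable:
  fixes a b :: "real \<Rightarrow> complex"
  assumes a: "integrable lborel a" and b: "integrable lborel b"
  shows "integrable (lborel \<Otimes>\<^sub>M lborel) (\<lambda>(t, x). a (x - t) * b t)"
proof -
  have [measurable]: "a \<in> borel_measurable borel" "b \<in> borel_measurable borel"
    using a b by auto
  show ?thesis
  proof (rule lborel_pair.Fubini_integrable)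
  show "(\<lambda>(t, x). a (x - t) * b t) \<in> borel_measurable (lborel \<Otimes>\<^sub>M lborel)" by measurable
  have sh: "integrable lborel (\<lambda>x. a (x - t))" for t
    using lborel_integrable_real_affine[OF a, of 1 "- t"] by simp
  have "(LINT x|lborel. norm (a (x - t) * b t)) = (LINT x|lborel. norm (a x)) * norm (b t)" for t
    using lborel_integral_real_affine[of 1 "\<lambda>x. norm (a x)" "- t"] by (simp add: norm_mult)
  thus "integrable lborel (\<lambda>t. LINT x|lborel. norm (case (t, x) of (t, x) \<Rightarrow> a (x - t) * b t))"
    using b by simp
  show "AE t in lborel. integrable lborel (\<lambda>x. case (t, x) of (t, x) \<Rightarrow> a (x - t) * b t)"
    using sh by simp
  qed
qed

lemma product_pair_integrable:
  fixes a b :: "real \<Rightarrow> complex"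
  assumes a: "integrable lborel a" and b: "integrable lborel b"
  shows "integrable (lborel \<Otimes>\<^sub>M lborel) (\<lambda>(t, x). a t * b x)"
proof -
  have [measurable]: "a \<in> borel_measurable borel" "b \<in> borel_measurable borel"
    using a b by auto
  show ?thesis
    by (rule lborel_pair.Fubini_integrable) (use a b in \<open>auto simp: norm_mult\<close>)
qed

lemma conv_integrable:
  assumes "integrable lborel a" "integrable lborel b"
  shows "integrable lborel (conv a b)"
  unfolding conv_def using lborel_pair.integrable_snd[OF conv_pair_integrable[OF assms]] by simp

lemma ft_shift: "ft (\<lambda>x. a (x - t)) \<omega> = iexp (\<omega> * t) * ft a \<omega>"
proof -
  have "ft (\<lambda>x. a (x - t)) \<omega> = (LINT x|lborel. iexp (\<omega> * (t + x)) * a x)"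
    unfolding ft_def by (subst lborel_integral_real_affine[where c = 1 and t = t]) simp_all
  thus ?thesis by (simp add: ft_def distrib_left exp_add mult.assoc)
qed

theorem ft_conv:
  assumes a: "integrable lborel a" and b: "integrable lborel b"
  shows "ft (conv a b) \<omega> = ft a \<omega> * ft b \<omega>"
proof -
  have [measurable]: "a \<in> borel_measurable borel" "b \<in> borel_measurable borel"
    using a b by auto
  have "ft (conv a b) \<omega> = (LINT x|lborel. LINT t|lborel. iexp (\<omega> * x) * (a (x - t) * b t))"
    by (simp add: ft_def conv_def)
  also have "\<dots> = (LINT t|lborel. LINT x|lborel. iexp (\<omega> * x) * (a (x - t) * b t))"
  proof (rule lborel_pair.Fubini_integral)
    have "integrable (lborel \<Otimes>\<^sub>M lborel) (\<lambda>z. (case z of (t, x) \<Rightarrow> iexp (\<omega> * x)) * (case z of (t, x) \<Rightarrow> a (x - t) * b t))"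
      by (rule integrable_bounded_mult[OF conv_pair_integrable[OF a b], where C = 1]) (auto simp: split_beta')
    thus "integrable (lborel \<Otimes>\<^sub>M lborel) (\<lambda>(t, x). iexp (\<omega> * x) * (a (x - t) * b t))"
      by (simp add: split_beta')
  qed
  also have "\<dots> = (LINT t|lborel. ft (\<lambda>x. a (x - t)) \<omega> * b t)"
    by (simp add: ft_def mult.assoc[symmetric] del: of_real_mult)
  also have "\<dots> = ft a \<omega> * ft b \<omega>"
    unfolding ft_shift by (simp add: ft_def[of b] mult_ac flip: integral_mult_right_zero)
  finally show ?thesis .
qed

section \<open>Inversion by Gaussian damping\<close>

lemma ft_std_normal_density: "ft (\<lambda>x. of_real (std_normal_density x)) t = of_real (exp (- (t\<^sup>2) / 2))"
proof -
  have "of_real (exp (- (t\<^sup>2) / 2)) = char std_normal_distribution t"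
    by (simp add: char_std_normal_distribution)
  also have "\<dots> = (LINT x|lborel. std_normal_density x *\<^sub>R iexp (t * x))"
    unfolding char_def by (subst integral_density) (auto simp: normal_density_nonneg)
  finally show ?thesis by (simp add: ft_def scaleR_conv_of_real mult.commute)
qed

text \<open>Multiplying the function and its candidate inverse transform by the Gaussian makes both
  integrable, and their transforms are then the same Gaussian average of \<open>ft g\<close>.\<close>

theorem ft_inversion_AE:
  assumes g: "integrable lborel g" and G: "integrable lborel (ft g)"
  shows "AE x in lborel. g x = ift (ft g) x"
proof -
  define \<theta> :: "real \<Rightarrow> complex" where "\<theta> = (\<lambda>x. of_real (exp (- (x\<^sup>2) / 2)))"
  define n :: "real \<Rightarrow> complex" where "n = (\<lambda>x. of_real (std_normal_density x))"
  have [measurable]: "g \<in> borel_measurable borel" "ft g \<in> borel_measurable borel" using g G by auto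
  have [measurable]: "\<theta> \<in> borel_measurable borel" "n \<in> borel_measurable borel"
    unfolding \<theta>_def n_def by measurable
  have mi [measurable]: "ift (ft g) \<in> borel_measurable borel"
    unfolding ift_def by measurable
  have n_int: "integrable lborel n"
    unfolding n_def using integrable_normal_density[of 1 0] by auto
  have \<theta>n: "\<theta> x = of_real (sqrt (2 * pi)) * n x" for x
    unfolding \<theta>_def n_def std_normal_density_def by (simp add: field_simps flip: of_real_mult)
  have \<theta>_int: "integrable lborel \<theta>"
    using n_int unfolding \<theta>n[abs_def] by simp
  have \<theta>1: "norm (\<theta> x) \<le> 1" for x by (simp add: \<theta>_def)
  have ftn: "ft n t = \<theta> t" for t by (simp add: n_def \<theta>_def ft_std_normal_density)
  \<comment> \<open>The factor \<open>2 * pi\<close> produced here cancels the one in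
    \<open>ift\<close>.\<close>
  have ft\<theta>: "ft \<theta> t = of_real (2 * pi) * n t" for t
  proof -
    have "ft \<theta> t = of_real (sqrt (2 * pi)) * (of_real (sqrt (2 * pi)) * n t)"
      unfolding \<theta>n[abs_def] ft_cmult ftn \<theta>n ..
    also have "\<dots> = of_real ((sqrt (2 * pi))\<^sup>2) * n t" by (simp only: power2_eq_square of_real_mult mult.assoc)
    finally show ?thesis by simp
  qed
  have nm: "n (- t) = n t" for t by (simp add: n_def std_normal_density_def)
  define H where "H = ift (ft g)"
  have Hb: "norm (H x) \<le> 1 / (2 * pi) * (LINT x|lborel. norm (ft g x))" for x
    unfolding H_def ift_eq_ft norm_mult by (intro mult_mono norm_ft_le) (auto simp: norm_divide)
  have int1: "integrable lborel (\<lambda>x. \<theta> x * g x)"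
    by (rule integrable_bounded_mult[OF g _ \<theta>1]) simp
  have int2: "integrable lborel (\<lambda>x. H x * \<theta> x)"
    by (rule integrable_bounded_mult[OF \<theta>_int _ Hb]) (simp add: H_def)
  \<comment> \<open>Here the Gaussian \<open>\<theta>\<close> is expanded as the transform of the
    density \<open>n\<close>; in \<open>B\<close> the density comes out as the transform of
    \<open>\<theta>\<close>. The same average results.\<close>
  have A: "ft (\<lambda>x. \<theta> x * g x) \<omega> = (LINT \<eta>|lborel. n \<eta> * ft g (\<omega> + \<eta>))" for \<omega>
  proof -
    have "ft (\<lambda>x. \<theta> x * g x) \<omega> = (LINT y|lborel. LINT \<eta>|lborel. iexp ((\<omega> + \<eta>) * y) * (n \<eta> * g y))"
    proof -
      have "(iexp (\<omega> * y) * g y) * (iexp (y * \<eta>) * n \<eta>) = iexp ((\<omega> + \<eta>) * y) * (n \<eta> * g y)" for y \<eta>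
        by (simp add: algebra_simps exp_add)
      hence "(iexp (\<omega> * y) * g y) * \<theta> y = (LINT \<eta>|lborel. iexp ((\<omega> + \<eta>) * y) * (n \<eta> * g y))" for y
        unfolding ftn[symmetric] ft_def[of n] by (simp only: integral_mult_right_zero[symmetric])
      moreover have "(iexp (\<omega> * y) * g y) * \<theta> y = iexp (\<omega> * y) * (\<theta> y * g y)" for y by simp
      ultimately show ?thesis unfolding ft_def by presburger
    qed
    also have "\<dots> = (LINT \<eta>|lborel. LINT y|lborel. iexp ((\<omega> + \<eta>) * y) * (n \<eta> * g y))"
    proof (rule lborel_pair.Fubini_integral)
      have "integrable (lborel \<Otimes>\<^sub>M lborel) (\<lambda>(\<eta>, y). n \<eta> * g y)"
        by (rule product_pair_integrable[OF n_int g]) 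
      from integrable_bounded_mult[OF this, of "\<lambda>(\<eta>, y). iexp ((\<omega> + \<eta>) * y)" 1]
      show "integrable (lborel \<Otimes>\<^sub>M lborel) (\<lambda>(\<eta>, y). iexp ((\<omega> + \<eta>) * y) * (n \<eta> * g y))"
        by (simp add: split_beta' del: of_real_mult)
    qed
    also have "\<dots> = (LINT \<eta>|lborel. n \<eta> * ft g (\<omega> + \<eta>))"
    proof -
      have "n \<eta> * ft g (\<omega> + \<eta>) = (LINT y|lborel. n \<eta> * (iexp ((\<omega> + \<eta>) * y) * g y))" for \<eta>
        unfolding ft_def integral_mult_right_zero ..
      thus ?thesis by (simp only: mult_ac)
    qed
    finally show ?thesis .
  qed
  have B: "ft (\<lambda>x. H x * \<theta> x) \<omega> = (LINT \<eta>|lborel. n \<eta> * ft g (\<omega> + \<eta>))" for \<omega>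
  proof -
    have "ft (\<lambda>x. H x * \<theta> x) \<omega> = of_real (1 / (2 * pi)) *
        (LINT x|lborel. LINT \<eta>|lborel. iexp ((\<omega> - \<eta>) * x) * (ft g \<eta> * \<theta> x))"
    proof -
      have "(iexp (\<omega> * x) * \<theta> x) * (iexp (- (\<eta> * x)) * ft g \<eta>) = iexp ((\<omega> - \<eta>) * x) * (ft g \<eta> * \<theta> x)" for x \<eta>
        by (simp add: algebra_simps exp_diff exp_minus divide_inverse)
      hence "(iexp (\<omega> * x) * \<theta> x) * (LINT \<eta>|lborel. iexp (- (\<eta> * x)) * ft g \<eta>) =
          (LINT \<eta>|lborel. iexp ((\<omega> - \<eta>) * x) * (ft g \<eta> * \<theta> x))" for x
        by (simp only: integral_mult_right_zero[symmetric])
      moreover have "iexp (\<omega> * x) * (H x * \<theta> x) = of_real (1 / (2 * pi)) *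
          ((iexp (\<omega> * x) * \<theta> x) * (LINT \<eta>|lborel. iexp (- (\<eta> * x)) * ft g \<eta>))" for x
        unfolding H_def ift_def by (simp only: mult_ac)
      ultimately show ?thesis
        unfolding ft_def[of "\<lambda>x. H x * \<theta> x"] by (simp only: integral_mult_right_zero)
    qed
    also have "(LINT x|lborel. LINT \<eta>|lborel. iexp ((\<omega> - \<eta>) * x) * (ft g \<eta> * \<theta> x)) =
        (LINT \<eta>|lborel. LINT x|lborel. iexp ((\<omega> - \<eta>) * x) * (ft g \<eta> * \<theta> x))"
    proof (rule lborel_pair.Fubini_integral)
      have "integrable (lborel \<Otimes>\<^sub>M lborel) (\<lambda>(\<eta>, x). ft g \<eta> * \<theta> x)"
        by (rule product_pair_integrable[OF G \<theta>_int]) 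
      from integrable_bounded_mult[OF this, of "\<lambda>(\<eta>, x). iexp ((\<omega> - \<eta>) * x)" 1]
      show "integrable (lborel \<Otimes>\<^sub>M lborel) (\<lambda>(\<eta>, x). iexp ((\<omega> - \<eta>) * x) * (ft g \<eta> * \<theta> x))"
        by (simp add: split_beta' del: of_real_mult)
    qed
    also have "\<dots> = (LINT \<eta>|lborel. ft g \<eta> * ft \<theta> (\<omega> - \<eta>))"
    proof -
      have "ft g \<eta> * ft \<theta> (\<omega> - \<eta>) = (LINT x|lborel. ft g \<eta> * (iexp ((\<omega> - \<eta>) * x) * \<theta> x))" for \<eta>
        unfolding ft_def[of \<theta>] integral_mult_right_zero ..
      thus ?thesis by (simp only: mult_ac)
    qed
    also have "\<dots> = of_real (2 * pi) * (LINT \<eta>|lborel. n (\<eta> - \<omega>) * ft g \<eta>)"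
    proof -
      have "ft g \<eta> * ft \<theta> (\<omega> - \<eta>) = of_real (2 * pi) * (n (\<eta> - \<omega>) * ft g \<eta>)" for \<eta>
        unfolding ft\<theta> using nm[of "\<eta> - \<omega>"] by simp
      thus ?thesis by (simp only: integral_mult_right_zero)
    qed
    also have "(LINT \<eta>|lborel. n (\<eta> - \<omega>) * ft g \<eta>) = (LINT \<eta>|lborel. n \<eta> * ft g (\<omega> + \<eta>))"
      by (subst lborel_integral_real_affine[where c = 1 and t = \<omega>]) simp_all
    finally show ?thesis by simp
  qed
  have "AE x in lborel. \<theta> x * g x - H x * \<theta> x = 0"
    by (rule ft_zero_imp_AE_zero) (use int1 int2 in \<open>auto simp: ft_diff A B\<close>)
  thus ?thesis
    by eventually_elim (simp add: H_def \<theta>_def)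
qed

lemma continuous_AE_zero_imp_zero:
  fixes f :: "real \<Rightarrow> complex"
  assumes "AE x in lborel. f x = 0" "continuous_on UNIV f"
  shows "f x = 0"
proof (rule ccontr)
  assume x: "f x \<noteq> 0"
  have "open (f -` (- {0}))" using assms(2) by (intro open_vimage) auto
  then obtain e where e: "e > 0" "ball x e \<subseteq> f -` (- {0})"
    using x unfolding open_contains_ball by force
  from assms(1) obtain N where N: "{x. f x \<noteq> 0} \<subseteq> N" "N \<in> null_sets lborel"
    by (auto simp: eventually_ae_filter)
  have "f -` (- {0}) = {x. f x \<noteq> 0}" by blast
  with e N(1) have "{x - e<..<x + e} \<subseteq> N" unfolding ball_eq_greaterThanLessThan by blast
  hence "{x - e<..<x + e} \<in> null_sets lborel" by (rule null_sets_subset[OF N(2), rotated]) simp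
  hence "emeasure lborel {x - e<..<x + e} = 0" by (rule null_setsD1)
  thus False using e by simp
qed

lemma ft_inversion:
  assumes g: "integrable lborel g" and G: "integrable lborel (ft g)" and c: "continuous_on UNIV g"
  shows "g x = ift (ft g) x"
proof -
  have "continuous_on UNIV (ift (ft g))"
    using isCont_ift[OF G] by (simp add: continuous_at_imp_continuous_on)
  hence "g x - ift (ft g) x = 0"
    using continuous_AE_zero_imp_zero[of "\<lambda>x. g x - ift (ft g) x" x] continuous_on_diff[OF c] ft_inversion_AE[OF g G]
    by auto
  thus ?thesis by simp
qed

section \<open>Laplace transforms of the differenced kernels\<close>

definition lap :: "(real \<Rightarrow> complex) \<Rightarrow> complex \<Rightarrow> complex" where
  "lap g z = (LINT x|lborel. exp (- (z * of_real x)) * g x)"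

text \<open>The left edge dominates for \<open>x \<ge> 0\<close>, the right edge for
  \<open>x < 0\<close>. The sum of the two edge weights is a majorant that is uniform over the
  strip, as dominated convergence requires.\<close>

lemma exp_strip_le:
  fixes a b u x :: real
  assumes "a \<le> u" "u \<le> b"
  shows "exp (- (u * x)) \<le> exp (- (a * x)) + exp (- (b * x))"
proof (cases "x \<ge> 0")
  case True
  hence "exp (- (u * x)) \<le> exp (- (a * x))" using assms by (simp add: mult_right_mono)
  thus ?thesis using exp_ge_zero[of "- (b * x)"] by linarith
next
  case False
  hence "exp (- (u * x)) \<le> exp (- (b * x))" using assms by (simp add: mult_right_mono_neg)
  thus ?thesis using exp_ge_zero[of "- (a * x)"] by linarith
qed

lemma lap_integrable:
  assumes a: "integrable lborel (\<lambda>x. exp (- (of_real (a * x))) * g x)"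
    and b: "integrable lborel (\<lambda>x. exp (- (of_real (b * x))) * g x)"
    and z: "a \<le> Re z" "Re z \<le> b" and g [measurable]: "g \<in> borel_measurable borel"
  shows "integrable lborel (\<lambda>x. exp (- (z * of_real x)) * g x)"
proof (rule Bochner_Integration.integrable_bound)
  show "integrable lborel (\<lambda>x. norm (exp (- (of_real (a * x))) * g x) + norm (exp (- (of_real (b * x))) * g x))"
    using a b by auto
  show "AE x in lborel. norm (exp (- (z * of_real x)) * g x)
      \<le> norm (norm (exp (- (of_real (a * x))) * g x) + norm (exp (- (of_real (b * x))) * g x))"
    using exp_strip_le[OF z]
    by (intro AE_I2) (auto simp: norm_mult abs_mult simp flip: distrib_right intro!: mult_right_mono)
qed simp

lemma lap_continuous:
  assumes a: "integrable lborel (\<lambda>x. exp (- (of_real (a * x))) * g x)"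
    and b: "integrable lborel (\<lambda>x. exp (- (of_real (b * x))) * g x)"
    and g [measurable]: "g \<in> borel_measurable borel"
  shows "continuous_on {z. a \<le> Re z \<and> Re z \<le> b} (lap g)"
  unfolding continuous_on_sequentially o_def
proof (intro allI ballI impI, elim conjE)
  fix Z z assume z: "z \<in> {z. a \<le> Re z \<and> Re z \<le> b}" and Z: "\<forall>n. Z n \<in> {z. a \<le> Re z \<and> Re z \<le> b}" "Z \<longlonglongrightarrow> z"
  show "(\<lambda>n. lap g (Z n)) \<longlonglongrightarrow> lap g z"
    unfolding lap_def
  proof (rule integral_dominated_convergence[where w = "\<lambda>x. norm (exp (- (of_real (a * x))) * g x) + norm (exp (- (of_real (b * x))) * g x)"])
    show "AE x in lborel. (\<lambda>n. exp (- (Z n * of_real x)) * g x) \<longlonglongrightarrow> exp (- (z * of_real x)) * g x"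
      by (intro AE_I2 tendsto_intros Z)
    show "AE x in lborel. norm (exp (- (Z n * of_real x)) * g x)
      \<le> norm (exp (- (of_real (a * x))) * g x) + norm (exp (- (of_real (b * x))) * g x)" for n
      using exp_strip_le[of a "Re (Z n)" b] Z(1)
      by (intro AE_I2) (auto simp: norm_mult abs_mult simp flip: distrib_right intro!: mult_right_mono)
  qed (use a b in auto)
qed

text \<open>The factor \<open>\<bar>x\<bar>\<close> comes from differentiating
  \<open>exp (- (z * x))\<close>. It is absorbed by
  \<open>\<eta> * \<bar>x\<bar> \<le> exp (\<eta> * \<bar>x\<bar>)\<close>, at the price of moving
  the exponent by \<eta> towards an edge.\<close>

lemma abs_mult_exp_strip_le:
  fixes a b u x \<eta> :: real
  assumes "\<eta> > 0" "a + \<eta> \<le> u" "u \<le> b - \<eta>"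
  shows "\<bar>x\<bar> * exp (- (u * x)) \<le> 1 / \<eta> * (exp (- (a * x)) + exp (- (b * x)))"
proof -
  have "\<eta> * \<bar>x\<bar> \<le> exp (\<eta> * \<bar>x\<bar>)" using exp_ge_add_one_self[of "\<eta> * \<bar>x\<bar>"] by linarith
  hence "\<eta> * \<bar>x\<bar> * exp (- (u * x)) \<le> exp (\<eta> * \<bar>x\<bar>) * exp (- (u * x))" by (intro mult_right_mono) auto
  also have "\<dots> \<le> exp (- (a * x)) + exp (- (b * x))"
  proof (cases "x \<ge> 0")
    case True
    have "exp (\<eta> * \<bar>x\<bar>) * exp (- (u * x)) = exp (- ((u - \<eta>) * x))"
      using True by (simp add: algebra_simps flip: exp_add)
    also have "\<dots> \<le> exp (- (a * x)) + exp (- (b * x))" using assms by (intro exp_strip_le) auto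
    finally show ?thesis .
  next
    case False
    have "exp (\<eta> * \<bar>x\<bar>) * exp (- (u * x)) = exp (- ((u + \<eta>) * x))"
      using False by (simp add: algebra_simps flip: exp_add)
    also have "\<dots> \<le> exp (- (a * x)) + exp (- (b * x))" using assms by (intro exp_strip_le) auto
    finally show ?thesis .
  qed
  finally show ?thesis using assms(1) by (simp add: field_simps)
qed

lemma lap_holomorphic:
  assumes a: "integrable lborel (\<lambda>x. exp (- (of_real (a * x))) * g x)"
    and b: "integrable lborel (\<lambda>x. exp (- (of_real (b * x))) * g x)"
    and g [measurable]: "g \<in> borel_measurable borel"
  shows "lap g holomorphic_on {z. a < Re z \<and> Re z < b}"
  unfolding holomorphic_on_def
proof
  fix z assume "z \<in> {z. a < Re z \<and> Re z < b}"
  hence z: "a < Re z" "Re z < b" by auto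
  \<comment> \<open>Half the distance to the nearer edge: every point of
    \<open>ball z \<eta>\<close> keeps the margin \<eta> that \<open>abs_mult_exp_strip_le\<close>
    demands.\<close>
  define \<eta> where "\<eta> = min (Re z - a) (b - Re z) / 2"
  have \<eta>: "\<eta> > 0" "a + 2 * \<eta> \<le> Re z" "Re z \<le> b - 2 * \<eta>" using z by (auto simp: \<eta>_def)
  have gz: "integrable lborel (\<lambda>x. exp (- (w * of_real x)) * g x)" if "w \<in> ball z \<eta>" for w
  proof -
    have "\<bar>Re (z - w)\<bar> < \<eta>" using that abs_Re_le_cmod[of "z - w"] by (simp add: dist_norm)
    thus ?thesis using \<eta> by (intro lap_integrable[OF a b _ _ g]) auto
  qed
  have quot: "norm ((exp (- (w * of_real x)) - exp (- (z * of_real x))) / (w - z)) \<le>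
      1 / \<eta> * (exp (- (a * x)) + exp (- (b * x)))" if w: "w \<in> ball z \<eta>" "w \<noteq> z" for w x
  proof -
    have "norm (exp (- (w * of_real x)) - exp (- (z * of_real x))) \<le>
      (1 / \<eta> * (exp (- (a * x)) + exp (- (b * x)))) * norm (w - z)"
    proof (rule field_differentiable_bound[where S = "ball z \<eta>" and f' = "\<lambda>w. - of_real x * exp (- (w * of_real x))"])
      fix v assume v: "v \<in> ball z \<eta>"
      show "((\<lambda>w. exp (- (w * of_real x))) has_field_derivative - of_real x * exp (- (v * of_real x))) (at v within ball z \<eta>)"
        by (auto intro!: derivative_eq_intros)
      have "\<bar>Re (z - v)\<bar> < \<eta>" using v abs_Re_le_cmod[of "z - v"] by (simp add: dist_norm)
      hence "\<bar>x\<bar> * exp (- (Re v * x)) \<le> 1 / \<eta> * (exp (- (a * x)) + exp (- (b * x)))"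
        using \<eta> by (intro abs_mult_exp_strip_le) auto
      thus "norm (- of_real x * exp (- (v * of_real x))) \<le> 1 / \<eta> * (exp (- (a * x)) + exp (- (b * x)))"
        by (simp add: norm_mult)
    qed (use w \<eta> in auto)
    thus ?thesis using w by (simp add: norm_divide divide_le_eq)
  qed
  define D where "D = (LINT x|lborel. (- of_real x * exp (- (z * of_real x))) * g x)"
  have "((\<lambda>w. (lap g w - lap g z) / (w - z)) \<longlongrightarrow> D) (at z within {z. a < Re z \<and> Re z < b})"
    unfolding tendsto_at_iff_sequentially o_def
  proof (intro allI impI)
    fix X assume X: "\<forall>i. X i \<in> {z. a < Re z \<and> Re z < b} - {z}" "X \<longlonglongrightarrow> z"
    obtain N where N: "\<And>n. n \<ge> N \<Longrightarrow> X n \<in> ball z \<eta>"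
      using X(2) \<eta>(1) unfolding lim_sequentially by (auto simp: dist_commute)
    \<comment> \<open>Finitely many terms of \<open>X\<close> may lie outside the ball on which the
      difference quotients are bounded; without them the majorant holds for every index.\<close>
    define Y where "Y = (\<lambda>n. X (n + N))"
    have Y: "Y n \<in> ball z \<eta>" "Y n \<noteq> z" for n using N[of "n + N"] X(1) by (auto simp: Y_def)
    have Yl: "Y \<longlonglongrightarrow> z" unfolding Y_def using X(2) by (rule LIMSEQ_ignore_initial_segment)
    define q where "q = (\<lambda>n x. (exp (- (Y n * of_real x)) - exp (- (z * of_real x))) / (Y n - z))"
    define B where "B = (\<lambda>x. 1 / \<eta> * (norm (exp (- (of_real (a * x))) * g x) + norm (exp (- (of_real (b * x))) * g x)))"
    have [measurable]: "q n \<in> borel_measurable borel" for n unfolding q_def by measurable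
    have "(\<lambda>n. LINT x|lborel. q n x * g x) \<longlonglongrightarrow> D"
      unfolding D_def
    proof (rule integral_dominated_convergence[where w = B])
      have "(\<lambda>n. q n x) \<longlonglongrightarrow> - of_real x * exp (- (z * of_real x))" for x
      proof -
        have "((\<lambda>w. exp (- (w * of_real x))) has_field_derivative - of_real x * exp (- (z * of_real x))) (at z)"
          by (auto intro!: derivative_eq_intros)
        hence "((\<lambda>w. (exp (- (w * of_real x)) - exp (- (z * of_real x))) / (w - z)) \<longlongrightarrow> - of_real x * exp (- (z * of_real x))) (at z)"
          unfolding has_field_derivative_iff .
        moreover have "filterlim Y (at z) sequentially" using Yl Y(2) by (simp add: filterlim_at)
        ultimately show ?thesis unfolding q_def by (rule filterlim_compose)
      qed
      thus "AE x in lborel. (\<lambda>n. q n x * g x) \<longlonglongrightarrow> (- of_real x * exp (- (z * of_real x))) * g x"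
        by (intro AE_I2 tendsto_mult tendsto_const)
      show "AE x in lborel. norm (q n x * g x) \<le> B x" for n
      proof (rule AE_I2)
        fix x
        have "norm (q n x * g x) \<le>
            (1 / \<eta> * (exp (- (a * x)) + exp (- (b * x)))) * norm (g x)"
          unfolding norm_mult[of _ "g x"] q_def by (intro mult_right_mono quot Y) simp
        also have "\<dots> = B x"
          by (simp only: B_def norm_mult norm_exp_eq_Re) (simp add: algebra_simps)
        finally show "norm (q n x * g x) \<le> B x" .
      qed
    qed (use a b in \<open>auto simp: B_def\<close>)
    moreover have "(LINT x|lborel. q n x * g x) =
        (lap g (Y n) - lap g z) / (Y n - z)" for n
    proof -
      have "lap g (Y n) - lap g z = (LINT x|lborel. exp (- (Y n * of_real x)) * g x - exp (- (z * of_real x)) * g x)"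
        unfolding lap_def using gz Y \<eta>(1) by (intro Bochner_Integration.integral_diff[symmetric]) auto
      moreover have "q n x * g x =
          (exp (- (Y n * of_real x)) * g x - exp (- (z * of_real x)) * g x) / (Y n - z)" for x
        by (simp add: q_def left_diff_distrib)
      ultimately show ?thesis by (metis (no_types, lifting) Bochner_Integration.integral_cong integral_divide_zero)
    qed
    ultimately have "(\<lambda>n. (lap g (Y n) - lap g z) / (Y n - z)) \<longlonglongrightarrow> D" by (simp only:)
    thus "(\<lambda>n. (lap g (X n) - lap g z) / (X n - z)) \<longlonglongrightarrow> D"
      unfolding Y_def by (rule LIMSEQ_offset[where f = "\<lambda>n. (lap g (X n) - lap g z) / (X n - z)"])
  qed
  hence "(lap g has_field_derivative D) (at z within {z. a < Re z \<and> Re z < b})"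
    by (simp add: has_field_derivative_iff)
  thus "lap g field_differentiable at z within {z. a < Re z \<and> Re z < b}"
    unfolding field_differentiable_def by (rule exI)
qed

lemma lap_shift: "lap (\<lambda>x. g (x - t)) z = exp (- (z * of_real t)) * lap g z"
proof -
  have "lap (\<lambda>x. g (x - t)) z = (LINT x|lborel. exp (- (z * of_real (t + x))) * g x)"
    unfolding lap_def by (subst lborel_integral_real_affine[where c = 1 and t = t]) simp_all
  thus ?thesis by (simp add: lap_def distrib_left exp_add mult.assoc exp_diff divide_inverse exp_minus)
qed

lemma ft_eq_lap: "ft (\<lambda>x. exp (- (\<sigma> * of_real x)) * g x) \<omega> = lap g (\<sigma> - \<i> * of_real \<omega>)"
  unfolding ft_def lap_def by (simp add: algebra_simps exp_diff exp_minus divide_inverse)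

section \<open>Truncated powers and their differences\<close>

text \<open>Since \<open>0 powr a = 0\<close>, this is the power cut off to \<open>t > 0\<close> for
  every \<nu>, including \<nu> = 1; hence the half-open interval in \<open>kap_one\<close>.\<close>

definition tpow :: "real \<Rightarrow> real \<Rightarrow> real" where
  "tpow \<nu> t = max t 0 powr (\<nu> - 1)"

text \<open>For 0 < \<nu> \<le> 1 the Riemann-Liouville kernel is not integrable at infinity. Its
  backward difference is: it decays like \<open>t powr (\<nu> - 2)\<close>, and for \<nu> = 1 it has
  bounded support.\<close>

definition kap :: "real \<Rightarrow> real \<Rightarrow> real \<Rightarrow> real" where
  "kap \<nu> \<delta> t = (tpow \<nu> t - tpow \<nu> (t - \<delta>)) / Gamma \<nu>"

lemma tpow_measurable [measurable]: "tpow \<nu> \<in> borel_measurable borel"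
  unfolding tpow_def by measurable

lemma kap_measurable [measurable]: "kap \<nu> \<delta> \<in> borel_measurable borel"
  unfolding kap_def by measurable

lemma tpow_nonpos [simp]: "t \<le> 0 \<Longrightarrow> tpow \<nu> t = 0"
  by (simp add: tpow_def max_def)

lemma tpow_pos: "t > 0 \<Longrightarrow> tpow \<nu> t = t powr (\<nu> - 1)"
  by (simp add: tpow_def)

lemma tpow_nonneg [simp]: "tpow \<nu> t \<ge> 0"
  by (simp add: tpow_def)

lemma kap_nonpos [simp]: "t \<le> 0 \<Longrightarrow> \<delta> \<ge> 0 \<Longrightarrow> kap \<nu> \<delta> t = 0"
  by (simp add: kap_def)

lemma kap_one: "\<delta> > 0 \<Longrightarrow> kap 1 \<delta> t = indicator {0<..\<delta>} t"
  by (auto simp: kap_def tpow_def max_def indicator_def)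

lemma integrable_lborel_of_integrable_on:
  fixes f :: "real \<Rightarrow> real"
  assumes "f integrable_on S" "\<And>x. x \<in> S \<Longrightarrow> f x \<ge> 0" "f \<in> borel_measurable borel" "S \<in> sets borel"
  shows "integrable lborel (\<lambda>x. indicator S x * f x)"
proof -
  have "set_integrable lebesgue S f"
    using nonnegative_absolutely_integrable_1[OF assms(1,2)] by simp
  hence "integrable lebesgue (\<lambda>x. indicator S x * f x)" by (simp add: set_integrable_def)
  thus ?thesis using assms by (subst (asm) integrable_completion) auto
qed

lemma integrable_tpow_atMost:
  assumes "\<nu> > 0"
  shows "integrable lborel (\<lambda>t. indicator {..c} t * tpow \<nu> t)"
proof (cases "c \<ge> 0")
  case True
  have "integrable lborel (\<lambda>t. indicator {0..c} t * t powr (\<nu> - 1))"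
    by (intro integrable_lborel_of_integrable_on integrable_on_powr_from_0) (use assms True in auto)
  also have "(\<lambda>t. indicator {0..c} t * t powr (\<nu> - 1)) = (\<lambda>t. indicator {..c} t * tpow \<nu> t)"
    by (auto simp: fun_eq_iff tpow_def indicator_def max_def)
  finally show ?thesis .
next
  case False
  hence "(\<lambda>t. indicator {..c} t * tpow \<nu> t) = (\<lambda>t. 0)"
    by (auto simp: fun_eq_iff indicator_def)
  thus ?thesis by simp
qed

text \<open>The mean value theorem; \<open>t \<ge> 2 * \<delta>\<close> keeps the intermediate point
  above \<open>t / 2\<close>.\<close>

lemma tpow_diff_le:
  assumes \<nu>: "0 < \<nu>" "\<nu> \<le> 1" and \<delta>: "\<delta> > 0" and t: "t \<ge> 2 * \<delta>"
  shows "\<bar>tpow \<nu> t - tpow \<nu> (t - \<delta>)\<bar> \<le> \<delta> * (1 - \<nu>) * (t / 2) powr (\<nu> - 2)"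
proof -
  obtain \<xi> where \<xi>: "t - \<delta> < \<xi>" "\<xi> < t" "t powr (\<nu> - 1) - (t - \<delta>) powr (\<nu> - 1) = (t - (t - \<delta>)) * ((\<nu> - 1) * \<xi> powr (\<nu> - 1 - 1))"
    using MVT2[of "t - \<delta>" t "\<lambda>t. t powr (\<nu> - 1)" "\<lambda>t. (\<nu> - 1) * t powr (\<nu> - 1 - 1)"] \<delta> t
    by (force intro!: derivative_eq_intros)
  have "\<bar>tpow \<nu> t - tpow \<nu> (t - \<delta>)\<bar> = \<delta> * (1 - \<nu>) * \<xi> powr (\<nu> - 2)"
    using \<xi> \<delta> t \<nu> by (simp add: tpow_pos abs_mult)
  also have "\<dots> \<le> \<delta> * (1 - \<nu>) * (t / 2) powr (\<nu> - 2)"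
    using \<xi>(1,2) \<delta> t \<nu> by (intro mult_left_mono powr_mono2') auto
  finally show ?thesis .
qed

lemma kap_integrable:
  assumes \<nu>: "0 < \<nu>" "\<nu> \<le> 1" and \<delta>: "\<delta> > 0"
  shows "integrable lborel (kap \<nu> \<delta>)"
proof -
  have 1: "integrable lborel (\<lambda>t. indicator {..2 * \<delta>} t * tpow \<nu> t)"
    by (rule integrable_tpow_atMost[OF \<nu>(1)])
  have "integrable lborel (\<lambda>t. indicator {..\<delta>} (- \<delta> + 1 * t) * tpow \<nu> (- \<delta> + 1 * t))"
    by (rule lborel_integrable_real_affine[OF integrable_tpow_atMost[OF \<nu>(1)]]) simp
  also have "(\<lambda>t. indicator {..\<delta>} (- \<delta> + 1 * t) * tpow \<nu> (- \<delta> + 1 * t)) = (\<lambda>t. indicator {..2 * \<delta>} t * tpow \<nu> (t - \<delta>))"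
    by (auto simp: fun_eq_iff indicator_def)
  finally have 2: "integrable lborel (\<lambda>t. indicator {..2 * \<delta>} t * tpow \<nu> (t - \<delta>))" .
  have 3: "integrable lborel (\<lambda>t. indicator {2 * \<delta>..} t * (\<delta> * (1 - \<nu>) * (t / 2) powr (\<nu> - 2)))"
  \<comment> \<open>At \<nu> = 1 the power \<open>t powr (- 1)\<close> is not integrable at
    infinity, but the factor \<open>1 - \<nu>\<close> annihilates the majorant.\<close>
  proof (cases "\<nu> = 1")
    case False
    have "integrable lborel (\<lambda>t. indicator {2 * \<delta>..} t * t powr (\<nu> - 2))"
      by (intro integrable_lborel_of_integrable_on has_integral_integrable[OF has_integral_powr_to_inf])
         (use False \<nu> \<delta> in auto)
    hence "integrable lborel (\<lambda>t. (\<delta> * (1 - \<nu>) / 2 powr (\<nu> - 2)) * (indicator {2 * \<delta>..} t * t powr (\<nu> - 2)))"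
      by simp
    also have "(\<lambda>t. (\<delta> * (1 - \<nu>) / 2 powr (\<nu> - 2)) * (indicator {2 * \<delta>..} t * t powr (\<nu> - 2))) =
        (\<lambda>t. indicator {2 * \<delta>..} t * (\<delta> * (1 - \<nu>) * (t / 2) powr (\<nu> - 2)))"
      using \<delta> by (auto simp: fun_eq_iff indicator_def powr_divide)
    finally show ?thesis .
  qed simp
  have "integrable lborel (\<lambda>t. tpow \<nu> t - tpow \<nu> (t - \<delta>))"
  proof (rule Bochner_Integration.integrable_bound)
    show "integrable lborel (\<lambda>t. indicator {..2 * \<delta>} t * tpow \<nu> t + indicator {..2 * \<delta>} t * tpow \<nu> (t - \<delta>) +
       indicator {2 * \<delta>..} t * (\<delta> * (1 - \<nu>) * (t / 2) powr (\<nu> - 2)))"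
      by (intro Bochner_Integration.integrable_add 1 2 3)
    show "AE t in lborel. norm (tpow \<nu> t - tpow \<nu> (t - \<delta>)) \<le> norm (indicator {..2 * \<delta>} t * tpow \<nu> t +
        indicator {..2 * \<delta>} t * tpow \<nu> (t - \<delta>) + indicator {2 * \<delta>..} t * (\<delta> * (1 - \<nu>) * (t / 2) powr (\<nu> - 2)))"
    proof (rule AE_I2)
      fix t
      consider "t < 2 * \<delta>" | "t = 2 * \<delta>" | "t > 2 * \<delta>" by linarith
      thus "norm (tpow \<nu> t - tpow \<nu> (t - \<delta>)) \<le> norm (indicator {..2 * \<delta>} t * tpow \<nu> t +
        indicator {..2 * \<delta>} t * tpow \<nu> (t - \<delta>) + indicator {2 * \<delta>..} t * (\<delta> * (1 - \<nu>) * (t / 2) powr (\<nu> - 2)))"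
      proof cases
        case 1
        thus ?thesis using tpow_nonneg[of \<nu> t] tpow_nonneg[of \<nu> "t - \<delta>"] by (simp, linarith)
      next
        case 2
        have "0 \<le> \<delta> * (1 - \<nu>) * (t / 2) powr (\<nu> - 2)" using \<nu> \<delta> by simp
        moreover have i: "indicat_real {..2 * \<delta>} t = 1" "indicat_real {2 * \<delta>..} t = 1" using 2 by auto
        ultimately show ?thesis
          unfolding i mult_1 real_norm_def using tpow_nonneg[of \<nu> t] tpow_nonneg[of \<nu> "t - \<delta>"] by linarith
      next
        case 3
        thus ?thesis using tpow_diff_le[OF \<nu> \<delta>, of t] by simp
      qed
    qed
  qed simp
  thus ?thesis unfolding kap_def[abs_def] by simp
qed

text \<open>Two separate reasons: for \<open>Re z \<ge> 0\<close> the exponential is bounded on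
  \<open>t > 0\<close>; for \<nu> = 1 the kernel lives on \<open>{0<..\<delta>}\<close>, where every
  exponential is bounded. \<open>M\<close> covers both.\<close>

lemma kap_exp_integrable:
  assumes \<nu>: "0 < \<nu>" "\<nu> \<le> 1" and \<delta>: "\<delta> > 0" and z: "Re z \<ge> 0 \<or> \<nu> = 1"
  shows "integrable lborel (\<lambda>t. exp (- (z * of_real t)) * of_real (kap \<nu> \<delta> t))"
proof (rule Bochner_Integration.integrable_bound)
  define M where "M = max 1 (exp (- (Re z * \<delta>)))"
  show "integrable lborel (\<lambda>t. M * kap \<nu> \<delta> t)"
    using kap_integrable[OF \<nu> \<delta>] by simp
  show "AE t in lborel. norm (exp (- (z * of_real t)) * of_real (kap \<nu> \<delta> t)) \<le> norm (M * kap \<nu> \<delta> t)"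
  proof (rule AE_I2)
    fix t
    have "exp (- (Re z * t)) \<le> M" if "kap \<nu> \<delta> t \<noteq> 0"
    proof -
      have t: "t > 0" using that \<delta> by (cases "t > 0") auto
      show ?thesis
      proof (cases "Re z \<ge> 0")
        case True
        thus ?thesis using t by (simp add: M_def le_max_iff_disj)
      next
        case False
        hence "t \<le> \<delta>" using that z kap_one[OF \<delta>, of t] by (auto simp: indicator_def split: if_splits)
        hence "exp (- (Re z * t)) \<le> exp (- (Re z * \<delta>))" using False by (simp add: mult_left_mono_neg)
        thus ?thesis by (simp add: M_def le_max_iff_disj)
      qed
    qed
    hence "exp (- (Re z * t)) * \<bar>kap \<nu> \<delta> t\<bar> \<le> M * \<bar>kap \<nu> \<delta> t\<bar>"
      by (cases "kap \<nu> \<delta> t = 0") (auto intro: mult_right_mono)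
    moreover have "M \<ge> 0" by (simp add: M_def)
    ultimately show "norm (exp (- (z * of_real t)) * of_real (kap \<nu> \<delta> t)) \<le> norm (M * kap \<nu> \<delta> t)"
      by (simp add: norm_mult abs_mult)
  qed
qed simp

lemma tpow_laplace_real:
  assumes \<nu>: "\<nu> > 0" and a: "a > 0"
  shows "integrable lborel (\<lambda>t. exp (- (a * t)) * tpow \<nu> t)"
    and "(LINT t|lborel. exp (- (a * t)) * tpow \<nu> t) = Gamma \<nu> * a powr (- \<nu>)"
proof -
  let ?f = "\<lambda>t. exp (- t) * tpow \<nu> t"
  have feq: "indicator {0..} t * t powr (\<nu> - 1) / exp t = ?f t" for t :: real
    by (auto simp: indicator_def tpow_def max_def exp_minus field_simps)
  have "(\<integral>\<^sup>+t. ennreal (?f t) \<partial>lborel) = ennreal (Gamma \<nu>)"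
    using Gamma_conv_nn_integral_real[OF \<nu>] unfolding feq by simp
  hence f: "integrable lborel ?f" "(LINT t|lborel. ?f t) = Gamma \<nu>"
    using \<nu> by (subst (asm) nn_integral_eq_integrable; simp)+
  have sc: "?f (a * t) = a powr (\<nu> - 1) * (exp (- (a * t)) * tpow \<nu> t)" for t
    using a by (cases "t > 0") (simp_all add: tpow_pos powr_mult mult_nonneg_nonpos not_less)
  have "integrable lborel (\<lambda>t. ?f (0 + a * t))"
    by (rule lborel_integrable_real_affine[OF f(1)]) (use a in simp)
  thus "integrable lborel (\<lambda>t. exp (- (a * t)) * tpow \<nu> t)"
    unfolding add_0 sc using a by simp
  have "Gamma \<nu> = \<bar>a\<bar> *\<^sub>R (LINT t|lborel. ?f (0 + a * t))"
    unfolding f(2)[symmetric] by (rule lborel_integral_real_affine) (use a in simp)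
  also have "\<dots> = a powr \<nu> * (LINT t|lborel. exp (- (a * t)) * tpow \<nu> t)"
    unfolding add_0 sc using a by (simp add: powr_diff)
  finally show "(LINT t|lborel. exp (- (a * t)) * tpow \<nu> t) = Gamma \<nu> * a powr (- \<nu>)"
    using a by (simp add: powr_minus field_simps)
qed

lemma tpow_exp_integrable:
  assumes \<nu>: "\<nu> > 0" and z: "Re z > 0"
  shows "integrable lborel (\<lambda>t. exp (- (z * of_real t)) * complex_of_real (tpow \<nu> t))"
  by (rule Bochner_Integration.integrable_bound[OF tpow_laplace_real(1)[OF \<nu> z]]) (auto simp: norm_mult)

text \<open>On the positive axis this is Euler's integral after scaling; both sides are holomorphic
  in the right half-plane, so the identity theorem extends it.\<close>

lemma lap_tpow:
  assumes \<nu>: "\<nu> > 0" and z: "Re z > 0"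
  shows "lap (\<lambda>t. of_real (tpow \<nu> t)) z = of_real (Gamma \<nu>) * z powr (- of_real \<nu>)"
proof -
  let ?F = "\<lambda>z. lap (\<lambda>t. of_real (tpow \<nu> t)) z - of_real (Gamma \<nu>) * z powr (- of_real \<nu>)"
  have "?F z = 0"
  proof (rule analytic_continuation[where f = ?F and S = "{z. 0 < Re z}" and U = "of_real ` {0<..}" and \<xi> = 1])
    show "?F holomorphic_on {z. 0 < Re z}"
    proof (intro holomorphic_intros)
      have "lap (\<lambda>t. of_real (tpow \<nu> t)) field_differentiable at w within {z. 0 < Re z}" if w: "Re w > 0" for w
      proof -
        \<comment> \<open>\<open>lap_holomorphic\<close> speaks of strips with integrable edges, so
          the half-plane is covered by a strip around each \<open>w\<close>.\<close>
        have "lap (\<lambda>t. of_real (tpow \<nu> t)) holomorphic_on {z. Re w / 2 < Re z \<and> Re z < Re w + 1}"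
          by (rule lap_holomorphic) (use tpow_exp_integrable[OF \<nu>, of "of_real (Re w / 2)"]
              tpow_exp_integrable[OF \<nu>, of "of_real (Re w + 1)"] w in \<open>auto\<close>)
        moreover have "open {z. Re w / 2 < Re z \<and> Re z < Re w + 1}"
          by (intro open_Collect_conj open_halfspace_Re_gt open_halfspace_Re_lt)
        ultimately have "lap (\<lambda>t. of_real (tpow \<nu> t)) field_differentiable at w"
          by (rule holomorphic_on_imp_differentiable_at) (use w in simp)
        thus ?thesis by (rule field_differentiable_at_within)
      qed
      thus "lap (\<lambda>t. of_real (tpow \<nu> t)) holomorphic_on {z. 0 < Re z}"
        by (auto simp: holomorphic_on_def)
    qed (auto simp: complex_nonpos_Reals_iff)
    show "open {z. 0 < Re z}" by (rule open_halfspace_Re_gt)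
    show "connected {z. 0 < Re z}" by (intro convex_connected convex_halfspace_Re_gt)
    show "(1::complex) islimpt of_real ` {0<..}"
      unfolding islimpt_approachable
    proof (intro allI impI)
      fix e :: real assume "e > 0"
      thus "\<exists>x'\<in>of_real ` {0<..}. x' \<noteq> (1::complex) \<and> dist x' 1 < e"
        by (intro bexI[of _ "of_real (1 + e / 2)"] imageI conjI) (auto simp: dist_norm norm_divide)
    qed
    fix w :: complex assume "w \<in> of_real ` {0<..}"
    then obtain a where a: "w = of_real a" "a > 0" by auto
    have "lap (\<lambda>t. of_real (tpow \<nu> t)) w = of_real (LINT t|lborel. exp (- (a * t)) * tpow \<nu> t)"
      unfolding lap_def a by (subst integral_complex_of_real[symmetric]) (simp flip: exp_of_real)
    thus "?F w = 0" using tpow_laplace_real(2)[OF \<nu> a(2)] a by (simp add: powr_of_real flip: of_real_minus)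
  qed (use z in auto)
  thus ?thesis by simp
qed

text \<open>For \<open>Re z > 0\<close> the two terms of \<open>kap\<close> are transformed
  separately. On the imaginary axis the formula is a limit from the right, where the principal power
  is continuous away from 0. For \<nu> = 1 it is an elementary integral, valid on either side of the
  axis.\<close>

lemma lap_kap:
  assumes \<nu>: "0 < \<nu>" "\<nu> \<le> 1" and \<delta>: "\<delta> > 0" and z: "Re z \<ge> 0 \<or> \<nu> = 1" "z \<noteq> 0"
  shows "lap (\<lambda>t. of_real (kap \<nu> \<delta> t)) z = (1 - exp (- (z * of_real \<delta>))) * z powr (- of_real \<nu>)"
proof -
  have G: "Gamma \<nu> > 0" using \<nu> by simp
  have pos: "lap (\<lambda>t. of_real (kap \<nu> \<delta> t)) w = (1 - exp (- (w * of_real \<delta>))) * w powr (- of_real \<nu>)" if w: "Re w > 0" for w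
  proof -
    have i1: "integrable lborel (\<lambda>t. exp (- (w * of_real t)) * complex_of_real (tpow \<nu> t))"
      by (rule tpow_exp_integrable[OF \<nu>(1) w])
    have "integrable lborel (\<lambda>t. exp (- (w * of_real (- \<delta> + 1 * t))) * complex_of_real (tpow \<nu> (- \<delta> + 1 * t)))"
      by (rule lborel_integrable_real_affine[OF i1]) simp
    hence "integrable lborel (\<lambda>t. exp (- (w * of_real \<delta>)) * (exp (- (w * of_real (- \<delta> + 1 * t))) * complex_of_real (tpow \<nu> (- \<delta> + 1 * t))))"
      by simp
    also have "(\<lambda>t. exp (- (w * of_real \<delta>)) * (exp (- (w * of_real (- \<delta> + 1 * t))) * complex_of_real (tpow \<nu> (- \<delta> + 1 * t)))) =
        (\<lambda>t. exp (- (w * of_real t)) * complex_of_real (tpow \<nu> (t - \<delta>)))"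
      by (simp add: fun_eq_iff algebra_simps flip: exp_add)
    finally have i2: "integrable lborel (\<lambda>t. exp (- (w * of_real t)) * complex_of_real (tpow \<nu> (t - \<delta>)))" .
    have "lap (\<lambda>t. of_real (kap \<nu> \<delta> t)) w = (LINT t|lborel. (exp (- (w * of_real t)) * complex_of_real (tpow \<nu> t) -
        exp (- (w * of_real t)) * complex_of_real (tpow \<nu> (t - \<delta>))) / of_real (Gamma \<nu>))"
      unfolding lap_def kap_def by (simp add: right_diff_distrib)
    also have "\<dots> = (lap (\<lambda>t. of_real (tpow \<nu> t)) w - lap (\<lambda>t. of_real (tpow \<nu> (t - \<delta>))) w) / of_real (Gamma \<nu>)"
      unfolding integral_divide_zero lap_def by (subst Bochner_Integration.integral_diff[OF i1 i2]) simp
    also have "\<dots> = (1 - exp (- (w * of_real \<delta>))) * w powr (- of_real \<nu>)"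
      unfolding lap_shift[of "\<lambda>t. of_real (tpow \<nu> t)"] lap_tpow[OF \<nu>(1) w] using G by (simp add: field_simps)
    finally show ?thesis .
  qed
  consider "Re z > 0" | "Re z = 0" | "\<nu> = 1" using z(1) by linarith
  thus ?thesis
  proof cases
    case 1
    thus ?thesis by (rule pos)
  next
    case 2
    define X where "X = (\<lambda>n. z + of_real (inverse (real (Suc n))))"
    have X: "X \<longlonglongrightarrow> z" unfolding X_def
      using tendsto_add[OF tendsto_const tendsto_of_real[OF LIMSEQ_inverse_real_of_nat], of z] by simp
    have kb: "(\<lambda>t. complex_of_real (kap \<nu> \<delta> t)) \<in> borel_measurable borel" by simp
    have "continuous_on {z. 0 \<le> Re z \<and> Re z \<le> 1} (lap (\<lambda>t. of_real (kap \<nu> \<delta> t)))"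
      by (rule lap_continuous[OF _ _ kb]) (use kap_exp_integrable[OF \<nu> \<delta>, of 0] kap_exp_integrable[OF \<nu> \<delta>, of 1] in auto)
    moreover have "X n \<in> {z. 0 \<le> Re z \<and> Re z \<le> 1}" for n using 2 by (simp add: X_def field_simps)
    ultimately have A: "(\<lambda>n. lap (\<lambda>t. of_real (kap \<nu> \<delta> t)) (X n)) \<longlonglongrightarrow> lap (\<lambda>t. of_real (kap \<nu> \<delta> t)) z"
      unfolding continuous_on_sequentially o_def using X 2 by auto
    have "(\<lambda>n. (1 - exp (- (X n * of_real \<delta>))) * X n powr (- of_real \<nu>)) \<longlonglongrightarrow> (1 - exp (- (z * of_real \<delta>))) * z powr (- of_real \<nu>)"
      using 2 z(2) by (intro tendsto_intros X) (auto simp: complex_nonpos_Reals_iff complex_eq_iff)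
    moreover have "lap (\<lambda>t. of_real (kap \<nu> \<delta> t)) (X n) = (1 - exp (- (X n * of_real \<delta>))) * X n powr (- of_real \<nu>)" for n
      using 2 by (intro pos) (simp add: X_def)
    ultimately show ?thesis using A LIMSEQ_unique by auto
  next
    case 3
    define E where "E = (\<lambda>t::real. - exp (- (z * of_real t)) / z)"
    have der: "(E has_vector_derivative exp (- (z * of_real t))) (at t within S)" for t S
      unfolding E_def
      by (rule has_vector_derivative_real_field[where f = "\<lambda>w. - exp (- (z * w)) / z"])
         (use z(2) in \<open>auto intro!: derivative_eq_intros\<close>)
    have "(LINT t|lborel. indicator {0..\<delta>} t *\<^sub>R exp (- (z * of_real t))) = E \<delta> - E 0"
      by (rule integral_FTC_Icc) (use \<delta> der in \<open>auto intro!: continuous_intros\<close>)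
    also have "(LINT t|lborel. indicator {0..\<delta>} t *\<^sub>R exp (- (z * of_real t))) = lap (\<lambda>t. of_real (kap \<nu> \<delta> t)) z"
      unfolding lap_def
    proof (rule integral_cong_AE)
      show "AE t in lborel. indicator {0..\<delta>} t *\<^sub>R exp (- (z * of_real t)) = exp (- (z * of_real t)) * of_real (kap \<nu> \<delta> t)"
        \<comment> \<open>The closed interval contains 0, where \<open>kap 1 \<delta>\<close>
          vanishes.\<close>
        using AE_lborel_singleton[of 0] by eventually_elim (auto simp: 3 kap_one[OF \<delta>] indicator_def)
    qed auto
    finally show ?thesis using z(2) by (simp add: E_def 3 powr_minus field_simps)
  qed
qed

section \<open>Fourier representation of the fractional derivatives\<close>

text \<open>Conjugation by \<open>exp (\<sigma> x)\<close> turns this into the ordinary backward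
  difference. Its Fourier symbol is \<open>1 - exp (- (z * \<delta>))\<close> with
  \<open>z = \<sigma> - \<i> \<omega>\<close>.\<close>

definition tdiff :: "complex \<Rightarrow> real \<Rightarrow> (real \<Rightarrow> complex) \<Rightarrow> real \<Rightarrow> complex" where
  "tdiff \<sigma> \<delta> g x = g x - exp (- (\<sigma> * of_real \<delta>)) * g (x - \<delta>)"

definition diff_kernel :: "complex \<Rightarrow> real \<Rightarrow> real \<Rightarrow> real \<Rightarrow> complex" where
  "diff_kernel \<sigma> \<nu> \<delta> t = exp (- (\<sigma> * of_real t)) * of_real (kap \<nu> \<delta> t)"

text \<open>The integral of \<open>exp (- (\<sigma> * t)) * q (x - t)\<close> over
  \<open>0 < t \<le> \<delta>\<close>. It takes \<open>q' + \<sigma> q\<close> to the twisted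
  difference of \<open>q\<close>, which trades derivatives for differences.\<close>

abbreviation tmean :: "complex \<Rightarrow> real \<Rightarrow> (real \<Rightarrow> complex) \<Rightarrow> real \<Rightarrow> complex" where
  "tmean \<sigma> \<delta> \<equiv> conv (diff_kernel \<sigma> 1 \<delta>)"

definition frac_kernel :: "complex \<Rightarrow> real \<Rightarrow> real \<Rightarrow> complex" where
  "frac_kernel \<sigma> \<nu> t = exp (- (\<sigma> * of_real t)) * of_real (tpow \<nu> t / Gamma \<nu>)"

lemma diff_kernel_measurable [measurable]: "diff_kernel \<sigma> \<nu> \<delta> \<in> borel_measurable borel"
  unfolding diff_kernel_def by measurable

lemma diff_kernel_eq: "diff_kernel \<sigma> \<nu> \<delta> = tdiff \<sigma> \<delta> (frac_kernel \<sigma> \<nu>)"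
proof
  fix t
  have "exp (- (\<sigma> * of_real \<delta>)) * exp (- (\<sigma> * of_real (t - \<delta>))) = exp (- (\<sigma> * of_real t))"
    by (simp add: algebra_simps flip: exp_add)
  thus "diff_kernel \<sigma> \<nu> \<delta> t = tdiff \<sigma> \<delta> (frac_kernel \<sigma> \<nu>) t"
    by (simp add: diff_kernel_def tdiff_def frac_kernel_def kap_def diff_divide_distrib right_diff_distrib mult.assoc[symmetric])
qed

lemma conv_shift:
  "conv k q (x - \<delta>) = (LINT t|lborel. k (x - t) * q (t - \<delta>))"
  "integrable lborel (\<lambda>t. k (x - \<delta> - t) * q t) \<Longrightarrow> integrable lborel (\<lambda>t. k (x - t) * q (t - \<delta>))"
proof -
  show "conv k q (x - \<delta>) = (LINT t|lborel. k (x - t) * q (t - \<delta>))"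
    unfolding conv_def by (subst lborel_integral_real_affine[where c = 1 and t = "- \<delta>"]) simp_all
  assume "integrable lborel (\<lambda>t. k (x - \<delta> - t) * q t)"
  from lborel_integrable_real_affine[OF this, of 1 "- \<delta>"]
  show "integrable lborel (\<lambda>t. k (x - t) * q (t - \<delta>))" by simp
qed

text \<open>Only pointwise existence of the convolution is assumed, since the rule is meant for
  \<open>frac_kernel\<close>, which need not be integrable.\<close>

lemma conv_tdiff:
  assumes "\<And>x. integrable lborel (\<lambda>t. k (x - t) * q t)"
  shows "conv k (tdiff \<sigma> \<delta> q) = tdiff \<sigma> \<delta> (conv k q)"
    and "integrable lborel (\<lambda>t. k (x - t) * tdiff \<sigma> \<delta> q t)"
proof -
  have eq: "k (x - t) * tdiff \<sigma> \<delta> q t = k (x - t) * q t - exp (- (\<sigma> * of_real \<delta>)) * (k (x - t) * q (t - \<delta>))" for x t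
    by (simp add: tdiff_def algebra_simps)
  have i: "integrable lborel (\<lambda>t. exp (- (\<sigma> * of_real \<delta>)) * (k (x - t) * q (t - \<delta>)))" for x
    using conv_shift(2)[of k x \<delta> q] assms by simp
  show "integrable lborel (\<lambda>t. k (x - t) * tdiff \<sigma> \<delta> q t)"
    unfolding eq by (intro Bochner_Integration.integrable_diff assms i)
  show "conv k (tdiff \<sigma> \<delta> q) = tdiff \<sigma> \<delta> (conv k q)"
  proof
    fix x
    have "conv k (tdiff \<sigma> \<delta> q) x = conv k q x - (LINT t|lborel. exp (- (\<sigma> * of_real \<delta>)) * (k (x - t) * q (t - \<delta>)))"
      unfolding conv_def eq by (rule Bochner_Integration.integral_diff[OF assms i])
    thus "conv k (tdiff \<sigma> \<delta> q) x = tdiff \<sigma> \<delta> (conv k q) x"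
      by (simp add: tdiff_def conv_shift(1))
  qed
qed

lemma tdiff_conv:
  assumes "\<And>x. integrable lborel (\<lambda>t. k (x - t) * q t)"
  shows "conv (tdiff \<sigma> \<delta> k) q = tdiff \<sigma> \<delta> (conv k q)"
    and "integrable lborel (\<lambda>t. tdiff \<sigma> \<delta> k (x - t) * q t)"
proof -
  have eq: "tdiff \<sigma> \<delta> k (x - t) * q t = k (x - t) * q t - exp (- (\<sigma> * of_real \<delta>)) * (k (x - \<delta> - t) * q t)" for x t
    by (simp add: tdiff_def algebra_simps)
  have i: "integrable lborel (\<lambda>t. exp (- (\<sigma> * of_real \<delta>)) * (k (x - \<delta> - t) * q t))" for x
    using assms by simp
  show "integrable lborel (\<lambda>t. tdiff \<sigma> \<delta> k (x - t) * q t)"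
    unfolding eq by (intro Bochner_Integration.integrable_diff assms i)
  show "conv (tdiff \<sigma> \<delta> k) q = tdiff \<sigma> \<delta> (conv k q)"
    unfolding conv_def[abs_def] eq by (subst Bochner_Integration.integral_diff[OF assms i]) (simp add: tdiff_def[abs_def])
qed

lemma tdiff_integrable:
  assumes "integrable lborel g"
  shows "integrable lborel (tdiff \<sigma> \<delta> g)"
proof -
  have "integrable lborel (\<lambda>x. g (x - \<delta>))"
    using lborel_integrable_real_affine[OF assms, of 1 "- \<delta>"] by simp
  thus ?thesis unfolding tdiff_def[abs_def] using assms by simp
qed

lemma ft_tdiff:
  assumes "integrable lborel g"
  shows "ft (tdiff \<sigma> \<delta> g) \<omega> = (1 - exp (- ((\<sigma> - \<i> * of_real \<omega>) * of_real \<delta>))) * ft g \<omega>"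
proof -
  have "integrable lborel (\<lambda>x. g (x - \<delta>))"
    using lborel_integrable_real_affine[OF assms, of 1 "- \<delta>"] by simp
  hence "ft (tdiff \<sigma> \<delta> g) \<omega> = ft g \<omega> - exp (- (\<sigma> * of_real \<delta>)) * (iexp (\<omega> * \<delta>) * ft g \<omega>)"
    unfolding tdiff_def[abs_def] using assms by (simp add: ft_diff ft_cmult ft_shift del: of_real_mult)
  thus ?thesis by (simp add: algebra_simps exp_diff exp_minus divide_inverse exp_add)
qed

lemma ft_tdiff_funpow:
  assumes "integrable lborel g"
  shows "integrable lborel ((tdiff \<sigma> \<delta> ^^ j) g)"
    and "ft ((tdiff \<sigma> \<delta> ^^ j) g) \<omega> = (1 - exp (- ((\<sigma> - \<i> * of_real \<omega>) * of_real \<delta>))) ^ j * ft g \<omega>"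
proof -
  have i: "integrable lborel ((tdiff \<sigma> \<delta> ^^ j) g)" for j
    by (induction j) (auto intro: assms tdiff_integrable)
  show "integrable lborel ((tdiff \<sigma> \<delta> ^^ j) g)" by (rule i)
  show "ft ((tdiff \<sigma> \<delta> ^^ j) g) \<omega> = (1 - exp (- ((\<sigma> - \<i> * of_real \<omega>) * of_real \<delta>))) ^ j * ft g \<omega>"
    by (induction j) (simp_all add: ft_tdiff[OF i])
qed

lemma continuous_tdiff: "continuous_on UNIV g \<Longrightarrow> continuous_on UNIV (tdiff \<sigma> \<delta> g)"
  unfolding tdiff_def[abs_def]
  by (intro continuous_on_diff continuous_on_mult continuous_on_const
        continuous_on_compose2[of UNIV g UNIV "\<lambda>x. x - \<delta>"] continuous_on_id) auto

lemma continuous_tdiff_funpow: "continuous_on UNIV g \<Longrightarrow> continuous_on UNIV ((tdiff \<sigma> \<delta> ^^ j) g)"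
  by (induction j) (auto intro: continuous_tdiff)

lemma diff_kernel_integrable:
  assumes "0 < \<nu>" "\<nu> \<le> 1" "\<delta> > 0" "Re \<sigma> \<ge> 0 \<or> \<nu> = 1"
  shows "integrable lborel (diff_kernel \<sigma> \<nu> \<delta>)"
  unfolding diff_kernel_def[abs_def] by (rule kap_exp_integrable[OF assms])

lemma ft_diff_kernel:
  assumes "0 < \<nu>" "\<nu> \<le> 1" "\<delta> > 0" "Re \<sigma> \<ge> 0 \<or> \<nu> = 1" and z: "z = \<sigma> - \<i> * of_real \<omega>" "z \<noteq> 0"
  shows "ft (diff_kernel \<sigma> \<nu> \<delta>) \<omega> = (1 - exp (- (z * of_real \<delta>))) * z powr (- of_real \<nu>)"
  unfolding diff_kernel_def[abs_def] ft_eq_lap z(1)[symmetric]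
  by (rule lap_kap) (use assms in auto)

lemma tmean_integrable: "\<delta> > 0 \<Longrightarrow> integrable lborel q \<Longrightarrow> integrable lborel (tmean \<sigma> \<delta> q)"
  by (intro conv_integrable diff_kernel_integrable) auto

lemma tmean_funpow_integrable:
  assumes "\<delta> > 0" "integrable lborel q"
  shows "integrable lborel ((tmean \<sigma> \<delta> ^^ j) q)"
  by (induction j) (auto intro: assms tmean_integrable)

lemma ft_tmean_funpow:
  assumes \<delta>: "\<delta> > 0" and q: "integrable lborel q" and z: "z = \<sigma> - \<i> * of_real \<omega>" "z \<noteq> 0"
  shows "ft ((tmean \<sigma> \<delta> ^^ j) q) \<omega> = ((1 - exp (- (z * of_real \<delta>))) / z) ^ j * ft q \<omega>"
proof (induction j)
  case (Suc j)
  have "ft ((tmean \<sigma> \<delta> ^^ Suc j) q) \<omega> = ft (diff_kernel \<sigma> 1 \<delta>) \<omega> * ft ((tmean \<sigma> \<delta> ^^ j) q) \<omega>"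
    unfolding funpow.simps o_def by (intro ft_conv diff_kernel_integrable tmean_funpow_integrable \<delta> q) (use \<delta> in auto)
  thus ?case using Suc ft_diff_kernel[OF _ _ \<delta> _ z, of 1] z(2) by (simp add: powr_minus_divide)
qed simp

lemma tmean_continuous_integrable:
  assumes "continuous_on UNIV q" "\<delta> > 0"
  shows "integrable lborel (\<lambda>t. diff_kernel \<sigma> 1 \<delta> (x - t) * q t)"
proof -
  have "integrable lborel (\<lambda>t. indicator {x - \<delta>..x} t *\<^sub>R (exp (- (\<sigma> * of_real (x - t))) * q t))"
    using assms by (intro borel_integrable_compact continuous_intros) (auto intro: continuous_on_subset)
  moreover have [measurable]: "q \<in> borel_measurable borel"
    using assms(1) by (rule borel_measurable_continuous_onI)
  have "AE t in lborel. indicator {x - \<delta>..x} t *\<^sub>R (exp (- (\<sigma> * of_real (x - t))) * q t) = diff_kernel \<sigma> 1 \<delta> (x - t) * q t"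
    using AE_lborel_singleton[of x]
    by eventually_elim (auto simp: diff_kernel_def kap_one[OF assms(2)] indicator_def)
  ultimately show ?thesis by (subst (asm) integrable_cong_AE) auto
qed

text \<open>The derivative is only known to exist everywhere and to be Lebesgue integrable, so the
  fundamental theorem of calculus is applied to the gauge integral.\<close>

lemma tdiff_eq_tmean:
  assumes q: "\<And>t. (q has_vector_derivative (r t - \<sigma> * q t)) (at t)"
    and r: "r \<in> borel_measurable lebesgue" and r0 [measurable]: "r0 \<in> borel_measurable borel"
    and eq: "AE t in lebesgue. r t = r0 t" and \<delta>: "\<delta> > 0"
    and int: "\<And>x. integrable lborel (\<lambda>t. diff_kernel \<sigma> 1 \<delta> (x - t) * r0 t)"
  shows "tdiff \<sigma> \<delta> q = tmean \<sigma> \<delta> r0"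
proof
  fix x
  \<comment> \<open>The exponential is the integrating factor of \<open>q' + \<sigma> q = r\<close>,
    so that \<open>E' = e\<close> without a term in \<open>q\<close>.\<close>
  define E where "E = (\<lambda>t. exp (- (\<sigma> * of_real (x - t))) * q t)"
  define e where "e = (\<lambda>t. exp (- (\<sigma> * of_real (x - t))) * r t)"
  have "(E has_vector_derivative e t) (at t)" for t
  proof -
    have "((\<lambda>t. exp (- (\<sigma> * of_real (x - t)))) has_vector_derivative \<sigma> * exp (- (\<sigma> * of_real (x - t)))) (at t)"
      unfolding of_real_diff
      by (rule has_vector_derivative_real_field[where f = "\<lambda>t. exp (- (\<sigma> * (of_real x - t)))"])
         (auto intro!: derivative_eq_intros)
    from has_vector_derivative_mult[OF this q[of t]] show ?thesis
      unfolding E_def e_def by (simp add: algebra_simps)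
  qed
  hence hi: "(e has_integral (E x - E (x - \<delta>))) {x - \<delta>..x}"
    using \<delta> by (intro fundamental_theorem_of_calculus) (auto intro: has_vector_derivative_at_within)
  have meas: "(\<lambda>t. indicator {x - \<delta>..x} t *\<^sub>R e t) \<in> borel_measurable lebesgue"
  proof -
    have "(\<lambda>t. exp (- (\<sigma> * of_real (x - t)))) \<in> borel_measurable lebesgue"
      by (rule measurable_completion) simp
    thus ?thesis unfolding e_def
      by (intro borel_measurable_scaleR borel_measurable_indicator borel_measurable_times r) auto
  qed
  \<comment> \<open>At \<open>t = x\<close> the kernel vanishes, but the indicator of the closed
    interval does not.\<close>
  have "AE t in lebesgue. t \<noteq> x" using AE_lborel_singleton[of x] by (rule AE_completion)
  with eq have ae: "AE t in lebesgue. diff_kernel \<sigma> 1 \<delta> (x - t) * r0 t = indicator {x - \<delta>..x} t *\<^sub>R e t"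
    by eventually_elim (auto simp: diff_kernel_def kap_one[OF \<delta>] indicator_def e_def)
  have dm: "(\<lambda>t. diff_kernel \<sigma> 1 \<delta> (x - t) * r0 t) \<in> borel_measurable lebesgue"
    by (intro measurable_completion) simp
  have "integrable lebesgue (\<lambda>t. diff_kernel \<sigma> 1 \<delta> (x - t) * r0 t)"
    using int[of x] by (subst integrable_completion) auto
  hence "set_integrable lebesgue {x - \<delta>..x} e"
    unfolding set_integrable_def using integrable_cong_AE[OF dm meas ae] by simp
  hence "(LINT t:{x - \<delta>..x}|lebesgue. e t) = integral {x - \<delta>..x} e"
    by (rule set_lebesgue_integral_eq_integral)
  also have "\<dots> = E x - E (x - \<delta>)" using hi by (rule integral_unique)
  also have "\<dots> = tdiff \<sigma> \<delta> q x" by (simp add: E_def tdiff_def)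
  also have "(LINT t:{x - \<delta>..x}|lebesgue. e t) = (LINT t|lebesgue. diff_kernel \<sigma> 1 \<delta> (x - t) * r0 t)"
    unfolding set_lebesgue_integral_def by (rule integral_cong_AE[OF dm meas ae, symmetric])
  also have "\<dots> = tmean \<sigma> \<delta> r0 x"
    unfolding conv_def by (rule integral_completion) simp
  finally show "tdiff \<sigma> \<delta> q x = tmean \<sigma> \<delta> r0 x" ..
qed

lemma tmean_tdiff_funpow:
  assumes "continuous_on UNIV q" "\<delta> > 0"
  shows "(tdiff \<sigma> \<delta> ^^ j) (tmean \<sigma> \<delta> q) = tmean \<sigma> \<delta> ((tdiff \<sigma> \<delta> ^^ j) q)"
proof (induction j)
  case (Suc j)
  have "tdiff \<sigma> \<delta> (tmean \<sigma> \<delta> ((tdiff \<sigma> \<delta> ^^ j) q)) = tmean \<sigma> \<delta> (tdiff \<sigma> \<delta> ((tdiff \<sigma> \<delta> ^^ j) q))"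
    by (rule conv_tdiff(1)[symmetric] tmean_continuous_integrable continuous_tdiff_funpow assms)+
  thus ?case using Suc by simp
qed simp

section \<open>Chains of iterated derivatives\<close>

text \<open>The members below \<open>M\<close> are differentiable, hence continuous; \<psi>
  \<open>M\<close> is only a pointwise derivative and may be discontinuous.\<close>

definition D_chain :: "complex \<Rightarrow> nat \<Rightarrow> (nat \<Rightarrow> real \<Rightarrow> complex) \<Rightarrow> bool" where
  "D_chain \<sigma> M \<psi> \<longleftrightarrow> (\<forall>k<M. \<forall>t. (\<psi> k has_vector_derivative (\<psi> (Suc k) t - \<sigma> * \<psi> k t)) (at t))"

lemma D_chain_continuous:
  assumes "D_chain \<sigma> M \<psi>" "k < M"
  shows "continuous_on UNIV (\<psi> k)"
proof (intro continuous_at_imp_continuous_on ballI)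
  fix x
  have "(\<psi> k has_vector_derivative (\<psi> (Suc k) x - \<sigma> * \<psi> k x)) (at x)"
    using assms unfolding D_chain_def by blast
  thus "isCont (\<psi> k) x" by (rule has_vector_derivative_continuous)
qed

lemma D_chain_step:
  assumes "D_chain \<sigma> M \<psi>" "Suc k < M" "\<delta> > 0"
  shows "tdiff \<sigma> \<delta> (\<psi> k) = tmean \<sigma> \<delta> (\<psi> (Suc k))"
proof (rule tdiff_eq_tmean)
  have c: "continuous_on UNIV (\<psi> (Suc k))" by (rule D_chain_continuous[OF assms(1,2)])
  thus m: "\<psi> (Suc k) \<in> borel_measurable borel" by (rule borel_measurable_continuous_onI)
  thus "\<psi> (Suc k) \<in> borel_measurable lebesgue" by (intro measurable_completion) simp
  show "\<And>t. (\<psi> k has_vector_derivative \<psi> (Suc k) t - \<sigma> * \<psi> k t) (at t)"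
    using assms unfolding D_chain_def by auto
  show "\<And>x. integrable lborel (\<lambda>t. diff_kernel \<sigma> 1 \<delta> (x - t) * \<psi> (Suc k) t)"
    by (rule tmean_continuous_integrable[OF c assms(3)])
qed (use assms in auto)

text \<open>Every step down the chain costs one difference and yields one mean; means commute with
  differences of continuous functions. Only the top step involves the possibly discontinuous \<psi>
  \<open>M\<close>, and there the hypothesis \<open>base\<close> supplies the mean, of
  \<open>w\<close>.\<close>

lemma D_chain_tmean:
  assumes ch: "D_chain \<sigma> M \<psi>" and \<delta>: "\<delta> > 0"
    and base: "tdiff \<sigma> \<delta> (\<psi> (M - 1)) = tmean \<sigma> \<delta> w" and j: "1 \<le> j" "j \<le> M"
  shows "(tdiff \<sigma> \<delta> ^^ j) (\<psi> (M - j)) = (tmean \<sigma> \<delta> ^^ j) w"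
  using j
proof (induction j rule: dec_induct)
  case base
  thus ?case using assms(3) by simp
next
  case (step j)
  have M: "Suc (M - Suc j) = M - j" using step by simp
  have "(tdiff \<sigma> \<delta> ^^ Suc j) (\<psi> (M - Suc j)) = (tdiff \<sigma> \<delta> ^^ j) (tdiff \<sigma> \<delta> (\<psi> (M - Suc j)))"
    by (simp add: funpow_swap1)
  also have "tdiff \<sigma> \<delta> (\<psi> (M - Suc j)) = tmean \<sigma> \<delta> (\<psi> (M - j))"
    using D_chain_step[OF ch _ \<delta>, of "M - Suc j"] step M by simp
  also have "(tdiff \<sigma> \<delta> ^^ j) (tmean \<sigma> \<delta> (\<psi> (M - j))) = tmean \<sigma> \<delta> ((tdiff \<sigma> \<delta> ^^ j) (\<psi> (M - j)))"
    by (rule tmean_tdiff_funpow[OF D_chain_continuous[OF ch] \<delta>]) (use step in auto)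
  also have "\<dots> = (tmean \<sigma> \<delta> ^^ Suc j) w" using step by simp
  finally show ?case .
qed

lemma tmean_close:
  assumes c: "continuous_on UNIV g" and \<delta>: "\<delta> > 0"
    and close: "\<And>t. t \<in> {y - \<delta>..y} \<Longrightarrow> norm (exp (- (\<sigma> * of_real (y - t))) * g t - c) \<le> \<epsilon>"
  shows "norm (tmean \<sigma> \<delta> g y / of_real \<delta> - c) \<le> \<epsilon>"
proof -
  have ind: "kap 1 \<delta> (y - t) = indicator {y - \<delta>..<y} t" for t
    by (auto simp: kap_one[OF \<delta>] indicator_def)
  have ii: "integrable lborel (\<lambda>t. complex_of_real (indicator {y - \<delta>..<y} t) * c)"
    by (intro integrable_mult_left integrable_of_real integrable_real_indicator) (use \<delta> in auto)
  have I: "(LINT t|lborel. complex_of_real (indicator {y - \<delta>..<y} t) * c) = of_real \<delta> * c"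
    using \<delta> by simp
  have "tmean \<sigma> \<delta> g y - of_real \<delta> * c =
      (LINT t|lborel. diff_kernel \<sigma> 1 \<delta> (y - t) * g t - of_real (indicator {y - \<delta>..<y} t) * c)"
    unfolding conv_def I[symmetric]
    by (rule Bochner_Integration.integral_diff[OF tmean_continuous_integrable[OF c \<delta>] ii, symmetric])
  also have "norm \<dots> \<le> (LINT t|lborel. indicator {y - \<delta>..<y} t * \<epsilon>)"
  proof (rule Bochner_Integration.integral_norm_bound_integral)
    show "integrable lborel (\<lambda>t. diff_kernel \<sigma> 1 \<delta> (y - t) * g t - of_real (indicator {y - \<delta>..<y} t) * c)"
      by (rule Bochner_Integration.integrable_diff[OF tmean_continuous_integrable[OF c \<delta>] ii])
    show "integrable lborel (\<lambda>t. indicator {y - \<delta>..<y} t * \<epsilon>)"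
      by (intro integrable_mult_left integrable_real_indicator) (use \<delta> in auto)
    fix t
    show "norm (diff_kernel \<sigma> 1 \<delta> (y - t) * g t - of_real (indicator {y - \<delta>..<y} t) * c) \<le> indicator {y - \<delta>..<y} t * \<epsilon>"
      using close[of t] by (auto simp: diff_kernel_def ind indicator_def)
  qed
  also have "\<dots> = \<delta> * \<epsilon>" using \<delta> by simp
  also have "tmean \<sigma> \<delta> g y - of_real \<delta> * c = (tmean \<sigma> \<delta> g y / of_real \<delta> - c) * of_real \<delta>"
    using \<delta> by (simp add: left_diff_distrib)
  finally have "norm ((tmean \<sigma> \<delta> g y / of_real \<delta> - c) * of_real \<delta>) \<le> \<epsilon> * \<delta>"
    by (simp only: mult.commute)
  thus ?thesis using \<delta> by (simp add: norm_mult)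
qed

text \<open>The point \<open>y\<close> varies near \<open>x\<close> because the induction averages
  over \<open>{y - \<delta>..y}\<close>: a limit at \<open>x\<close> alone would not pass to the
  next mean.\<close>

lemma D_chain_limit_aux:
  assumes ch: "D_chain \<sigma> M \<psi>" and n: "n < M" and "j \<le> n" "\<epsilon> > 0"
  shows "\<exists>r>0. \<forall>\<delta> y. 0 < \<delta> \<and> \<delta> < r \<and> \<bar>y - x\<bar> < r \<longrightarrow>
    norm ((tdiff \<sigma> \<delta> ^^ j) (\<psi> (n - j)) y / of_real \<delta> ^ j - \<psi> n x) \<le> \<epsilon>"
  using assms(3,4)
proof (induction j arbitrary: \<epsilon>)
  case 0
  have "isCont (\<psi> n) x"
    using D_chain_continuous[OF ch n] by (simp add: continuous_on_eq_continuous_at)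
  then obtain r where r: "r > 0" "\<And>y. \<bar>y - x\<bar> < r \<Longrightarrow> dist (\<psi> n y) (\<psi> n x) < \<epsilon>"
    using 0 unfolding continuous_at_eps_delta by (auto simp: dist_real_def)
  thus ?case by (intro exI[of _ r]) (auto simp: dist_norm intro: less_imp_le)
next
  case (Suc j)
  define c where "c = \<psi> n x"
  \<comment> \<open>Joint continuity in delay and value: the weight of the mean is close to 1 for a
    short delay, so it spoils neither the average nor its limit \<open>c\<close>.\<close>
  have "((\<lambda>z. exp (- (\<sigma> * of_real (fst z))) * snd z) \<longlongrightarrow> exp (- (\<sigma> * of_real (fst (0::real, c)))) * snd (0::real, c)) (at (0, c))"
    by (intro tendsto_intros)
  hence "isCont (\<lambda>z. exp (- (\<sigma> * of_real (fst z))) * snd z) (0::real, c)"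
    by (simp add: isCont_def)
  then obtain d where d: "d > 0" "\<And>z. dist z (0::real, c) < d \<Longrightarrow> dist (exp (- (\<sigma> * of_real (fst z))) * snd z) c < \<epsilon>"
    using Suc.prems unfolding continuous_at_eps_delta by (metis (no_types, lifting) exp_zero fst_conv minus_zero mult_1 mult_zero_right of_real_0 snd_conv)
  have d': "norm (exp (- (\<sigma> * of_real u)) * b - c) \<le> \<epsilon>" if "\<bar>u\<bar> < d / 2" "norm (b - c) \<le> d / 4" for u b
  proof -
    have "dist (u, b) (0::real, c) \<le> \<bar>u\<bar> + norm (b - c)"
      using norm_Pair_le[of u "b - c"] by (simp add: dist_norm)
    also have "\<dots> < d" using that d(1) by linarith
    finally show ?thesis using d(2)[of "(u, b)"] by (simp add: dist_norm)
  qed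
  obtain r where r: "r > 0" "\<And>\<delta> y. 0 < \<delta> \<and> \<delta> < r \<and> \<bar>y - x\<bar> < r \<Longrightarrow>
    norm ((tdiff \<sigma> \<delta> ^^ j) (\<psi> (n - j)) y / of_real \<delta> ^ j - c) \<le> d / 4"
    using Suc.IH[of "d / 4"] Suc.prems d(1) unfolding c_def by auto
  show ?case
  \<comment> \<open>Half of \<open>r\<close>, since a point of \<open>{y - \<delta>..y}\<close> may
    be as far as \<open>\<bar>y - x\<bar> + \<delta>\<close> from \<open>x\<close>.\<close>
  proof (intro exI[of _ "min (r / 2) (d / 2)"] conjI allI impI, goal_cases)
    case (2 \<delta> y)
    hence \<delta>: "\<delta> > 0" "\<delta> < r / 2" "\<delta> < d / 2" "\<bar>y - x\<bar> < r / 2" by auto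
    define G where "G = (tdiff \<sigma> \<delta> ^^ j) (\<psi> (n - j))"
    have cn: "continuous_on UNIV (\<psi> (n - j))" using n by (intro D_chain_continuous[OF ch]) simp
    hence cG: "continuous_on UNIV G" unfolding G_def by (rule continuous_tdiff_funpow)
    have S: "Suc (n - Suc j) = n - j" using Suc.prems by simp
    have "(tdiff \<sigma> \<delta> ^^ Suc j) (\<psi> (n - Suc j)) = (tdiff \<sigma> \<delta> ^^ j) (tdiff \<sigma> \<delta> (\<psi> (n - Suc j)))"
      by (simp add: funpow_swap1)
    also have "tdiff \<sigma> \<delta> (\<psi> (n - Suc j)) = tmean \<sigma> \<delta> (\<psi> (n - j))"
      using D_chain_step[OF ch _ \<delta>(1), of "n - Suc j"] S n by simp
    also have "(tdiff \<sigma> \<delta> ^^ j) (tmean \<sigma> \<delta> (\<psi> (n - j))) = tmean \<sigma> \<delta> G"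
      unfolding G_def by (rule tmean_tdiff_funpow[OF cn \<delta>(1)])
    finally have "(tdiff \<sigma> \<delta> ^^ Suc j) (\<psi> (n - Suc j)) y = tmean \<sigma> \<delta> G y" by simp
    moreover have "tmean \<sigma> \<delta> G y = of_real \<delta> ^ j * tmean \<sigma> \<delta> (\<lambda>t. G t / of_real \<delta> ^ j) y"
      unfolding conv_def using \<delta>(1) by (simp add: mult.commute)
    ultimately have "(tdiff \<sigma> \<delta> ^^ Suc j) (\<psi> (n - Suc j)) y / of_real \<delta> ^ Suc j =
        tmean \<sigma> \<delta> (\<lambda>t. G t / of_real \<delta> ^ j) y / of_real \<delta>"
      using \<delta>(1) by simp
    moreover have "norm (tmean \<sigma> \<delta> (\<lambda>t. G t / of_real \<delta> ^ j) y / of_real \<delta> - c) \<le> \<epsilon>"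
    proof (rule tmean_close[OF _ \<delta>(1)])
      show "continuous_on UNIV (\<lambda>t. G t / of_real \<delta> ^ j)"
        using \<delta>(1) by (intro continuous_on_divide cG continuous_on_const) auto
      fix t assume t: "t \<in> {y - \<delta>..y}"
      show "norm (exp (- (\<sigma> * of_real (y - t))) * (G t / of_real \<delta> ^ j) - c) \<le> \<epsilon>"
      proof (rule d')
        show "\<bar>y - t\<bar> < d / 2" using t \<delta> by auto
        show "norm (G t / of_real \<delta> ^ j - c) \<le> d / 4"
          unfolding G_def by (intro r(2)) (use t \<delta> in \<open>simp, linarith\<close>)
      qed
    qed
    ultimately show ?case by (simp add: c_def)
  qed (use r d in auto)
qed

lemma D_chain_limit:
  assumes "D_chain \<sigma> M \<psi>" "n < M" and \<delta>: "\<delta> \<longlonglongrightarrow> 0" "\<And>k. \<delta> k > 0"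
  shows "(\<lambda>k. (tdiff \<sigma> (\<delta> k) ^^ n) (\<psi> 0) x / of_real (\<delta> k) ^ n) \<longlonglongrightarrow> \<psi> n x"
proof (rule LIMSEQ_I)
  fix e :: real assume e: "e > 0"
  obtain r where r: "r > 0" "\<And>\<delta> y. 0 < \<delta> \<and> \<delta> < r \<and> \<bar>y - x\<bar> < r \<Longrightarrow>
      norm ((tdiff \<sigma> \<delta> ^^ n) (\<psi> (n - n)) y / of_real \<delta> ^ n - \<psi> n x) \<le> e / 2"
    using D_chain_limit_aux[OF assms(1,2) order_refl, of "e / 2" x] e by auto
  obtain N where N: "\<And>k. k \<ge> N \<Longrightarrow> \<delta> k < r"
    using order_tendstoD(2)[OF \<delta>(1) r(1)] unfolding eventually_sequentially by auto
  show "\<exists>N. \<forall>k\<ge>N. norm ((tdiff \<sigma> (\<delta> k) ^^ n) (\<psi> 0) x / of_real (\<delta> k) ^ n - \<psi> n x) < e"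
  proof (intro exI[of _ N] allI impI)
    fix k assume "k \<ge> N"
    hence "norm ((tdiff \<sigma> (\<delta> k) ^^ n) (\<psi> 0) x / of_real (\<delta> k) ^ n - \<psi> n x) \<le> e / 2"
      using r(2)[of "\<delta> k" x] N[of k] \<delta>(2)[of k] r(1) by simp
    thus "norm ((tdiff \<sigma> (\<delta> k) ^^ n) (\<psi> 0) x / of_real (\<delta> k) ^ n - \<psi> n x) < e" using e by simp
  qed
qed

text \<open>The mean value inequality in a vertical strip, where the derivative is bounded whatever
  the imaginary part is; along the line \<open>Re z = Re \<sigma>\<close> the constant is therefore
  uniform.\<close>

lemma norm_one_minus_exp_le: "norm (1 - exp (- w)) \<le> exp \<bar>Re w\<bar> * norm (w :: complex)"
proof -
  have "norm (exp (- w) - exp (- 0)) \<le> exp \<bar>Re w\<bar> * norm (w - 0)"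
  proof (rule field_differentiable_bound[where S = "{z. \<bar>Re z\<bar> \<le> \<bar>Re w\<bar>}" and f' = "\<lambda>z. - exp (- z)"])
    have "{z. \<bar>Re z\<bar> \<le> \<bar>Re w\<bar>} = {z. Re z \<le> \<bar>Re w\<bar>} \<inter> {z. Re z \<ge> - \<bar>Re w\<bar>}" by auto
    thus "convex {z. \<bar>Re z\<bar> \<le> \<bar>Re w\<bar>}" by (simp add: convex_Int convex_halfspace_Re_le convex_halfspace_Re_ge)
  qed (auto intro!: derivative_eq_intros)
  thus ?thesis by (simp add: norm_minus_commute)
qed

section \<open>Transform of the fractional derivative\<close>

text \<open>These are the frequencies at which the symbol of the unit difference vanishes. They must
  be left out before dividing by it.\<close>

lemma countable_exp_line:
  "countable {\<omega>. exp (- (\<sigma> - \<i> * of_real \<omega>)) = 1}"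
proof (rule countable_subset)
  show "{\<omega>. exp (- (\<sigma> - \<i> * of_real \<omega>)) = 1} \<subseteq> range (\<lambda>k::int. Im \<sigma> + 2 * pi * of_int k)"
  proof
    fix \<omega> assume "\<omega> \<in> {\<omega>. exp (- (\<sigma> - \<i> * of_real \<omega>)) = 1}"
    then obtain k :: int where "- (Im \<sigma> - \<omega>) = of_int (2 * k) * pi"
      by (auto simp: exp_eq_1)
    thus "\<omega> \<in> range (\<lambda>k::int. Im \<sigma> + 2 * pi * of_int k)" by (auto intro!: image_eqI[of _ _ k] simp: algebra_simps)
  qed
qed simp

text \<open>One difference is spent on the kernel and turns it into \<open>diff_kernel\<close>, to
  which the convolution theorem can apply; the rest act on \<open>f\<close>. Hence
  \<open>Suc i\<close> on one side and \<open>i\<close> on the other.\<close>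

lemma tdiff_funpow_frac_integral:
  assumes conv: "\<And>x. integrable lborel (\<lambda>t. frac_kernel \<sigma> \<nu> (x - t) * f t)"
  shows "integrable lborel (\<lambda>t. frac_kernel \<sigma> \<nu> (x - t) * (tdiff \<sigma> \<delta> ^^ i) f t)"
    and "(tdiff \<sigma> \<delta> ^^ Suc i) (conv (frac_kernel \<sigma> \<nu>) f) = conv (diff_kernel \<sigma> \<nu> \<delta>) ((tdiff \<sigma> \<delta> ^^ i) f)"
proof -
  have 0: "integrable lborel (\<lambda>t. frac_kernel \<sigma> \<nu> (x - t) * (tdiff \<sigma> \<delta> ^^ i) f t)" for i x
    by (induction i arbitrary: x) (use conv conv_tdiff(2) in simp_all)
  thus "integrable lborel (\<lambda>t. frac_kernel \<sigma> \<nu> (x - t) * (tdiff \<sigma> \<delta> ^^ i) f t)" .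
  have "(tdiff \<sigma> \<delta> ^^ i) (conv (frac_kernel \<sigma> \<nu>) f) = conv (frac_kernel \<sigma> \<nu>) ((tdiff \<sigma> \<delta> ^^ i) f)" for i
    by (induction i) (simp_all add: conv_tdiff(1)[OF 0])
  thus "(tdiff \<sigma> \<delta> ^^ Suc i) (conv (frac_kernel \<sigma> \<nu>) f) = conv (diff_kernel \<sigma> \<nu> \<delta>) ((tdiff \<sigma> \<delta> ^^ i) f)"
    unfolding diff_kernel_eq tdiff_conv(1)[OF 0] by simp
qed

text \<open>The symbol comes from unit differences of full order \<open>n + p\<close>. The pointwise
  formula comes from differences of order \<open>n\<close> with step tending to 0: divided by the
  step they converge to \<psi> \<open>n\<close>, and their transforms converge under one
  majorant.\<close>

theorem frac_deriv_representation:
  fixes \<sigma> :: complex and \<nu> :: real and f w :: "real \<Rightarrow> complex" and n p :: nat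
  defines "z \<equiv> \<lambda>\<omega>. \<sigma> - \<i> * of_real \<omega>"
  assumes \<nu>: "0 < \<nu>" "\<nu> \<le> 1" "Re \<sigma> \<ge> 0 \<or> \<nu> = 1" and n: "n \<ge> 1" "p \<ge> 1"
    and f: "integrable lborel f" "integrable lborel (ft f)"
    and conv: "\<And>x. integrable lborel (\<lambda>t. frac_kernel \<sigma> \<nu> (x - t) * f t)"
    and ch: "D_chain \<sigma> (n + p) \<psi>" "\<psi> 0 = conv (frac_kernel \<sigma> \<nu>) f"
    and last: "\<And>\<delta>. \<delta> > 0 \<Longrightarrow> tdiff \<sigma> \<delta> (\<psi> (n + p - 1)) = tmean \<sigma> \<delta> w"
    and w: "integrable lborel w" "integrable lborel (ft w)"
  shows "AE \<omega> in lborel. ft w \<omega> = z \<omega> powr of_real (real n - \<nu> + real p) * ft f \<omega>"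
    and "integrable lborel (\<lambda>\<omega>. z \<omega> powr of_real (real n - \<nu>) * ft f \<omega>)"
    and "\<psi> n x = ift (\<lambda>\<omega>. z \<omega> powr of_real (real n - \<nu>) * ft f \<omega>) x"
proof -
  have [measurable]: "f \<in> borel_measurable borel" "w \<in> borel_measurable borel" using f w by auto
  have zm [measurable]: "z \<in> borel_measurable borel" unfolding z_def by measurable
  have [measurable]: "(\<lambda>\<omega>. z \<omega> powr c) \<in> borel_measurable borel" for c
    unfolding powr_def by measurable
  have fn: "integrable lborel ((tdiff \<sigma> \<delta> ^^ j) (\<psi> 0))"
    "z \<omega> \<noteq> 0 \<Longrightarrow> ft ((tdiff \<sigma> \<delta> ^^ j) (\<psi> 0)) \<omega> = (1 - exp (- (z \<omega> * of_real \<delta>))) ^ j * z \<omega> powr (- of_real \<nu>) * ft f \<omega>"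
    if \<delta>: "\<delta> > 0" and j: "j \<ge> 1" for \<delta> j \<omega>
  proof -
    obtain i where i: "j = Suc i" using j by (cases j) auto
    have 4: "(tdiff \<sigma> \<delta> ^^ j) (\<psi> 0) = conv (diff_kernel \<sigma> \<nu> \<delta>) ((tdiff \<sigma> \<delta> ^^ i) f)"
      unfolding i ch(2) by (rule tdiff_funpow_frac_integral(2)[OF conv])
    have ki: "integrable lborel (diff_kernel \<sigma> \<nu> \<delta>)"
      by (rule diff_kernel_integrable[OF \<nu>(1,2) \<delta> \<nu>(3)])
    show "integrable lborel ((tdiff \<sigma> \<delta> ^^ j) (\<psi> 0))"
      unfolding 4 by (intro conv_integrable ki ft_tdiff_funpow f)
    assume "z \<omega> \<noteq> 0"
    note ft_diff_kernel[OF \<nu>(1,2) \<delta> \<nu>(3) z_def[THEN meta_eq_to_obj_eq, THEN fun_cong] this]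
    moreover have "ft ((tdiff \<sigma> \<delta> ^^ j) (\<psi> 0)) \<omega> =
        ft (diff_kernel \<sigma> \<nu> \<delta>) \<omega> * ((1 - exp (- (z \<omega> * of_real \<delta>))) ^ i * ft f \<omega>)"
      unfolding 4 ft_conv[OF ki ft_tdiff_funpow(1)[OF f(1)]] ft_tdiff_funpow(2)[OF f(1)] z_def by simp
    ultimately show "ft ((tdiff \<sigma> \<delta> ^^ j) (\<psi> 0)) \<omega> = (1 - exp (- (z \<omega> * of_real \<delta>))) ^ j * z \<omega> powr (- of_real \<nu>) * ft f \<omega>"
      by (simp add: i)
  qed
  have z0: "exp (- z \<omega>) \<noteq> 1 \<Longrightarrow> z \<omega> \<noteq> 0" for \<omega> by auto
  have ae: "AE \<omega> in lborel. exp (- z \<omega>) \<noteq> 1"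
    using countable_imp_null_set_lborel[OF countable_exp_line[of \<sigma>]]
    by (intro AE_I'[of "{\<omega>. exp (- z \<omega>) = 1}"]) (auto simp: z_def)
  show star: "AE \<omega> in lborel. ft w \<omega> = z \<omega> powr of_real (real n - \<nu> + real p) * ft f \<omega>"
    using ae
  proof eventually_elim
    case (elim \<omega>)
    have z: "z \<omega> \<noteq> 0" by (rule z0[OF elim])
    let ?e = "1 - exp (- (z \<omega> * of_real 1))"
    have "(tdiff \<sigma> 1 ^^ (n + p)) (\<psi> 0) = (tmean \<sigma> 1 ^^ (n + p)) w"
      using D_chain_tmean[OF ch(1) zero_less_one last[OF zero_less_one], of "n + p"] n by simp
    hence "?e ^ (n + p) * z \<omega> powr (- of_real \<nu>) * ft f \<omega> = (?e / z \<omega>) ^ (n + p) * ft w \<omega>"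
      using fn(2)[of 1 "n + p" \<omega>] ft_tmean_funpow[OF zero_less_one w(1) _ z, of \<sigma> \<omega> "n + p"] z n
      by (simp add: z_def)
    hence "ft w \<omega> = z \<omega> ^ (n + p) * z \<omega> powr (- of_real \<nu>) * ft f \<omega>"
      using elim z by (simp add: power_divide field_simps)
    also have "z \<omega> ^ (n + p) * z \<omega> powr (- of_real \<nu>) = z \<omega> powr (of_nat (n + p) + (- of_real \<nu>))"
      unfolding powr_add using powr_nat'[of "z \<omega>" "n + p"] z by simp
    finally show ?case by (simp add: algebra_simps)
  qed
  define \<alpha> where "\<alpha> = real n - \<nu>"
  have \<alpha>0: "\<alpha> \<ge> 0" using n \<nu> by (simp add: \<alpha>_def)
  show int: "integrable lborel (\<lambda>\<omega>. z \<omega> powr of_real (real n - \<nu>) * ft f \<omega>)"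
  proof (rule Bochner_Integration.integrable_bound)
    show "integrable lborel (\<lambda>\<omega>. norm (ft f \<omega>) + norm (ft w \<omega>))" using f w by simp
    show "AE \<omega> in lborel. norm (z \<omega> powr of_real (real n - \<nu>) * ft f \<omega>) \<le> norm (norm (ft f \<omega>) + norm (ft w \<omega>))"
      using star
    proof eventually_elim
      case (elim \<omega>)
      \<comment> \<open>Interpolation: \<open>ft f\<close> controls the low frequencies and
        \<open>ft w\<close> the high ones.\<close>
      have "norm (z \<omega>) powr \<alpha> \<le> 1 + norm (z \<omega>) powr (\<alpha> + p)"
      proof (cases "norm (z \<omega>) \<le> 1")
        case True
        hence "norm (z \<omega>) powr \<alpha> \<le> 1" using \<alpha>0 by (simp add: powr_le1)
        thus ?thesis using powr_ge_zero[of "norm (z \<omega>)" "\<alpha> + p"] by linarith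
      next
        case False
        hence "norm (z \<omega>) powr \<alpha> \<le> norm (z \<omega>) powr (\<alpha> + p)" by (intro powr_mono) auto
        thus ?thesis by simp
      qed
      hence "norm (z \<omega>) powr \<alpha> * norm (ft f \<omega>) \<le> (1 + norm (z \<omega>) powr (\<alpha> + p)) * norm (ft f \<omega>)"
        by (rule mult_right_mono) simp
      thus ?case unfolding elim by (simp only: norm_mult norm_powr_of_real \<alpha>_def distrib_right) simp
    qed
  qed measurable
  \<comment> \<open>The bound \<delta> \<open>k\<close> \<le> 1 makes the constant \<open>C\<close>
    below independent of \<open>k\<close>.\<close>
  define \<delta> where "\<delta> = (\<lambda>k. inverse (real (Suc k)))"
  have \<delta>: "\<delta> \<longlonglongrightarrow> 0" "\<And>k. \<delta> k > 0" "\<And>k. \<delta> k \<le> 1"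
    unfolding \<delta>_def by (rule LIMSEQ_inverse_real_of_nat, simp, simp add: inverse_le_1_iff)
  define S where "S = (\<lambda>k \<omega>. ((1 - exp (- (z \<omega> * of_real (\<delta> k)))) / of_real (\<delta> k)) ^ n * z \<omega> powr (- of_real \<nu>) * ft f \<omega>)"
  have Sm [measurable]: "S k \<in> borel_measurable borel" for k unfolding S_def by measurable
  have zae: "AE \<omega> in lborel. z \<omega> \<noteq> 0" using ae by eventually_elim (rule z0)
  have zn: "z \<omega> ^ n * z \<omega> powr (- of_real \<nu>) = z \<omega> powr of_real (real n - \<nu>)" if "z \<omega> \<noteq> 0" for \<omega>
    using powr_add[of "z \<omega>" "of_nat n" "- of_real \<nu>"] powr_nat'[of "z \<omega>" n] that by simp
  define C where "C = exp \<bar>Re \<sigma>\<bar>"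
  have Sb: "norm (S k \<omega>) \<le> C ^ n * norm (z \<omega> powr of_real (real n - \<nu>) * ft f \<omega>)" if z: "z \<omega> \<noteq> 0" for k \<omega>
  proof -
    have "norm (1 - exp (- (z \<omega> * of_real (\<delta> k)))) \<le> exp \<bar>Re (z \<omega> * of_real (\<delta> k))\<bar> * norm (z \<omega> * of_real (\<delta> k))"
      by (rule norm_one_minus_exp_le)
    also have "\<dots> \<le> C * norm (z \<omega> * of_real (\<delta> k))"
      using \<delta>(2,3)[of k] by (intro mult_right_mono) (auto simp: C_def z_def abs_mult mult_left_le)
    finally have "norm ((1 - exp (- (z \<omega> * of_real (\<delta> k)))) / of_real (\<delta> k)) \<le> C * norm (z \<omega>)"
      using \<delta>(2)[of k] by (simp add: norm_divide norm_mult divide_le_eq)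
    hence "norm ((1 - exp (- (z \<omega> * of_real (\<delta> k)))) / of_real (\<delta> k)) ^ n \<le> (C * norm (z \<omega>)) ^ n"
      by (rule power_mono) simp
    hence "norm (S k \<omega>) \<le> (C * norm (z \<omega>)) ^ n * (norm (z \<omega> powr (- of_real \<nu>)) * norm (ft f \<omega>))"
      unfolding S_def norm_mult norm_power mult.assoc by (rule mult_right_mono) simp
    also have "\<dots> = C ^ n * norm (z \<omega> powr of_real (real n - \<nu>) * ft f \<omega>)"
      unfolding zn[OF z, symmetric] by (simp add: norm_mult norm_power power_mult_distrib)
    finally show ?thesis .
  qed
  have Sint: "integrable lborel (S k)" for k
  proof (rule Bochner_Integration.integrable_bound)
    show "integrable lborel (\<lambda>\<omega>. C ^ n * norm (z \<omega> powr of_real (real n - \<nu>) * ft f \<omega>))" using int by simp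
    show "AE \<omega> in lborel. norm (S k \<omega>) \<le> norm (C ^ n * norm (z \<omega> powr of_real (real n - \<nu>) * ft f \<omega>))"
      using zae by eventually_elim (use Sb in \<open>force intro: order_trans[OF _ abs_ge_self]\<close>)
  qed simp
  \<comment> \<open>The differences inherit continuity from \<psi> 0, so the inversion formula holds
    at the given \<open>x\<close> and not just almost everywhere.\<close>
  have inv: "(tdiff \<sigma> (\<delta> k) ^^ n) (\<psi> 0) x / of_real (\<delta> k) ^ n = ift (S k) x" for k
  proof -
    let ?g = "(tdiff \<sigma> (\<delta> k) ^^ n) (\<psi> 0)"
    have ae: "AE \<omega> in lborel. ft ?g \<omega> = of_real (\<delta> k) ^ n * S k \<omega>"
      using zae by eventually_elim (use fn(2)[OF \<delta>(2) n(1)] \<delta>(2)[of k] in \<open>simp add: S_def power_divide\<close>)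
    have gi: "integrable lborel ?g" by (rule fn(1)[OF \<delta>(2) n(1)])
    have gm: "ft ?g \<in> borel_measurable borel" using gi by (intro ft_measurable) auto
    have "integrable lborel (\<lambda>\<omega>. of_real (\<delta> k) ^ n * S k \<omega>)" using Sint by simp
    hence "integrable lborel (ft ?g)"
      using gm ae by (subst integrable_cong_AE[where g = "\<lambda>\<omega>. of_real (\<delta> k) ^ n * S k \<omega>"]) auto
    moreover have "continuous_on UNIV ?g"
      by (rule continuous_tdiff_funpow[OF D_chain_continuous[OF ch(1)]]) (use n in simp)
    ultimately have "?g x = ift (ft ?g) x" by (rule ft_inversion[OF gi])
    also have "\<dots> = ift (\<lambda>\<omega>. of_real (\<delta> k) ^ n * S k \<omega>) x"
      unfolding ift_eq_ft using ft_cong_AE[OF ae] gm by simp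
    also have "\<dots> = of_real (\<delta> k) ^ n * ift (S k) x"
      unfolding ift_eq_ft ft_cmult by simp
    finally show ?thesis using \<delta>(2)[of k] by simp
  qed
  have "(\<lambda>k. ift (S k) x) \<longlonglongrightarrow> ift (\<lambda>\<omega>. z \<omega> powr of_real (real n - \<nu>) * ft f \<omega>) x"
    unfolding ift_def
  proof (rule tendsto_mult[OF tendsto_const], rule integral_dominated_convergence[where w = "\<lambda>\<omega>. C ^ n * norm (z \<omega> powr of_real (real n - \<nu>) * ft f \<omega>)"])
    show "integrable lborel (\<lambda>\<omega>. C ^ n * norm (z \<omega> powr of_real (real n - \<nu>) * ft f \<omega>))" using int by simp
    show "AE \<omega> in lborel. norm (iexp (- (\<omega> * x)) * S k \<omega>) \<le> C ^ n * norm (z \<omega> powr of_real (real n - \<nu>) * ft f \<omega>)" for k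
      using zae by eventually_elim (use Sb in \<open>simp add: norm_mult\<close>)
    show "AE \<omega> in lborel. (\<lambda>k. iexp (- (\<omega> * x)) * S k \<omega>) \<longlonglongrightarrow> iexp (- (\<omega> * x)) * (z \<omega> powr of_real (real n - \<nu>) * ft f \<omega>)"
      using zae
    proof eventually_elim
      case (elim \<omega>)
      have "((\<lambda>t. 1 - exp (- (z \<omega> * t))) has_field_derivative z \<omega>) (at 0)"
        by (auto intro!: derivative_eq_intros)
      hence "((\<lambda>t. (1 - exp (- (z \<omega> * t))) / t) \<longlongrightarrow> z \<omega>) (at 0)"
        by (simp add: has_field_derivative_iff)
      moreover have "filterlim (\<lambda>k. complex_of_real (\<delta> k)) (at 0) sequentially"
        using tendsto_of_real[OF \<delta>(1), where 'a = complex] \<delta>(2) by (simp add: filterlim_at less_imp_neq[symmetric])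
      ultimately have "(\<lambda>k. (1 - exp (- (z \<omega> * of_real (\<delta> k)))) / of_real (\<delta> k)) \<longlonglongrightarrow> z \<omega>"
        by (rule filterlim_compose)
      hence "(\<lambda>k. S k \<omega>) \<longlonglongrightarrow> z \<omega> ^ n * z \<omega> powr (- of_real \<nu>) * ft f \<omega>"
        unfolding S_def by (intro tendsto_intros)
      thus ?case unfolding zn[OF elim] by (intro tendsto_mult tendsto_const)
    qed
  qed measurable
  moreover have "(\<lambda>k. (tdiff \<sigma> (\<delta> k) ^^ n) (\<psi> 0) x / of_real (\<delta> k) ^ n) \<longlonglongrightarrow> \<psi> n x"
    by (rule D_chain_limit[OF ch(1) _ \<delta>(1,2)]) (use n in simp)
  ultimately show "\<psi> n x = ift (\<lambda>\<omega>. z \<omega> powr of_real (real n - \<nu>) * ft f \<omega>) x"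
    unfolding inv using LIMSEQ_unique by blast
qed

section \<open>Growing kernels of fractional order\<close>

text \<open>Extended by 0 across the half of the axis where it vanishes, \<open>Z\<close> stays
  continuous and is therefore holomorphic there. It is 0 on the right of the axis, hence on the
  left, and the identity theorem and continuity do the rest.\<close>

lemma strip_uniqueness:
  assumes s: "s > 0" and cont: "continuous_on {z. - s \<le> Re z \<and> Re z \<le> 0} Z"
    and hol: "Z holomorphic_on {z. - s < Re z \<and> Re z < 0}"
    and zero: "\<And>y. y \<ge> 0 \<Longrightarrow> Z (\<i> * of_real y) = 0"
    and z: "- s \<le> Re z" "Re z \<le> 0"
  shows "Z z = 0"
proof -
  \<comment> \<open>Restricted to the upper half-plane, since nothing is known on the lower half of
    the axis.\<close>
  define S where "S = {z. - s < Re z} \<inter> {z. 0 < Im z}"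
  define H where "H = (\<lambda>z. if Re z \<le> 0 then Z z else 0)"
  have S: "open S" "convex S" unfolding S_def
    by (auto intro!: open_Int convex_Int open_halfspace_Re_gt open_halfspace_Im_gt convex_halfspace_Re_gt convex_halfspace_Im_gt)
  have op: "open {z. - s < Re z \<and> Re z < 0}" "convex {z. - s < Re z \<and> Re z < 0}"
  proof -
    have "{z. - s < Re z \<and> Re z < 0} = {z. - s < Re z} \<inter> {z. Re z < 0}" by auto
    thus "open {z. - s < Re z \<and> Re z < 0}" "convex {z. - s < Re z \<and> Re z < 0}"
      by (auto intro!: open_Int convex_Int open_halfspace_Re_gt open_halfspace_Re_lt convex_halfspace_Re_gt convex_halfspace_Re_lt)
  qed
  have "H holomorphic_on S"
  proof (rule holomorphic_on_paste_across_line[where d = 1 and k = 0])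
    show "H holomorphic_on S \<inter> {z. 1 \<bullet> z < 0}"
      by (rule holomorphic_transform[OF holomorphic_on_subset[OF hol]])
         (auto simp: S_def H_def inner_complex_def)
    show "H holomorphic_on S \<inter> {z. 0 < 1 \<bullet> z}"
      by (rule holomorphic_transform[of "\<lambda>_. 0"]) (auto simp: S_def H_def inner_complex_def)
    show "continuous_on S H" unfolding H_def
    proof (rule continuous_on_cases_le)
      show "continuous_on {t \<in> S. Re t \<le> 0} Z"
        by (rule continuous_on_subset[OF cont]) (auto simp: S_def)
      fix t assume "t \<in> S" "Re t = 0"
      hence "t = \<i> * of_real (Im t)" "Im t \<ge> 0" by (auto simp: complex_eq_iff S_def)
      thus "Z t = 0" using zero by metis
    qed (auto intro!: continuous_intros)
  qed (use S in auto)
  have H0: "H w = 0" if "w \<in> S" for w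
  proof (rule analytic_continuation_open[where s = "S \<inter> {z. Re z > 0}" and s' = S and g = "\<lambda>_. 0" and f = H])
    show "open (S \<inter> {z. Re z > 0})" by (intro open_Int S open_halfspace_Re_gt)
    have "Complex 1 1 \<in> S \<inter> {z. Re z > 0}" using s by (auto simp: S_def)
    thus "S \<inter> {z. Re z > 0} \<noteq> {}" by blast
  qed (use S that \<open>H holomorphic_on S\<close> in \<open>auto simp: H_def convex_connected\<close>)
  have Z0: "Z w = 0" if "- s < Re w" "Re w < 0" for w
  proof (rule analytic_continuation_open[where s = "S \<inter> {z. - s < Re z \<and> Re z < 0}" and s' = "{z. - s < Re z \<and> Re z < 0}" and g = "\<lambda>_. 0" and f = Z])
    show "open (S \<inter> {z. - s < Re z \<and> Re z < 0})" by (intro open_Int S op)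
    have "Complex (- s / 2) 1 \<in> S \<inter> {z. - s < Re z \<and> Re z < 0}" using s by (auto simp: S_def)
    thus "S \<inter> {z. - s < Re z \<and> Re z < 0} \<noteq> {}" by blast
    fix v assume "v \<in> S \<inter> {z. - s < Re z \<and> Re z < 0}"
    thus "Z v = 0" using H0[of v] by (simp add: H_def)
  qed (use op that hol in \<open>auto simp: convex_connected\<close>)
  \<comment> \<open>These points run horizontally from the midline of the strip towards
    \<open>z\<close>, so they stay in the open strip even if \<open>z\<close> lies on an
    edge.\<close>
  define X where "X = (\<lambda>n. z + of_real ((- s / 2 - Re z) * inverse (real (Suc n))))"
  have "(\<lambda>n. (- s / 2 - Re z) * inverse (real (Suc n))) \<longlonglongrightarrow> (- s / 2 - Re z) * 0"
    by (intro tendsto_mult tendsto_const LIMSEQ_inverse_real_of_nat)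
  from tendsto_add[OF tendsto_const tendsto_of_real[OF this], of z] have X: "X \<longlonglongrightarrow> z"
    by (simp add: X_def)
  have Xs: "- s < Re (X n) \<and> Re (X n) < 0" for n
  proof -
    define r where "r = inverse (real (Suc n))"
    have r: "0 < r" "r \<le> 1" by (auto simp: r_def inverse_le_1_iff)
    have "Re (X n) = (1 - r) * Re z + r * (- s / 2)"
      unfolding X_def r_def[symmetric] by (simp add: algebra_simps)
    moreover have "(1 - r) * Re z \<le> 0" using r z by (intro mult_nonneg_nonpos) auto
    moreover have "r * (- s / 2) < 0" using r s by (intro mult_pos_neg) auto
    moreover have "(1 - r) * Re z \<ge> (1 - r) * (- s)" using r z by (intro mult_left_mono) auto
    moreover have "r * (- s / 2) > r * (- s)" using r s by (intro mult_strict_left_mono) auto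
    ultimately show ?thesis by (simp add: algebra_simps)
  qed
  have "(\<lambda>n. Z (X n)) \<longlonglongrightarrow> Z z"
    using cont[unfolded continuous_on_sequentially o_def, rule_format, of z X] z Xs X by (auto intro: less_imp_le)
  moreover have "Z (X n) = 0" for n using Z0 Xs by simp
  ultimately show ?thesis by (simp add: LIMSEQ_const_iff)
qed

section \<open>A kernel with half-line spectrum\<close>

text \<open>The constant comes from \<open>(1 + t) * (2 / t) \<le> 3\<close> for
  \<open>t \<ge> 2\<close>. The interval left out contains the singularities at 0 and 1 that occur
  for \<nu> < 1.\<close>

lemma kap_decay:
  assumes \<nu>: "0 < \<nu>" "\<nu> \<le> 1" and t: "t \<ge> 2 \<or> t \<le> 0"
  shows "(1 + \<bar>t\<bar>) * \<bar>kap \<nu> 1 t\<bar> \<le> 3 / Gamma \<nu>"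
proof (cases "t \<ge> 2")
  case True
  have "\<bar>tpow \<nu> t - tpow \<nu> (t - 1)\<bar> \<le> 1 * (1 - \<nu>) * (t / 2) powr (\<nu> - 2)"
    using tpow_diff_le[OF \<nu>, of 1 t] True by simp
  also have "\<dots> \<le> 1 * (t / 2) powr (- 1)"
    using \<nu> True by (intro mult_mono powr_mono) auto
  also have "\<dots> = 2 / t" using True by (simp add: powr_minus field_simps)
  finally have "(1 + \<bar>t\<bar>) * \<bar>tpow \<nu> t - tpow \<nu> (t - 1)\<bar> \<le> (1 + \<bar>t\<bar>) * (2 / t)"
    by (intro mult_left_mono) auto
  also have "\<dots> \<le> 3" using True by (simp add: field_simps)
  finally show ?thesis using \<nu> by (simp add: kap_def abs_divide divide_right_mono)
next
  case False
  hence "t \<le> 0" using t by auto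
  thus ?thesis using \<nu> by (simp add: less_imp_le)
qed

text \<open>The boundary values at \<open>z = \<i> \<xi>\<close> of the causal symbol \<open>z powr - \<nu>\<close> and of the anticausal
  symbol \<open>(- z) powr - \<nu>\<close> differ by a factor that only depends on the sign of \<open>\<xi>\<close>, so a
  combination of the two kernels has its spectrum on a half line.\<close>

definition half_kernel :: "real \<Rightarrow> real \<Rightarrow> complex" where
  "half_kernel \<nu> t = of_real (kap \<nu> 1 t) + exp (- (\<i> * of_real (pi * \<nu>))) * of_real (kap \<nu> 1 (1 - t))"

lemma half_kernel_measurable [measurable]: "half_kernel \<nu> \<in> borel_measurable borel"
  unfolding half_kernel_def by measurable

text \<open>Reflecting to \<open>1 - t\<close> rather than \<open>- t\<close> fits the unit
  difference: because \<open>exp (- z) * (1 - exp z) = - (1 - exp (- z))\<close>, the original and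
  the reflected kernel share the factor \<open>1 - exp (- z)\<close>.\<close>

lemma kap_reflect_integrable:
  assumes "integrable lborel (\<lambda>t. exp (z * of_real t) * complex_of_real (kap \<nu> 1 t))"
  shows "integrable lborel (\<lambda>t. exp (- (z * of_real t)) * complex_of_real (kap \<nu> 1 (1 - t)))"
    and "lap (\<lambda>t. of_real (kap \<nu> 1 (1 - t))) z = exp (- z) * lap (\<lambda>t. of_real (kap \<nu> 1 t)) (- z)"
proof -
  have e: "exp (- (z * of_real (1 + - 1 * t))) = exp (- z) * exp (z * of_real t)" for t :: real
    by (simp add: algebra_simps flip: exp_add)
  from lborel_integrable_real_affine[OF assms, of "- 1" 1]
  have "integrable lborel (\<lambda>t. exp (- z) * (exp (z * of_real (1 - t)) * complex_of_real (kap \<nu> 1 (1 - t))))" by simp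
  thus "integrable lborel (\<lambda>t. exp (- (z * of_real t)) * complex_of_real (kap \<nu> 1 (1 - t)))"
    by (simp add: mult.assoc[symmetric] algebra_simps flip: exp_add)
  show "lap (\<lambda>t. of_real (kap \<nu> 1 (1 - t))) z = exp (- z) * lap (\<lambda>t. of_real (kap \<nu> 1 t)) (- z)"
  proof -
    have "lap (\<lambda>t. of_real (kap \<nu> 1 (1 - t))) z = (LINT t|lborel. exp (- (z * of_real (1 + - 1 * t))) * of_real (kap \<nu> 1 (1 - (1 + - 1 * t))))"
      unfolding lap_def by (subst lborel_integral_real_affine[where c = "- 1" and t = 1]) simp_all
    also have "\<dots> = (LINT t|lborel. exp (- z) * (exp (- (- z * of_real t)) * of_real (kap \<nu> 1 t)))"
      unfolding e by (simp add: mult.assoc)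
    finally show ?thesis unfolding integral_mult_right_zero lap_def .
  qed
qed

lemma half_kernel_integrable:
  assumes \<nu>: "0 < \<nu>" "\<nu> \<le> 1"
  shows "integrable lborel (half_kernel \<nu>)"
  unfolding half_kernel_def[abs_def]
  using kap_exp_integrable[OF \<nu> zero_less_one, of 0] kap_reflect_integrable(1)[of 0 \<nu>] by simp

text \<open>For \<omega> < 0 the point \<open>z = - \<i> \<omega>\<close> is on the upper imaginary
  axis, where \<open>Ln z = Ln (- z) + \<i> \<pi>\<close>. The phase in \<open>half_kernel\<close>
  is the resulting ratio of the two powers.\<close>

lemma ft_half_kernel:
  assumes \<nu>: "0 < \<nu>" "\<nu> \<le> 1" and \<omega>: "\<omega> < 0"
  shows "ft (half_kernel \<nu>) \<omega> = 0"
proof -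
  define z where "z = - (\<i> * of_real \<omega>)"
  have z: "Re z = 0" "z \<noteq> 0" "Re (- z) = 0" "- z \<noteq> 0" using \<omega> by (auto simp: z_def)
  have i: "integrable lborel (\<lambda>t. exp (- (w * of_real t)) * complex_of_real (kap \<nu> 1 t))" if "Re w = 0" for w
    by (rule kap_exp_integrable[OF \<nu>]) (use that in auto)
  have "ft (half_kernel \<nu>) \<omega> = lap (half_kernel \<nu>) z"
    using ft_eq_lap[of 0 "half_kernel \<nu>" \<omega>] by (simp add: z_def)
  also have "\<dots> = lap (\<lambda>t. of_real (kap \<nu> 1 t)) z + exp (- (\<i> * of_real (pi * \<nu>))) * lap (\<lambda>t. of_real (kap \<nu> 1 (1 - t))) z"
  proof -
    have "integrable lborel (\<lambda>t. exp (- (z * of_real t)) * complex_of_real (kap \<nu> 1 (1 - t)))"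
      using i[OF z(3)] by (intro kap_reflect_integrable) simp
    hence "integrable lborel (\<lambda>t. exp (- (\<i> * of_real (pi * \<nu>))) * (exp (- (z * of_real t)) * complex_of_real (kap \<nu> 1 (1 - t))))"
      by simp
    from Bochner_Integration.integral_add[OF i[OF z(1)] this] show ?thesis
      unfolding lap_def half_kernel_def integral_mult_right_zero by (simp only: distrib_left mult.left_commute)
  qed
  also have "\<dots> = (1 - exp (- z)) * (z powr (- of_real \<nu>) - exp (- (\<i> * of_real (pi * \<nu>))) * (- z) powr (- of_real \<nu>))"
  proof -
    have "lap (\<lambda>t. of_real (kap \<nu> 1 (1 - t))) z = exp (- z) * lap (\<lambda>t. of_real (kap \<nu> 1 t)) (- z)"
      using i[OF z(3)] by (intro kap_reflect_integrable) simp
    also have "\<dots> = exp (- z) * ((1 - exp z) * (- z) powr (- of_real \<nu>))"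
      using lap_kap[OF \<nu> zero_less_one _ z(4)] z(3) by simp
    also have "\<dots> = - (1 - exp (- z)) * (- z) powr (- of_real \<nu>)"
      by (simp add: algebra_simps exp_minus)
    finally have 2: "lap (\<lambda>t. of_real (kap \<nu> 1 (1 - t))) z = - (1 - exp (- z)) * (- z) powr (- of_real \<nu>)" .
    have 1: "lap (\<lambda>t. of_real (kap \<nu> 1 t)) z = (1 - exp (- z)) * z powr (- of_real \<nu>)"
      using lap_kap[OF \<nu> zero_less_one _ z(2)] z(1) by simp
    show ?thesis unfolding 1 2 by (simp add: algebra_simps)
  qed
  also have "z powr (- of_real \<nu>) = exp (- (\<i> * of_real (pi * \<nu>))) * (- z) powr (- of_real \<nu>)"
  proof -
    have z1: "z = of_real (- \<omega>) * \<i>" "- z = of_real (- \<omega>) * (- \<i>)" by (auto simp: z_def)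
    have L1: "Ln z = of_real (ln (- \<omega>)) + \<i> * of_real (pi / 2)"
      unfolding z1(1) using \<omega> by (subst Ln_times_of_real) (simp_all add: Ln_of_real del: of_real_minus)
    have L2: "Ln (- z) = of_real (ln (- \<omega>)) - \<i> * of_real (pi / 2)"
      unfolding z1(2) using \<omega> by (subst Ln_times_of_real) (simp_all add: Ln_of_real del: of_real_minus)
    have "\<i> * of_real pi = \<i> * of_real (pi / 2) + \<i> * of_real (pi / 2)" by simp
    hence "Ln z = \<i> * of_real pi + Ln (- z)" unfolding L1 L2 by simp
    hence "- of_real \<nu> * Ln z = - (\<i> * of_real (pi * \<nu>)) + - of_real \<nu> * Ln (- z)"
      by (simp add: algebra_simps)
    thus ?thesis using z by (simp add: powr_def flip: exp_add)
  qed
  finally show ?thesis by simp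
qed

text \<open>With exponent 4 the damping remains integrable after a factor
  \<open>1 + \<bar>x\<bar>\<close> has been given away.\<close>

lemma norm_inverse_quartic: "norm ((1 + \<i> * of_real x) powr (- of_real 4)) = 1 / (1 + x\<^sup>2)\<^sup>2"
proof -
  have nz: "1 + \<i> * of_real x \<noteq> 0" by (auto simp: complex_eq_iff)
  have "norm ((1 + \<i> * of_real x) powr (- of_real 4)) = norm (1 + \<i> * of_real x) powr (- 4)"
    using nz by (simp add: powr_def)
  also have "\<dots> = 1 / (norm (1 + \<i> * of_real x)) ^ 4"
    using nz by (simp add: powr_minus_divide flip: powr_numeral)
  also have "norm (1 + \<i> * of_real x) ^ 4 = ((norm (1 + \<i> * of_real x))\<^sup>2)\<^sup>2" by simp
  also have "(norm (1 + \<i> * of_real x))\<^sup>2 = 1 + x\<^sup>2" by (simp add: cmod_power2)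
  finally show ?thesis .
qed

lemma integrable_inverse_one_plus_square: "integrable lborel (\<lambda>x::real. 1 / (1 + x\<^sup>2))"
proof -
  have "set_integrable lborel (einterval (-\<infinity>) \<infinity>) (\<lambda>x. inverse (1 + x^2))"
    by (rule Sinc_Integral.integrable_inverse_1_plus_square)
  thus ?thesis by (simp add: set_integrable_def divide_inverse)
qed

text \<open>The damping factor \<open>6 / (1 + \<i> x) ^ 4\<close> is a superposition of \<open>exp (- \<i> \<xi> x)\<close> with \<open>\<xi> > 0\<close>
  only, so multiplying by it keeps the spectrum on the same half line.\<close>

lemma half_line_vanishing:
  fixes F :: "real \<Rightarrow> complex"
  assumes \<nu>: "0 < \<nu>" "\<nu> \<le> 1" and F: "integrable lborel (\<lambda>x. F x / of_real (1 + \<bar>x\<bar>))"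
    and Fm [measurable]: "F \<in> borel_measurable borel"
  defines "e \<equiv> \<lambda>x. 6 * (1 + \<i> * of_real x) powr (- of_real 4)"
  shows "integrable lborel (\<lambda>x. e x * conv (half_kernel \<nu>) F x)"
    and "\<omega> \<le> 0 \<Longrightarrow> ft (\<lambda>x. e x * conv (half_kernel \<nu>) F x) \<omega> = 0"
proof -
  let ?k = "half_kernel \<nu>"
  have em [measurable]: "e \<in> borel_measurable borel" unfolding e_def powr_def by measurable
  define \<eta> where "\<eta> = (\<lambda>\<xi>. exp (- (1 * of_real \<xi>)) * complex_of_real (tpow 4 \<xi>))"
  have \<eta>: "integrable lborel \<eta>" unfolding \<eta>_def by (rule tpow_exp_integrable) auto
  \<comment> \<open>The constant 6 is \<open>Gamma 4\<close>, from the transform of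
    \<open>\<xi> ^ 3 * exp (- \<xi>)\<close> on the positive axis.\<close>
  have e_ft: "e x = ft \<eta> (- x)" for x
  proof -
    have G: "Gamma 4 = (6::real)"
      using Gamma_fact[of 3, where 'a = real] by (simp add: fact_numeral)
    have "ft \<eta> (- x) = lap (\<lambda>t. of_real (tpow 4 t)) (1 + \<i> * of_real x)"
      unfolding \<eta>_def ft_eq_lap by simp
    also have "\<dots> = e x" using lap_tpow[of 4 "1 + \<i> * of_real x"] by (simp add: e_def G)
    finally show ?thesis ..
  qed
  have ne: "norm (e x) = 6 / (1 + x\<^sup>2)\<^sup>2" for x
    unfolding e_def norm_mult norm_inverse_quartic by simp
  \<comment> \<open>\<open>F\<close> is integrable only against
    \<open>1 / (1 + \<bar>t\<bar>)\<close>, so a weight must be absorbed. From \<open>1 +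
    \<bar>t\<bar> \<le> (1 + \<bar>x\<bar>) * (1 + \<bar>x - t\<bar>)\<close> one factor goes to the
    damping (bound 12) and one to the kernel (constants 3 and 6); this gives 36 and 72.\<close>
  have wbound: "(1 + \<bar>t\<bar>) * norm (e x * ?k (x - t)) \<le> 36 * norm (?k (x - t)) + 72 / Gamma \<nu> * (1 / (1 + x\<^sup>2))" for t x
  proof -
    have kd: "(1 + \<bar>u\<bar>) * norm (?k u) \<le> 3 * norm (?k u) + 6 / Gamma \<nu>" for u
    proof (cases "\<bar>u\<bar> \<le> 2")
      case True
      hence "(1 + \<bar>u\<bar>) * norm (?k u) \<le> 3 * norm (?k u)" by (intro mult_right_mono) auto
      moreover have "0 \<le> 6 / Gamma \<nu>" using \<nu> by simp
      ultimately show ?thesis by linarith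
    next
      case False
      have "norm (?k u) \<le> \<bar>kap \<nu> 1 u\<bar> + \<bar>kap \<nu> 1 (1 - u)\<bar>"
        unfolding half_kernel_def by (rule order_trans[OF norm_triangle_ineq]) (simp add: norm_mult)
      hence "(1 + \<bar>u\<bar>) * norm (?k u) \<le> (1 + \<bar>u\<bar>) * \<bar>kap \<nu> 1 u\<bar> + (1 + \<bar>u\<bar>) * \<bar>kap \<nu> 1 (1 - u)\<bar>"
        unfolding distrib_left[symmetric] by (intro mult_left_mono) auto
      also have "(1 + \<bar>u\<bar>) * \<bar>kap \<nu> 1 u\<bar> \<le> 3 / Gamma \<nu>"
        by (rule kap_decay[OF \<nu>]) (use False in auto)
      also have "(1 + \<bar>u\<bar>) * \<bar>kap \<nu> 1 (1 - u)\<bar> \<le> 3 / Gamma \<nu>"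
      proof (cases "u > 0")
        case True
        thus ?thesis using False \<nu> by (simp add: less_imp_le)
      next
        case u: False
        have "(1 + \<bar>u\<bar>) * \<bar>kap \<nu> 1 (1 - u)\<bar> \<le> (1 + \<bar>1 - u\<bar>) * \<bar>kap \<nu> 1 (1 - u)\<bar>"
          using u by (intro mult_right_mono) auto
        also have "\<dots> \<le> 3 / Gamma \<nu>" by (rule kap_decay[OF \<nu>]) (use u False in auto)
        finally show ?thesis .
      qed
      finally have "(1 + \<bar>u\<bar>) * norm (?k u) \<le> 6 / Gamma \<nu>" by simp
      thus ?thesis by (simp add: add.commute add_increasing2)
    qed
    have ex: "(1 + \<bar>x\<bar>) * norm (e x) \<le> 12 * (1 / (1 + x\<^sup>2))"
    proof -
      have "\<bar>x\<bar> \<le> 1 + x\<^sup>2" using sum_squares_ge_zero[of "\<bar>x\<bar> - 1" 0] by (cases "\<bar>x\<bar> \<le> 1") (auto simp: abs_le_iff power2_eq_square algebra_simps intro: order_trans[of _ "x * x"] abs_le_square_iff[THEN iffD1])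
      hence "1 + \<bar>x\<bar> \<le> 1 + (1 + x\<^sup>2)" by simp
      also have "\<dots> \<le> 2 * (1 + x\<^sup>2)" by simp
      finally have "1 + \<bar>x\<bar> \<le> 2 * (1 + x\<^sup>2)" .
      hence "(1 + \<bar>x\<bar>) * (6 / (1 + x\<^sup>2)\<^sup>2) \<le> (2 * (1 + x\<^sup>2)) * (6 / (1 + x\<^sup>2)\<^sup>2)"
        by (intro mult_right_mono) auto
      also have "\<dots> = 12 * (1 / (1 + x\<^sup>2))"
      proof -
        have "(2 * a) * (6 / a\<^sup>2) = 12 * (1 / a)" if "a > 0" for a :: real
          using that by (simp add: power2_eq_square field_simps)
        from this[of "1 + x\<^sup>2"] show ?thesis by (simp only: add_pos_nonneg zero_less_one zero_le_power2)
      qed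
      finally show ?thesis by (simp only: ne)
    qed
    have e12: "(1 + \<bar>x\<bar>) * norm (e x) \<le> 12"
    proof -
      have "1 / (1 + x\<^sup>2) \<le> 1" by (simp add: add_pos_nonneg)
      thus ?thesis using ex by linarith
    qed
    have "1 + \<bar>t\<bar> \<le> (1 + \<bar>x\<bar>) * (1 + \<bar>x - t\<bar>)"
    proof -
      have "\<bar>t\<bar> \<le> \<bar>x\<bar> + \<bar>x - t\<bar>" by linarith
      moreover have "0 \<le> \<bar>x\<bar> * \<bar>x - t\<bar>" by simp
      moreover have "(1 + a) * (1 + b) = 1 + a + b + a * b" for a b :: real by (simp add: algebra_simps)
      from this[of "\<bar>x\<bar>" "\<bar>x - t\<bar>"] have "(1 + \<bar>x\<bar>) * (1 + \<bar>x - t\<bar>) = 1 + \<bar>x\<bar> + \<bar>x - t\<bar> + \<bar>x\<bar> * \<bar>x - t\<bar>" .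
      ultimately show ?thesis by linarith
    qed
    hence "(1 + \<bar>t\<bar>) * norm (e x * ?k (x - t)) \<le> ((1 + \<bar>x\<bar>) * (1 + \<bar>x - t\<bar>)) * norm (e x * ?k (x - t))"
      by (rule mult_right_mono) simp
    also have "\<dots> = ((1 + \<bar>x\<bar>) * norm (e x)) * ((1 + \<bar>x - t\<bar>) * norm (?k (x - t)))"
      by (simp add: norm_mult)
    also have "\<dots> \<le> ((1 + \<bar>x\<bar>) * norm (e x)) * (3 * norm (?k (x - t)) + 6 / Gamma \<nu>)"
      by (intro mult_left_mono kd) auto
    also have "\<dots> \<le> 12 * (3 * norm (?k (x - t))) + (12 * (1 / (1 + x\<^sup>2))) * (6 / Gamma \<nu>)"
      unfolding distrib_left using \<nu> by (intro add_mono mult_right_mono e12 ex) auto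
    finally show ?thesis by (simp add: mult_ac)
  qed
  have ki: "integrable lborel ?k" by (rule half_kernel_integrable[OF \<nu>])
  have shift: "integrable lborel (\<lambda>x. ?k (x - t))" for t
    using lborel_integrable_real_affine[OF ki, of 1 "- t"] by simp
  define C where "C = 36 * (LINT x|lborel. norm (?k x)) + 72 / Gamma \<nu> * (LINT x|lborel. 1 / (1 + x\<^sup>2 :: real))"
  have ei: "integrable lborel (\<lambda>x. e x * ?k (x - t))" for t
  proof (rule integrable_bounded_mult[OF shift])
    show "norm (e x) \<le> 6" for x
      unfolding ne by (simp add: divide_le_eq add_pos_nonneg one_le_power)
  qed simp
  have Wbound: "(1 + \<bar>t\<bar>) * (LINT x|lborel. norm (e x * ?k (x - t))) \<le> C" for t
  proof -
    have "(1 + \<bar>t\<bar>) * (LINT x|lborel. norm (e x * ?k (x - t))) = (LINT x|lborel. (1 + \<bar>t\<bar>) * norm (e x * ?k (x - t)))"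
      by simp
    also have "\<dots> \<le> (LINT x|lborel. 36 * norm (?k (x - t)) + 72 / Gamma \<nu> * (1 / (1 + x\<^sup>2)))"
      using ei shift integrable_inverse_one_plus_square
      by (intro integral_mono wbound Bochner_Integration.integrable_add integrable_mult_right integrable_norm) auto
    also have "\<dots> = 36 * (LINT x|lborel. norm (?k (x - t))) + 72 / Gamma \<nu> * (LINT x|lborel. 1 / (1 + x\<^sup>2 :: real))"
      unfolding integral_mult_right_zero[symmetric]
      by (intro Bochner_Integration.integral_add integrable_mult_right integrable_norm shift integrable_inverse_one_plus_square)
    also have "(LINT x|lborel. norm (?k (x - t))) = (LINT x|lborel. norm (?k x))"
      using lborel_integral_real_affine[of 1 "\<lambda>x. norm (?k x)" "- t"] by simp
    finally show ?thesis by (simp add: C_def)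
  qed
  have pair: "integrable (lborel \<Otimes>\<^sub>M lborel) (\<lambda>(t, x). e x * ?k (x - t) * F t)"
  proof (rule lborel_pair.Fubini_integrable)
    show "integrable lborel (\<lambda>t. LINT x|lborel. norm (case (t, x) of (t, x) \<Rightarrow> e x * ?k (x - t) * F t))"
    proof (rule Bochner_Integration.integrable_bound)
      show "integrable lborel (\<lambda>t. C * norm (F t / of_real (1 + \<bar>t\<bar>)))" using F by simp
      show "AE t in lborel. norm (LINT x|lborel. norm (case (t, x) of (t, x) \<Rightarrow> e x * ?k (x - t) * F t))
          \<le> norm (C * norm (F t / of_real (1 + \<bar>t\<bar>)))"
      proof (rule AE_I2)
        fix t
        have "(LINT x|lborel. norm (e x * ?k (x - t) * F t)) = (LINT x|lborel. norm (e x * ?k (x - t))) * norm (F t)"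
          by (simp add: norm_mult)
        also have "\<dots> = ((1 + \<bar>t\<bar>) * (LINT x|lborel. norm (e x * ?k (x - t)))) * norm (F t / of_real (1 + \<bar>t\<bar>))"
          by (simp add: norm_divide del: of_real_add)
        also have "\<dots> \<le> C * norm (F t / of_real (1 + \<bar>t\<bar>))"
          by (intro mult_right_mono Wbound) simp
        finally show "norm (LINT x|lborel. norm (case (t, x) of (t, x) \<Rightarrow> e x * ?k (x - t) * F t))
          \<le> norm (C * norm (F t / of_real (1 + \<bar>t\<bar>)))" by simp
      qed
    qed measurable
    show "AE t in lborel. integrable lborel (\<lambda>x. case (t, x) of (t, x) \<Rightarrow> e x * ?k (x - t) * F t)"
      using ei by simp
  qed measurable
  have "integrable lborel (\<lambda>x. LINT t|lborel. e x * ?k (x - t) * F t)"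
    using lborel_pair.integrable_snd[OF pair] by simp
  thus "integrable lborel (\<lambda>x. e x * conv ?k F x)" by (simp add: conv_def mult.assoc)
  assume \<omega>: "\<omega> \<le> 0"
  \<comment> \<open>Damping moves the frequency to \<omega> - \<xi> with \<xi> > 0, which is
    negative even at \<omega> = 0.\<close>
  have inner: "(LINT x|lborel. iexp (\<omega> * x) * (e x * ?k (x - t))) = 0" for t
  proof -
    have zero: "(LINT x|lborel. iexp ((\<omega> - \<xi>) * x) * (\<eta> \<xi> * ?k (x - t))) = 0" for \<xi>
    proof -
      have "(LINT x|lborel. iexp ((\<omega> - \<xi>) * x) * (\<eta> \<xi> * ?k (x - t))) = \<eta> \<xi> * ft (\<lambda>x. ?k (x - t)) (\<omega> - \<xi>)"
        unfolding ft_def integral_mult_right_zero[symmetric] by (simp only: mult.left_commute)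
      also have "\<dots> = 0"
      proof (cases "\<xi> > 0")
        case True
        thus ?thesis unfolding ft_shift using ft_half_kernel[OF \<nu>, of "\<omega> - \<xi>"] \<omega> by simp
      qed (simp add: \<eta>_def)
      finally show ?thesis .
    qed
    have "(LINT x|lborel. iexp (\<omega> * x) * (e x * ?k (x - t))) =
        (LINT x|lborel. LINT \<xi>|lborel. iexp ((\<omega> - \<xi>) * x) * (\<eta> \<xi> * ?k (x - t)))"
    proof -
      have "(iexp (\<omega> * x) * ?k (x - t)) * (iexp (- x * \<xi>) * \<eta> \<xi>) = iexp ((\<omega> - \<xi>) * x) * (\<eta> \<xi> * ?k (x - t))" for x \<xi>
        by (simp add: algebra_simps exp_diff exp_minus divide_inverse)
      hence "(iexp (\<omega> * x) * ?k (x - t)) * e x = (LINT \<xi>|lborel. iexp ((\<omega> - \<xi>) * x) * (\<eta> \<xi> * ?k (x - t)))" for x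
        unfolding e_ft ft_def by (simp only: integral_mult_right_zero[symmetric])
      moreover have "iexp (\<omega> * x) * (e x * ?k (x - t)) = (iexp (\<omega> * x) * ?k (x - t)) * e x" for x by simp
      ultimately show ?thesis by presburger
    qed
    also have "\<dots> = (LINT \<xi>|lborel. LINT x|lborel. iexp ((\<omega> - \<xi>) * x) * (\<eta> \<xi> * ?k (x - t)))"
    proof (rule lborel_pair.Fubini_integral)
      from integrable_bounded_mult[OF product_pair_integrable[OF \<eta> shift[of t]], of "\<lambda>(\<xi>, x). iexp ((\<omega> - \<xi>) * x)" 1]
      show "integrable (lborel \<Otimes>\<^sub>M lborel) (\<lambda>(\<xi>, x). iexp ((\<omega> - \<xi>) * x) * (\<eta> \<xi> * ?k (x - t)))"
        by (simp add: split_beta' del: of_real_mult of_real_diff)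
    qed
    finally show ?thesis unfolding zero by simp
  qed
  have zero: "(LINT x|lborel. iexp (\<omega> * x) * (e x * ?k (x - t) * F t)) = 0" for t
  proof -
    have "(LINT x|lborel. iexp (\<omega> * x) * (e x * ?k (x - t) * F t)) = (LINT x|lborel. iexp (\<omega> * x) * (e x * ?k (x - t))) * F t"
      by (simp only: integral_mult_left_zero[symmetric] mult.assoc)
    thus ?thesis unfolding inner by simp
  qed
  have "ft (\<lambda>x. e x * conv ?k F x) \<omega> = (LINT x|lborel. LINT t|lborel. iexp (\<omega> * x) * (e x * ?k (x - t) * F t))"
    unfolding ft_def conv_def by (simp only: integral_mult_right_zero mult.assoc)
  also have "\<dots> = (LINT t|lborel. LINT x|lborel. iexp (\<omega> * x) * (e x * ?k (x - t) * F t))"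
  proof (rule lborel_pair.Fubini_integral)
    from integrable_bounded_mult[OF pair, of "\<lambda>(t, x). iexp (\<omega> * x)" 1]
    show "integrable (lborel \<Otimes>\<^sub>M lborel) (\<lambda>(t, x). iexp (\<omega> * x) * (e x * ?k (x - t) * F t))"
      by (simp add: split_beta' del: of_real_mult)
  qed
  finally show "ft (\<lambda>x. e x * conv ?k F x) \<omega> = 0" unfolding zero by simp
qed

section \<open>Vanishing under one-sided decay\<close>

lemma kap_conv_pointwise:
  fixes F :: "real \<Rightarrow> complex"
  assumes "\<And>x. integrable lborel (\<lambda>t. of_real (tpow \<nu> (x - t)) * F t)"
  shows "integrable lborel (\<lambda>t. of_real (kap \<nu> 1 (x - t)) * F t)"
proof -
  have "integrable lborel (\<lambda>t. (of_real (tpow \<nu> (x - t)) * F t - of_real (tpow \<nu> (x - 1 - t)) * F t) / of_real (Gamma \<nu>))"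
    using assms by simp
  also have "(\<lambda>t. (of_real (tpow \<nu> (x - t)) * F t - of_real (tpow \<nu> (x - 1 - t)) * F t) / of_real (Gamma \<nu>)) =
      (\<lambda>t. of_real (kap \<nu> 1 (x - t)) * F t)"
    by (simp add: fun_eq_iff kap_def algebra_simps diff_divide_distrib)
  finally show ?thesis .
qed

text \<open>The weight \<open>exp (s x)\<close> grows only to the right, where the reflected kernel
  is 0. The transform of the weighted kernel is evaluated at \<open>Re (- z) > 0\<close>, away from
  the zeros of \<open>1 - exp z\<close>, so convolution with it can be undone.\<close>

lemma reflected_conv_weighted:
  fixes F :: "real \<Rightarrow> complex"
  assumes \<nu>: "0 < \<nu>" "\<nu> \<le> 1" and s: "s > 0"
    and F: "integrable lborel (\<lambda>x. exp (of_real (s * x)) * F x)"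
  defines "a \<equiv> \<lambda>u. exp (- (- of_real s * of_real u)) * complex_of_real (kap \<nu> 1 (1 - u))"
  defines "b \<equiv> \<lambda>x. exp (of_real (s * x)) * F x"
  shows "integrable lborel a"
    and "conv a b x = exp (of_real (s * x)) * conv (\<lambda>u. of_real (kap \<nu> 1 (1 - u))) F x"
    and "AE x in lborel. integrable lborel (\<lambda>t. of_real (kap \<nu> 1 (1 - (x - t))) * F t)"
    and "ft a \<omega> \<noteq> 0"
proof -
  have k: "integrable lborel (\<lambda>t. exp (- (w * of_real t)) * complex_of_real (kap \<nu> 1 t))" if "Re w \<ge> 0" for w
    by (rule kap_exp_integrable[OF \<nu>]) (use that in auto)
  show a: "integrable lborel a"
    unfolding a_def using k[of "of_real s"] s by (intro kap_reflect_integrable(1)) simp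
  have e: "exp (- (- of_real s * of_real (x - t))) * exp (of_real (s * t)) = exp (complex_of_real (s * x))" for x t
    by (simp add: algebra_simps flip: exp_add)
  have eq: "a (x - t) * b t = exp (of_real (s * x)) * (of_real (kap \<nu> 1 (1 - (x - t))) * F t)" for x t
    unfolding a_def b_def e[of x t, symmetric] by (simp only: mult_ac)
  show "conv a b x = exp (of_real (s * x)) * conv (\<lambda>u. of_real (kap \<nu> 1 (1 - u))) F x"
    unfolding conv_def eq by (rule integral_mult_right_zero)
  have "AE x in lborel. integrable lborel (\<lambda>t. a (x - t) * b t)"
    using lborel_pair.AE_integrable_snd[OF conv_pair_integrable[OF a F[folded b_def]]] by simp
  thus "AE x in lborel. integrable lborel (\<lambda>t. of_real (kap \<nu> 1 (1 - (x - t))) * F t)"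
  proof eventually_elim
    case (elim x)
    hence "integrable lborel (\<lambda>t. exp (- of_real (s * x)) * (exp (of_real (s * x)) * (of_real (kap \<nu> 1 (1 - (x - t))) * F t)))"
      unfolding eq by (rule integrable_mult_right)
    thus ?case by (simp add: mult.assoc[symmetric] flip: exp_add)
  qed
  define z where "z = - of_real s - \<i> * of_real \<omega>"
  have z: "Re (- z) > 0" using s by (simp add: z_def)
  hence z0: "- z \<noteq> 0" by auto
  have "ft a \<omega> = lap (\<lambda>u. of_real (kap \<nu> 1 (1 - u))) z"
    unfolding a_def ft_eq_lap z_def ..
  also have "\<dots> = exp (- z) * lap (\<lambda>t. of_real (kap \<nu> 1 t)) (- z)"
    using k[of "- z"] z by (intro kap_reflect_integrable(2)) simp
  also have "\<dots> = exp (- z) * ((1 - exp z) * (- z) powr (- of_real \<nu>))"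
    using lap_kap[OF \<nu> zero_less_one _ z0] z by simp
  finally have eq: "ft a \<omega> = exp (- z) * ((1 - exp z) * (- z) powr (- of_real \<nu>))" .
  have "norm (exp z) < 1" using z by simp
  hence "exp z \<noteq> 1" by (metis norm_one order_less_irrefl)
  thus "ft a \<omega> \<noteq> 0" unfolding eq using z0 by simp
qed

text \<open>The damped convolution \<open>g\<close> has no spectrum on a half line, and the weight
  \<open>exp (s x)\<close> continues its transform analytically into a strip bordering on that half
  line. So \<open>g\<close> vanishes, and the damping factor has no zeros.\<close>

lemma half_kernel_annihilates:
  fixes F :: "real \<Rightarrow> complex"
  assumes \<nu>: "0 < \<nu>" "\<nu> \<le> 1" and s: "s > 0" and Fm [measurable]: "F \<in> borel_measurable borel"
    and F: "integrable lborel (\<lambda>x. exp (of_real (s * x)) * F x)"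
    and conv: "\<And>x. integrable lborel (\<lambda>t. of_real (tpow \<nu> (x - t)) * F t)"
    and Y: "integrable lborel (\<lambda>x. exp (of_real (s * x)) * conv (\<lambda>t. of_real (kap \<nu> 1 t)) F x)"
  shows "AE x in lborel. conv (\<lambda>t. of_real (kap \<nu> 1 t)) F x +
    exp (- (\<i> * of_real (pi * \<nu>))) * conv (\<lambda>u. of_real (kap \<nu> 1 (1 - u))) F x = 0"
proof -
  define c where "c = exp (- (\<i> * of_real (pi * \<nu>)))"
  define e where "e = (\<lambda>x. 6 * (1 + \<i> * of_real x) powr (- of_real 4))"
  define g where "g = (\<lambda>x. e x * conv (half_kernel \<nu>) F x)"
  have em [measurable]: "e \<in> borel_measurable borel" unfolding e_def powr_def by measurable
  have e6: "norm (e x) \<le> 6" for x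
    unfolding e_def norm_mult norm_inverse_quartic by (simp add: divide_le_eq add_pos_nonneg one_le_power)
  have e0: "e x \<noteq> 0" for x
  proof -
    have "1 + \<i> * of_real x \<noteq> 0" by (auto simp: complex_eq_iff)
    thus ?thesis by (simp add: e_def)
  qed
  have F1: "integrable lborel (\<lambda>x. F x / of_real (1 + \<bar>x\<bar>))"
  proof (rule Bochner_Integration.integrable_bound)
    show "integrable lborel (\<lambda>x. norm (of_real (tpow \<nu> (1 - x)) * F x) + norm (exp (of_real (s * x)) * F x))"
      using conv[of 1] F by auto
    show "AE x in lborel. norm (F x / of_real (1 + \<bar>x\<bar>)) \<le>
        norm (norm (of_real (tpow \<nu> (1 - x)) * F x) + norm (exp (of_real (s * x)) * F x))"
    proof (rule AE_I2)
      fix x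
      \<comment> \<open>To the left the kernel seen from the point 1 decays no faster than
        \<open>1 / (1 + \<bar>x\<bar>)\<close>; to the right the exponential weight is at least
        1.\<close>
      have "1 / (1 + \<bar>x\<bar>) \<le> tpow \<nu> (1 - x) + exp (s * x)"
      proof (cases "x \<le> 0")
        case True
        have "1 / (1 + \<bar>x\<bar>) = (1 - x) powr (- 1)" using True by (simp add: powr_minus field_simps)
        also have "\<dots> \<le> (1 - x) powr (\<nu> - 1)" using True \<nu> by (intro powr_mono) auto
        also have "\<dots> = tpow \<nu> (1 - x)" using True by (simp add: tpow_pos)
        finally show ?thesis using exp_ge_zero[of "s * x"] by linarith
      next
        case False
        hence "1 / (1 + \<bar>x\<bar>) \<le> 1" by simp
        also have "1 \<le> exp (s * x)" using False s by simp
        finally show ?thesis using tpow_nonneg[of \<nu> "1 - x"] by linarith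
      qed
      hence "1 / (1 + \<bar>x\<bar>) * norm (F x) \<le> (tpow \<nu> (1 - x) + exp (s * x)) * norm (F x)"
        by (rule mult_right_mono) simp
      also have "\<dots> = norm (of_real (tpow \<nu> (1 - x)) * F x) + norm (exp (of_real (s * x)) * F x)"
        by (simp add: norm_mult distrib_right)
      finally show "norm (F x / of_real (1 + \<bar>x\<bar>)) \<le>
          norm (norm (of_real (tpow \<nu> (1 - x)) * F x) + norm (exp (of_real (s * x)) * F x))"
        by (simp add: norm_divide del: of_real_add)
    qed
  qed measurable
  have g: "integrable lborel g" "\<And>\<omega>. \<omega> \<le> 0 \<Longrightarrow> ft g \<omega> = 0"
    unfolding g_def e_def by (rule half_line_vanishing[OF \<nu> F1 Fm])+
  have gm [measurable]: "g \<in> borel_measurable borel" using g(1) by auto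
  let ?Y = "conv (\<lambda>t. of_real (kap \<nu> 1 t)) F" and ?U = "conv (\<lambda>u. of_real (kap \<nu> 1 (1 - u))) F"
  have ae: "AE x in lborel. conv (half_kernel \<nu>) F x = ?Y x + c * ?U x"
    using reflected_conv_weighted(3)[OF \<nu> s F]
  proof eventually_elim
    case (elim x)
    hence "integrable lborel (\<lambda>t. c * (of_real (kap \<nu> 1 (1 - (x - t))) * F t))" by simp
    from Bochner_Integration.integral_add[OF kap_conv_pointwise[OF conv, of x] this]
    show ?case
      unfolding conv_def half_kernel_def c_def integral_mult_right_zero by (simp only: distrib_right mult.assoc)
  qed
  have U: "integrable lborel (\<lambda>x. exp (of_real (s * x)) * ?U x)"
    unfolding reflected_conv_weighted(2)[OF \<nu> s F, symmetric]
    by (intro conv_integrable reflected_conv_weighted(1)[OF \<nu> s F] F)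
  have gs: "integrable lborel (\<lambda>x. exp (- (of_real (- s * x))) * g x)"
  proof -
    have "integrable lborel (\<lambda>x. exp (of_real (s * x)) * ?Y x + c * (exp (of_real (s * x)) * ?U x))"
      using Y U by simp
    from integrable_bounded_mult[OF this _ e6]
    have i: "integrable lborel (\<lambda>x. e x * (exp (of_real (s * x)) * ?Y x + c * (exp (of_real (s * x)) * ?U x)))" by simp
    have "AE x in lborel. exp (- (of_real (- s * x))) * g x = e x * (exp (of_real (s * x)) * ?Y x + c * (exp (of_real (s * x)) * ?U x))"
      using ae by eventually_elim (simp add: g_def algebra_simps)
    thus ?thesis using i by (subst integrable_cong_AE) auto
  qed
  have g0: "integrable lborel (\<lambda>x. exp (- (of_real (0 * x))) * g x)" using g(1) by simp
  have Z: "lap g z = 0" if "- s \<le> Re z" "Re z \<le> 0" for z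
  proof (rule strip_uniqueness[OF s lap_continuous[OF gs g0 gm] lap_holomorphic[OF gs g0 gm] _ that])
    \<comment> \<open>The point \<open>\<i> y\<close> of the strip is the frequency
      \<open>- y\<close>.\<close>
    fix y :: real assume "y \<ge> 0"
    thus "lap g (\<i> * of_real y) = 0"
      using ft_eq_lap[of 0 g "- y"] g(2)[of "- y"] by simp
  qed
  have "AE x in lborel. exp (- (of_real (- s) * of_real x)) * g x = 0"
  proof (rule ft_zero_imp_AE_zero)
    show "integrable lborel (\<lambda>x. exp (- (of_real (- s) * of_real x)) * g x)" using gs by simp
    show "ft (\<lambda>x. exp (- (of_real (- s) * of_real x)) * g x) \<omega> = 0" for \<omega>
      unfolding ft_eq_lap using s by (intro Z) auto
  qed
  with ae show ?thesis
    unfolding c_def[symmetric] by eventually_elim (use e0 in \<open>auto simp: g_def\<close>)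
qed

text \<open>Annihilation for \<open>F\<close> gives \<open>?Y + c * ?U = 0\<close>; for its
  conjugate, conjugated back, \<open>?Y + cnj c * ?U = 0\<close>. As \<open>c\<close> is not real
  for 0 < \<nu> < 1, \<open>?U\<close> vanishes, and the weighted reflected kernel has a transform
  without zeros.\<close>

lemma one_sided_decay_imp_zero:
  fixes F :: "real \<Rightarrow> complex"
  assumes \<nu>: "0 < \<nu>" "\<nu> < 1" and s: "s > 0" and Fm: "F \<in> borel_measurable borel"
    and F: "integrable lborel (\<lambda>x. exp (of_real (s * x)) * F x)"
    and conv: "\<And>x. integrable lborel (\<lambda>t. of_real (tpow \<nu> (x - t)) * F t)"
    and Y: "integrable lborel (\<lambda>x. exp (of_real (s * x)) * conv (\<lambda>t. of_real (kap \<nu> 1 t)) F x)"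
  shows "AE x in lborel. F x = 0"
proof -
  have \<nu>1: "\<nu> \<le> 1" using \<nu> by simp
  define c where "c = exp (- (\<i> * of_real (pi * \<nu>)))"
  let ?Y = "conv (\<lambda>t. of_real (kap \<nu> 1 t)) F" and ?U = "conv (\<lambda>u. of_real (kap \<nu> 1 (1 - u))) F"
  have cn: "conv (\<lambda>t. of_real (k t)) (\<lambda>x. cnj (F x)) x = cnj (conv (\<lambda>t. of_real (k t)) F x)" for k x
    unfolding conv_def by (subst Bochner_Integration.integral_cnj[symmetric]) simp
  have cs: "exp (of_real (s * x)) * cnj w = cnj (exp (of_real (s * x)) * w)" for x w
    by (simp add: exp_cnj)
  have 1: "AE x in lborel. ?Y x + c * ?U x = 0"
    unfolding c_def by (rule half_kernel_annihilates[OF \<nu>(1) \<nu>1 s Fm F conv Y])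
  have 2: "AE x in lborel. cnj (?Y x) + c * cnj (?U x) = 0"
    unfolding c_def cn[symmetric]
  proof (rule half_kernel_annihilates[OF \<nu>(1) \<nu>1 s])
    show "(\<lambda>x. cnj (F x)) \<in> borel_measurable borel"
      using measurable_compose[OF Fm borel_measurable_continuous_onI[of cnj]] by (simp add: continuous_on_cnj)
    show "integrable lborel (\<lambda>x. exp (of_real (s * x)) * cnj (F x))"
      unfolding cs by (rule integrable_cnj[OF F])
    show "integrable lborel (\<lambda>t. of_real (tpow \<nu> (x - t)) * cnj (F t))" for x
      using integrable_cnj[OF conv[of x]] by (simp only: complex_cnj_mult complex_cnj_complex_of_real)
    show "integrable lborel (\<lambda>x. exp (of_real (s * x)) * conv (\<lambda>t. of_real (kap \<nu> 1 t)) (\<lambda>x. cnj (F x)) x)"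
      unfolding cn cs by (rule integrable_cnj[OF Y])
  qed
  have "c \<noteq> cnj c"
  proof
    assume "c = cnj c"
    hence "Im c = 0" by (simp add: complex_eq_iff)
    hence "sin (pi * \<nu>) = 0" by (simp add: c_def Im_exp)
    moreover have "sin (pi * \<nu>) > 0" using \<nu> by (intro sin_gt_zero) auto
    ultimately show False by simp
  qed
  from 1 2 have U0: "AE x in lborel. ?U x = 0"
  proof eventually_elim
    case (elim x)
    from elim(2) have "cnj (cnj (?Y x) + c * cnj (?U x)) = 0" by simp
    hence "?Y x + cnj c * ?U x = 0" by simp
    moreover have "(c - cnj c) * ?U x = (?Y x + c * ?U x) - (?Y x + cnj c * ?U x)" by (simp add: left_diff_distrib)
    ultimately have "(c - cnj c) * ?U x = 0" using elim(1) by simp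
    thus ?case using \<open>c \<noteq> cnj c\<close> by simp
  qed
  define a where "a = (\<lambda>u. exp (- (- of_real s * of_real u)) * complex_of_real (kap \<nu> 1 (1 - u)))"
  define b where "b = (\<lambda>x. exp (of_real (s * x)) * F x)"
  note R = reflected_conv_weighted[OF \<nu>(1) \<nu>1 s F, folded a_def b_def]
  have bi: "integrable lborel b" unfolding b_def by (rule F)
  have "AE x in lborel. conv a b x = 0"
    using U0 by eventually_elim (simp add: R(2))
  hence "ft (conv a b) = ft (\<lambda>x. 0)"
    using conv_integrable[OF R(1) bi] by (intro ft_cong_AE) auto
  hence "ft a \<omega> * ft b \<omega> = 0" for \<omega>
    using ft_conv[OF R(1) bi, of \<omega>] by (simp add: ft_def[of "\<lambda>x. 0"])
  hence "ft b \<omega> = 0" for \<omega> using R(4) by simp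
  hence "AE x in lborel. b x = 0" by (rule ft_zero_imp_AE_zero[OF bi])
  thus ?thesis by eventually_elim (simp add: b_def)
qed

text \<open>The factor \<open>exp (\<sigma> x)\<close> removes the twist, and the weight with
  \<open>s = - Re \<sigma>\<close> restores the modulus. Integrability of \<open>f\<close> and
  \<open>w\<close> thus becomes exponential decay to the right of \<open>F\<close> and of its
  convolution with \<open>kap\<close>.\<close>

theorem frac_deriv_degenerate:
  assumes \<nu>: "0 < \<nu>" "\<nu> < 1" and \<sigma>: "Re \<sigma> < 0" and M: "M \<ge> 1" and f: "integrable lborel f"
    and conv: "\<And>x. integrable lborel (\<lambda>t. frac_kernel \<sigma> \<nu> (x - t) * f t)"
    and ch: "D_chain \<sigma> M \<psi>" "\<psi> 0 = conv (frac_kernel \<sigma> \<nu>) f"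
    and last: "tdiff \<sigma> 1 (\<psi> (M - 1)) = tmean \<sigma> 1 w" and w: "integrable lborel w"
  shows "AE x in lborel. f x = 0"
proof -
  define s where "s = - Re \<sigma>"
  have s: "s > 0" using \<sigma> by (simp add: s_def)
  have G: "Gamma \<nu> > 0" using \<nu> by simp
  \<comment> \<open>One difference fewer than \<open>M\<close>: the last one goes into the
    kernel.\<close>
  define f1 where "f1 = (tdiff \<sigma> 1 ^^ (M - 1)) f"
  define F where "F = (\<lambda>x. exp (\<sigma> * of_real x) * f1 x)"
  have f1: "integrable lborel f1" unfolding f1_def by (rule ft_tdiff_funpow(1)[OF f])
  have f1m [measurable]: "f1 \<in> borel_measurable borel" using f1 by auto
  have bd: "integrable lborel (\<lambda>x. exp (of_real (s * x)) * (exp (\<sigma> * of_real x) * g x))"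
    if "integrable lborel g" for g
  proof -
    have "integrable lborel (\<lambda>x. (exp (of_real (s * x)) * exp (\<sigma> * of_real x)) * g x)"
    proof (rule integrable_bounded_mult[OF that, where C = 1])
      show "norm (exp (of_real (s * x)) * exp (\<sigma> * of_real x)) \<le> 1" for x
        by (simp add: norm_mult s_def flip: exp_add)
    qed simp
    thus ?thesis by (simp only: mult.assoc)
  qed
  have ek: "exp (\<sigma> * of_real x) * exp (- (\<sigma> * of_real (x - t))) = exp (\<sigma> * of_real t)" for x t
    by (simp add: algebra_simps flip: exp_add)
  have Y: "conv (\<lambda>t. of_real (kap \<nu> 1 t)) F x = exp (\<sigma> * of_real x) * (tmean \<sigma> 1 ^^ M) w x" for x
  proof -
    have "of_real (kap \<nu> 1 (x - t)) * F t = exp (\<sigma> * of_real x) * (diff_kernel \<sigma> \<nu> 1 (x - t) * f1 t)" for t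
      unfolding F_def diff_kernel_def ek[of x t, symmetric] by (simp only: mult_ac)
    hence "conv (\<lambda>t. of_real (kap \<nu> 1 t)) F x = exp (\<sigma> * of_real x) * conv (diff_kernel \<sigma> \<nu> 1) f1 x"
      unfolding conv_def by simp
    also have "conv (diff_kernel \<sigma> \<nu> 1) f1 = (tdiff \<sigma> 1 ^^ M) (\<psi> 0)"
      unfolding f1_def ch(2) using tdiff_funpow_frac_integral(2)[OF conv, where \<delta> = 1 and i = "M - 1"] M by simp
    also have "\<dots> = (tmean \<sigma> 1 ^^ M) w"
      using D_chain_tmean[OF ch(1) zero_less_one last, of M] M by simp
    finally show ?thesis .
  qed
  have "AE x in lborel. F x = 0"
  proof (rule one_sided_decay_imp_zero[OF \<nu> s])
    show "F \<in> borel_measurable borel" unfolding F_def by measurable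
    show "integrable lborel (\<lambda>x. exp (of_real (s * x)) * F x)"
      unfolding F_def by (rule bd[OF f1])
    show "integrable lborel (\<lambda>t. of_real (tpow \<nu> (x - t)) * F t)" for x
    proof -
      have "of_real (tpow \<nu> (x - t)) * F t = (exp (\<sigma> * of_real x) * of_real (Gamma \<nu>)) * (frac_kernel \<sigma> \<nu> (x - t) * f1 t)" for t
      proof -
        have "complex_of_real (tpow \<nu> (x - t)) = of_real (Gamma \<nu>) * of_real (tpow \<nu> (x - t) / Gamma \<nu>)"
          using G by simp
        thus ?thesis unfolding F_def frac_kernel_def ek[of x t, symmetric] by (simp only: mult_ac)
      qed
      thus ?thesis using tdiff_funpow_frac_integral(1)[OF conv, where x = x and \<delta> = 1 and i = "M - 1"] by (simp add: f1_def)
    qed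
    show "integrable lborel (\<lambda>x. exp (of_real (s * x)) * conv (\<lambda>t. of_real (kap \<nu> 1 t)) F x)"
      unfolding Y by (rule bd[OF tmean_funpow_integrable[OF zero_less_one w]])
  qed
  hence "AE x in lborel. f1 x = 0" by eventually_elim (simp add: F_def)
  hence "ft f1 = ft (\<lambda>x. 0)" by (rule ft_cong_AE) auto
  hence "(1 - exp (- ((\<sigma> - \<i> * of_real \<omega>) * of_real 1))) ^ (M - 1) * ft f \<omega> = 0" for \<omega>
    using ft_tdiff_funpow(2)[OF f, where \<sigma> = \<sigma> and \<delta> = 1 and j = "M - 1" and \<omega> = \<omega>] by (simp add: f1_def ft_def[of "\<lambda>x. 0"])
  \<comment> \<open>Away from \<open>Re \<sigma> = 0\<close> the modulus of this exponential is not
    1, so the differences have no null frequencies.\<close>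
  moreover have "exp (- ((\<sigma> - \<i> * of_real \<omega>) * of_real 1)) \<noteq> 1" for \<omega>
  proof
    assume "exp (- ((\<sigma> - \<i> * of_real \<omega>) * of_real 1)) = 1"
    hence "norm (exp (- ((\<sigma> - \<i> * of_real \<omega>) * of_real 1))) = 1" by simp
    thus False using \<sigma> by simp
  qed
  ultimately have "ft f \<omega> = 0" for \<omega> by (metis eq_iff_diff_eq_0 mult_eq_0_iff power_not_zero)
  thus ?thesis by (rule ft_zero_imp_AE_zero[OF f])
qed

section \<open>The generating function\<close>

text \<open>The series of \<open>- ln (1 - w)\<close> cut off after degree \<open>p\<close>; at
  \<open>w = 1 - exp (- z)\<close> it approximates \<open>z\<close>. It is the characteristic
  polynomial of the \<open>p\<close>-step backward differentiation formula.\<close>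

definition bdf :: "nat \<Rightarrow> complex \<Rightarrow> complex" where
  "bdf p w = (\<Sum>i=1..p. 1 / of_nat i * w ^ i)"

definition bdf_quot :: "nat \<Rightarrow> complex \<Rightarrow> complex" where
  "bdf_quot p w = (\<Sum>i=1..p. 1 / of_nat i * w ^ (i - 1))"

lemma bdf_eq: "bdf p w = w * bdf_quot p w"
  unfolding bdf_def bdf_quot_def sum_distrib_left
  by (intro sum.cong refl) (simp flip: power_Suc)

lemma dominant_constant_nonzero:
  fixes a r :: complex
  assumes "norm r < norm a"
  shows "a + r \<noteq> 0"
  using assms by (metis add_eq_0_iff2 norm_minus_cancel order_less_irrefl)

text \<open>After multiplication by a truncation of the reciprocal series, the constant coefficient
  outweighs the sum of the moduli of the others.\<close>

lemma bdf_quot_nonzero_cball: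
  assumes p: "p \<in> {2, 3, 4, 5}" and z: "norm \<zeta> \<le> 1"
  shows "bdf_quot p (1 - \<zeta>) \<noteq> 0"
proof
  assume 0: "bdf_quot p (1 - \<zeta>) = 0"
  have pw: "norm (c * \<zeta> ^ k) \<le> norm c" for c k
    using z by (simp add: norm_mult norm_power mult_left_le power_le_one)
  have "norm (c * \<zeta>) \<le> norm c" for c
    using pw[of c 1] by simp
  note pw = pw this
  consider "p = 2" | "p = 3" | "p = 4" | "p = 5" using p by auto
  thus False
  proof cases
    case 1
    have "bdf_quot p (1 - \<zeta>) = 3/2 + (-1/2) * \<zeta>"
      by (simp add: 1 bdf_quot_def numeral_eq_Suc field_simps)
    moreover have "norm ((-1/2) * \<zeta>) < norm (3/2 :: complex)"
      by (rule le_less_trans[OF pw(2)]) simp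
    ultimately show False using 0 dominant_constant_nonzero by metis
  next
    case 2
    have "bdf_quot p (1 - \<zeta>) = 11/6 + ((-7/6) * \<zeta> + (1/3) * \<zeta>^2)"
      by (simp add: 2 bdf_quot_def numeral_eq_Suc field_simps)
    moreover have "norm ((-7/6) * \<zeta> + (1/3) * \<zeta>^2) < norm (11/6 :: complex)"
      by (rule le_less_trans[OF norm_triangle_le[OF add_mono[OF pw(2) pw(1)]]]) simp
    ultimately show False using 0 dominant_constant_nonzero by metis
  next
    case 3
    \<comment> \<open>From here on the constant alone no longer dominates. The normalised reciprocal
      begins \<open>1 + (23/25) * \<zeta>\<close>; 9/10 is a rounding of 23/25.\<close>
    have "bdf_quot p (1 - \<zeta>) * (1 + 9/10 * \<zeta>) =
        25/12 + (((-1/24) * \<zeta> + (-77/120) * \<zeta>^2) + ((29/40) * \<zeta>^3 + (-9/40) * \<zeta>^4))"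
      by (simp add: 3 bdf_quot_def numeral_eq_Suc field_simps)
    moreover have "norm (((-1/24) * \<zeta> + (-77/120) * \<zeta>^2) + ((29/40) * \<zeta>^3 + (-9/40) * \<zeta>^4)) < norm (25/12 :: complex)"
      by (rule le_less_trans[OF norm_triangle_le[OF add_mono[OF norm_triangle_le[OF add_mono[OF pw(2) pw(1)]]
            norm_triangle_le[OF add_mono[OF pw(1) pw(1)]]]]]) simp
    ultimately show False using 0 dominant_constant_nonzero by (metis mult_zero_left)
  next
    case 4
    \<comment> \<open>Roundings of 163/137 and \<open>(163/137)^2 - 1\<close>, the first two
      coefficients of the normalised reciprocal after the constant.\<close>
    have "bdf_quot p (1 - \<zeta>) * (1 + 6/5 * \<zeta> + 2/5 * \<zeta>^2) = 137/60 +
        ((((7/300) * \<zeta> + (-19/300) * \<zeta>^2) + ((181/300) * \<zeta>^3 + (-11/75) * \<zeta>^4)) + ((-9/50) * \<zeta>^5 + (2/25) * \<zeta>^6))"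
      by (simp add: 4 bdf_quot_def numeral_eq_Suc field_simps)
    moreover have "norm ((((7/300) * \<zeta> + (-19/300) * \<zeta>^2) + ((181/300) * \<zeta>^3 + (-11/75) * \<zeta>^4)) + ((-9/50) * \<zeta>^5 + (2/25) * \<zeta>^6)) < norm (137/60 :: complex)"
      by (rule le_less_trans[OF norm_triangle_le[OF add_mono[OF norm_triangle_le[OF add_mono[OF norm_triangle_le[OF add_mono[OF pw(2) pw(1)]]
            norm_triangle_le[OF add_mono[OF pw(1) pw(1)]]]] norm_triangle_le[OF add_mono[OF pw(1) pw(1)]]]]]) simp
    ultimately show False using 0 dominant_constant_nonzero by (metis mult_zero_left)
  qed
qed

text \<open>The closed zero set has positive distance from the compact unit disc. The gain in radius
  makes the series of powers of this factor absolutely summable on the unit circle.\<close>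

lemma bdf_quot_nonzero:
  assumes p: "p \<in> {2, 3, 4, 5}"
  obtains R where "R > 1" "\<And>\<zeta>. norm \<zeta> < R \<Longrightarrow> bdf_quot p (1 - \<zeta>) \<noteq> 0"
proof -
  define Z where "Z = (\<lambda>\<zeta>. bdf_quot p (1 - \<zeta>)) -` {0}"
  have "closed Z"
    unfolding Z_def bdf_quot_def by (intro closed_vimage continuous_intros) auto
  moreover have "Z \<inter> cball 0 1 = {}"
    using bdf_quot_nonzero_cball[OF p] by (auto simp: Z_def)
  ultimately obtain d where d: "d > 0" "\<And>x y. x \<in> cball 0 1 \<Longrightarrow> y \<in> Z \<Longrightarrow> d \<le> dist x y"
    using separate_compact_closed[of "cball 0 1" Z] by (metis Int_commute compact_cball)
  show ?thesis
  proof (rule that[of "1 + d"])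
    fix \<zeta> :: complex assume z: "norm \<zeta> < 1 + d"
    show "bdf_quot p (1 - \<zeta>) \<noteq> 0"
    proof (cases "norm \<zeta> \<le> 1")
      case True
      thus ?thesis by (rule bdf_quot_nonzero_cball[OF p])
    next
      case False
      \<comment> \<open>\<open>sgn \<zeta>\<close> is the point of the closed unit disc nearest to
        \<zeta>.\<close>
      have "dist (sgn \<zeta>) \<zeta> = norm \<zeta> - 1"
      proof -
        have "\<zeta> - sgn \<zeta> = of_real (1 - 1 / norm \<zeta>) * \<zeta>"
          using False by (simp add: sgn_div_norm scaleR_conv_of_real field_simps)
        hence "dist (sgn \<zeta>) \<zeta> = \<bar>1 - 1 / norm \<zeta>\<bar> * norm \<zeta>"
          by (simp add: dist_norm norm_minus_commute[of "sgn \<zeta>"] norm_mult del: of_real_diff of_real_divide)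
        also have "\<bar>1 - 1 / norm \<zeta>\<bar> = 1 - 1 / norm \<zeta>"
          using False by (intro abs_of_nonneg) (auto simp: divide_le_eq)
        also have "(1 - 1 / norm \<zeta>) * norm \<zeta> = norm \<zeta> - 1" using False by (auto simp: field_simps)
        finally show ?thesis .
      qed
      moreover have "\<zeta> \<noteq> 0" using False by auto
      hence "sgn \<zeta> \<in> cball 0 1" by (simp add: norm_sgn)
      ultimately have "\<zeta> \<notin> Z" using d(2)[of "sgn \<zeta>" \<zeta>] z by force
      thus ?thesis by (simp add: Z_def)
    qed
  qed (use d in auto)
qed

lemma bdf_quot_of_real_pos:
  assumes "p \<ge> 1" "x \<ge> 0"
  shows "\<exists>y>0. bdf_quot p (of_real x) = of_real y"
proof -
  have "(\<Sum>i=1..p. 1 / real i * x ^ (i - 1)) \<ge> (\<Sum>i\<in>{1::nat}. 1 / real i * x ^ (i - 1))"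
    using assms by (intro sum_mono2) auto
  hence "(\<Sum>i=1..p. 1 / real i * x ^ (i - 1)) > 0" by simp
  thus ?thesis
    by (intro exI[of _ "\<Sum>i=1..p. 1 / real i * x ^ (i - 1)"]) (simp add: bdf_quot_def)
qed

text \<open>The logarithm of \<open>bdf_quot\<close> on the disc that takes the value \<open>0\<close> at \<open>1\<close>; it is the real
  logarithm along \<open>[0, 1]\<close>, which links the coefficients (defined at \<open>0\<close>) with the behaviour near \<open>1\<close>.\<close>

lemma bdf_quot_log:
  assumes p: "p \<in> {2, 3, 4, 5}"
  obtains R L where "R > 1" "L holomorphic_on ball 0 R"
    "\<And>\<zeta>. norm \<zeta> < R \<Longrightarrow> exp (L \<zeta>) = bdf_quot p (1 - \<zeta>)" "L 1 = 0" "Im (L 0) = 0"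
proof -
  obtain R where R: "R > 1" "\<And>\<zeta>. norm \<zeta> < R \<Longrightarrow> bdf_quot p (1 - \<zeta>) \<noteq> 0"
    using bdf_quot_nonzero[OF p] by metis
  have hol: "(\<lambda>\<zeta>. bdf_quot p (1 - \<zeta>)) holomorphic_on ball 0 R"
    unfolding bdf_quot_def by (intro holomorphic_intros)
  obtain g where g: "g holomorphic_on ball 0 R" "\<And>z. z \<in> ball 0 R \<Longrightarrow> bdf_quot p (1 - z) = exp (g z)"
    using contractible_imp_holomorphic_log[OF hol convex_imp_contractible[OF convex_ball]] R(2) by auto
  have q0: "bdf_quot p 0 = 1"
  proof -
    have "bdf_quot p 0 = (\<Sum>i\<in>{1}. 1 / of_nat i * 0 ^ (i - 1))"
      unfolding bdf_quot_def using p by (intro sum.mono_neutral_right) auto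
    thus ?thesis by simp
  qed
  have e1: "exp (g 1) = 1" using g(2)[of 1] R q0 by auto
  define L where "L = (\<lambda>\<zeta>. g \<zeta> - g 1)"
  have L: "exp (L \<zeta>) = bdf_quot p (1 - \<zeta>)" if "norm \<zeta> < R" for \<zeta>
    using g(2)[of \<zeta>] that e1 by (simp add: L_def exp_diff)
  have holL: "L holomorphic_on ball 0 R" unfolding L_def by (intro holomorphic_intros g)
  define f where "f = (\<lambda>t::real. Im (L (of_real t)))"
  \<comment> \<open>On the segment \<open>bdf_quot\<close> is positive, so \<open>f\<close> takes
    values in the multiples of \<open>2 * pi\<close>; a continuous function with discrete range is
    constant.\<close>
  have "f constant_on {0..1}"
  proof (rule continuous_discrete_range_constant)
    show "continuous_on {0..1} f" unfolding f_def
      using R(1) by (intro continuous_intros continuous_on_compose2[OF holomorphic_on_imp_continuous_on[OF holL]]) auto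
    have 2: "\<exists>n::int. f t = 2 * pi * n" if t: "t \<in> {0..1}" for t
    proof -
      obtain y where y: "y > 0" "bdf_quot p (of_real (1 - t)) = of_real y"
        using bdf_quot_of_real_pos[of p "1 - t"] t p by auto
      have "exp (L (of_real t)) = exp (of_real (ln y))"
        using L[of "of_real t"] t R y by (simp add: exp_of_real)
      then obtain n :: int where "L (of_real t) = of_real (ln y) + (of_int (2 * n) * pi) * \<i>"
        unfolding exp_eq by blast
      hence "Im (L (of_real t)) = 2 * pi * n" by simp
      thus ?thesis unfolding f_def by blast
    qed
    show "\<exists>e>0. \<forall>y. y \<in> {0..1} \<and> f y \<noteq> f x \<longrightarrow> e \<le> norm (f y - f x)" if x: "x \<in> {0..1}" for x
    proof (intro exI[of _ "2 * pi"] conjI allI impI)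
      fix y assume y: "y \<in> {0..1} \<and> f y \<noteq> f x"
      obtain n m :: int where nm: "f y = 2 * pi * n" "f x = 2 * pi * m"
        using 2[of x] 2[of y] x y by auto
      with y have "n \<noteq> m" by auto
      hence "1 \<le> \<bar>real_of_int n - real_of_int m\<bar>" by linarith
      thus "2 * pi \<le> norm (f y - f x)"
        unfolding nm by (simp add: abs_mult flip: right_diff_distrib)
    qed simp
  qed auto
  hence "f 0 = f 1" unfolding constant_on_def by auto
  hence "Im (L 0) = 0" by (simp add: f_def L_def)
  thus ?thesis using that[OF R(1) holL L] by (auto simp: L_def)
qed

text \<open>For \<open>E z = z - bdf p (1 - exp (- z))\<close> the derivative telescopes to \<open>(1 - exp (- z)) ^ p\<close>.\<close>

lemma bdf_expansion:
  obtains C where "C > 0" "\<And>z. norm z \<le> 1 \<Longrightarrow> norm (z - bdf p (1 - exp (- z))) \<le> C * norm z ^ (p + 1)"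
proof
  \<comment> \<open>The 3 bounds \<open>exp 1\<close> in
    \<open>norm (1 - exp (- z)) \<le> exp 1 * norm z\<close> on the unit disc; its power bounds the
    derivative of \<open>E\<close>.\<close>
  show "(3 ^ p :: real) > 0" by simp
  fix z :: complex assume z: "norm z \<le> 1"
  define E where "E = (\<lambda>z. z - bdf p (1 - exp (- z)))"
  have w: "norm (1 - exp (- z)) \<le> 3 * norm z" if "norm z \<le> 1" for z :: complex
  proof -
    have "norm (exp (- z) - exp 0) \<le> exp 1 * norm (- z - 0)"
      by (rule field_differentiable_bound[where S = "cball 0 1" and f' = exp])
         (use that in \<open>auto intro!: derivative_eq_intros order_trans[OF norm_exp] order_trans[OF complex_Re_le_cmod]\<close>)
    also have "\<dots> \<le> 3 * norm z" using exp_le by (simp add: mult_right_mono)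
    finally show ?thesis by (simp add: norm_minus_commute)
  qed
  have der: "(E has_field_derivative (1 - exp (- z)) ^ p) (at z within S)" for z S
  proof -
    have geo: "(\<Sum>i=1..p. w ^ (i - 1)) * (1 - w) = 1 - w ^ p" for w :: complex
      by (simp add: one_diff_power_eq[of w p] sum.atLeast1_atMost_eq mult.commute)
    have "(E has_field_derivative (1 - (\<Sum>i=1..p. (1 - exp (- z)) ^ (i - 1)) * exp (- z))) (at z within S)"
    proof -
      have "((\<lambda>z. 1 / of_nat i * (1 - exp (- z)) ^ i) has_field_derivative (1 - exp (- z)) ^ (i - 1) * exp (- z)) (at z within S)"
        if "i \<in> {1..p}" for i
        using that by (auto intro!: derivative_eq_intros)
      thus ?thesis unfolding E_def bdf_def sum_distrib_right by (intro DERIV_diff DERIV_ident DERIV_sum)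
    qed
    thus ?thesis using geo[of "1 - exp (- z)"] by simp
  qed
  have "norm (E z - E 0) \<le> (3 * norm z) ^ p * norm (z - 0)"
  proof (rule field_differentiable_bound[where S = "cball 0 (norm z)"])
    fix x :: complex assume x: "x \<in> cball 0 (norm z)"
    show "norm ((1 - exp (- x)) ^ p) \<le> (3 * norm z) ^ p"
      unfolding norm_power using w[of x] x z by (intro power_mono) auto
  qed (auto intro: der)
  also have "E 0 = 0" by (simp add: E_def bdf_eq)
  finally show "norm (z - bdf p (1 - exp (- z))) \<le> 3 ^ p * norm z ^ (p + 1)"
    by (simp add: E_def power_mult_distrib mult_ac)
qed

section \<open>Consistency of the symbol\<close>

lemma norm_powr_diff_one:
  obtains C where "C > 0" "\<And>u. norm (u - 1) \<le> 1 / 2 \<Longrightarrow> norm (u powr of_real \<alpha> - 1) \<le> C * norm (u - 1 :: complex)"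
proof -
  have Re_pos: "Re u > 0" if "u \<in> cball 1 (1/2)" for u :: complex
  proof -
    have "Re (1 - u) \<le> norm (1 - u)" by (rule complex_Re_le_cmod)
    thus ?thesis using that by (simp add: dist_norm)
  qed
  hence nz: "u \<notin> \<real>\<^sub>\<le>\<^sub>0" if "u \<in> cball 1 (1/2)" for u :: complex
    using that by (force simp: complex_nonpos_Reals_iff)
  have der: "((\<lambda>u. u powr of_real \<alpha>) has_field_derivative (of_real \<alpha> * u powr (of_real \<alpha> - 1))) (at u within cball 1 (1/2))"
    if "u \<in> cball 1 (1/2)" for u :: complex
    by (rule has_field_derivative_at_within, rule has_field_derivative_powr[OF nz[OF that]])
  define F where "F = (\<lambda>u. of_real \<alpha> * u powr (of_real \<alpha> - 1) :: complex)"
  have "continuous_on (cball 1 (1/2)) F"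
    unfolding F_def
    by (intro continuous_on_mult continuous_on_const continuous_on_powr_complex continuous_on_id)
       (use Re_pos in force)+
  hence "bounded (F ` cball 1 (1/2))"
    by (intro compact_imp_bounded compact_continuous_image) simp_all
  then obtain B where B: "B > 0" "\<And>u. u \<in> cball 1 (1/2) \<Longrightarrow> norm (F u) \<le> B"
    unfolding bounded_pos by blast
  show ?thesis
  proof (rule that[OF B(1)])
    fix u :: complex assume u: "norm (u - 1) \<le> 1 / 2"
    have "norm (u powr of_real \<alpha> - 1 powr of_real \<alpha>) \<le> B * norm (u - 1)"
      using u by (intro field_differentiable_bound[OF convex_cball der B(2)[unfolded F_def]])
        (simp_all add: dist_norm norm_minus_commute)
    thus "norm (u powr of_real \<alpha> - 1) \<le> B * norm (u - 1)" by simp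
  qed
qed

text \<open>Near 0 the quotient \<open>u\<close> of \<open>bdf\<close> by \<open>z\<close> is 1 up
  to order \<open>p\<close>, and so is its power. Away from 0 both 1 and
  \<open>norm z powr \<alpha>\<close> are at most a multiple of
  \<open>norm z powr (\<alpha> + p)\<close>, so boundedness of \<open>G\<close> suffices. The set
  \<open>Z\<close> is free because fractional and integer orders use different half-planes.\<close>

lemma symbol_estimate:
  fixes G :: "complex \<Rightarrow> complex"
  assumes \<alpha>: "\<alpha> > 0" and p: "p \<ge> 1"
    and bound: "\<And>z. z \<in> Z \<Longrightarrow> norm (G z) \<le> K"
    and near: "\<forall>\<^sub>F z in nhds 0. z \<in> Z \<longrightarrow> G z = z powr of_real \<alpha> * (bdf p (1 - exp (- z)) / z) powr of_real \<alpha>"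
  shows "\<exists>C. \<forall>z\<in>Z. norm (G z - z powr of_real \<alpha>) \<le> C * norm z powr (\<alpha> + p)"
proof -
  obtain C where C: "C > 0" "\<And>z. norm z \<le> 1 \<Longrightarrow> norm (z - bdf p (1 - exp (- z))) \<le> C * norm z ^ (p + 1)"
    using bdf_expansion[of p] by metis
  obtain C' where C': "C' > 0" "\<And>u. norm (u - 1) \<le> 1 / 2 \<Longrightarrow> norm (u powr of_real \<alpha> - 1) \<le> C' * norm (u - 1 :: complex)"
    using norm_powr_diff_one[of \<alpha>] by metis
  obtain d where d: "d > 0" "\<And>z. norm z < d \<Longrightarrow> z \<in> Z \<Longrightarrow> G z = z powr of_real \<alpha> * (bdf p (1 - exp (- z)) / z) powr of_real \<alpha>"
    using near unfolding eventually_nhds_metric by (auto simp: dist_norm)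
  \<comment> \<open>The bound \<open>1 / (2 * C)\<close> keeps \<open>u\<close> in the disc where
    \<open>norm_powr_diff_one\<close> applies.\<close>
  define r where "r = min (d / 2) (min 1 (1 / (2 * C)))"
  have r: "r > 0" "r < d" "r \<le> 1" "C * r \<le> 1 / 2"
  proof -
    have "r \<le> 1 / (2 * C)" by (simp add: r_def)
    thus "C * r \<le> 1 / 2" using C by (simp add: field_simps)
  qed (use d C in \<open>auto simp: r_def min_less_iff_disj\<close>)
  have A: "norm (G z - z powr of_real \<alpha>) \<le> C' * C * norm z powr (\<alpha> + p)" if z: "z \<in> Z" "norm z \<le> r" for z
  proof (cases "z = 0")
    case True
    thus ?thesis using d(2)[of 0] z d(1) by simp
  next
    case False
    define u where "u = bdf p (1 - exp (- z)) / z"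
    have "u - 1 = - ((z - bdf p (1 - exp (- z))) / z)" using False by (simp add: u_def field_simps)
    hence "norm (u - 1) = norm (z - bdf p (1 - exp (- z))) / norm z" by (simp add: norm_divide)
    also have "\<dots> \<le> (C * norm z ^ (p + 1)) / norm z"
      using C(2)[of z] z r by (intro divide_right_mono) auto
    finally have u: "norm (u - 1) \<le> C * norm z ^ p" using False by simp
    also have "norm z ^ p \<le> norm z ^ 1" using z r p by (intro power_decreasing) auto
    hence "C * norm z ^ p \<le> C * r" using z C by (intro mult_left_mono) auto
    finally have "norm (u - 1) \<le> 1 / 2" using r by simp
    from C'(2)[OF this] have "norm (u powr of_real \<alpha> - 1) \<le> C' * (C * norm z ^ p)"
      using u C' by (meson less_imp_le mult_left_mono order_trans)
    hence "norm z powr \<alpha> * norm (u powr of_real \<alpha> - 1) \<le> norm z powr \<alpha> * (C' * (C * norm z ^ p))"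
      by (intro mult_left_mono) auto
    moreover have "G z - z powr of_real \<alpha> = z powr of_real \<alpha> * (u powr of_real \<alpha> - 1)"
      using d(2)[of z] z r by (simp add: u_def algebra_simps)
    ultimately show ?thesis
      using False by (simp add: norm_mult norm_powr_of_real powr_add powr_realpow mult_ac)
  qed
  define D where "D = max 0 K / r powr (\<alpha> + p) + 1 / r ^ p"
  have B: "norm (G z - z powr of_real \<alpha>) \<le> D * norm z powr (\<alpha> + p)" if z: "z \<in> Z" "norm z > r" for z
  proof -
    have "norm (G z - z powr of_real \<alpha>) \<le> max 0 K + norm z powr \<alpha>"
      using norm_triangle_ineq4[of "G z" "z powr of_real \<alpha>"] bound[OF z(1)] by (simp add: norm_powr_of_real)
    also have "max 0 K \<le> max 0 K / r powr (\<alpha> + p) * norm z powr (\<alpha> + p)"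
    proof -
      have "r powr (\<alpha> + p) \<le> norm z powr (\<alpha> + p)" using z r \<alpha> by (intro powr_mono2) auto
      hence "max 0 K * r powr (\<alpha> + p) \<le> max 0 K * norm z powr (\<alpha> + p)" by (intro mult_left_mono) auto
      moreover have "r powr (\<alpha> + p) > 0" using r by simp
      ultimately show ?thesis by (metis pos_le_divide_eq times_divide_eq_left)
    qed
    also have "norm z powr \<alpha> \<le> 1 / r ^ p * norm z powr (\<alpha> + p)"
    proof -
      have "r ^ p \<le> norm z ^ p" using z r by (intro power_mono) auto
      hence "norm z powr \<alpha> * r ^ p \<le> norm z powr \<alpha> * norm z ^ p" by (intro mult_left_mono) auto
      moreover have "norm z powr (\<alpha> + p) = norm z powr \<alpha> * norm z ^ p"
        using z r by (subst powr_add, subst powr_realpow) auto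
      ultimately show ?thesis using r by (simp add: field_simps)
    qed
    finally show ?thesis by (simp add: D_def distrib_right)
  qed
  show ?thesis
  proof (intro exI[of _ "max (C' * C) D"] ballI)
    fix z assume "z \<in> Z"
    with A[of z] B[of z] have "norm (G z - z powr of_real \<alpha>) \<le> C' * C * norm z powr (\<alpha> + p) \<or>
        norm (G z - z powr of_real \<alpha>) \<le> D * norm z powr (\<alpha> + p)" by (cases "norm z \<le> r") auto
    thus "norm (G z - z powr of_real \<alpha>) \<le> max (C' * C) D * norm z powr (\<alpha> + p)"
      by (elim disjE) (erule order_trans, intro mult_right_mono, simp, simp)+
  qed
qed

section \<open>Coefficients of the difference operator\<close>

text \<open>The logarithms \<open>a\<close> and \<open>b\<close> need not be principal; only their
  sum has to lie in the principal strip. This lets \<open>Ln\<close> be combined with the logarithm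
  \<open>L\<close> of \<open>bdf_quot\<close>.\<close>

lemma powr_prod_Ln_eq:
  assumes "exp a = x" "exp b = y" "\<bar>Im a + Im b\<bar> < pi"
  shows "(x * y) powr c = exp (c * a) * exp (c * b)"
proof -
  have "x * y = exp (a + b)" using assms by (simp add: exp_add)
  moreover have "Ln (exp (a + b)) = a + b" using assms(3) by (intro Ln_exp) auto
  ultimately show ?thesis by (simp add: powr_def distrib_left exp_add)
qed

text \<open>Both \<sigma> and \<open>h\<close> enter only by rescaling \<zeta>, so by uniqueness of
  power series one sequence \<open>b\<close> serves all step sizes.\<close>

lemma approx_coeff_eqI:
  assumes p: "p \<ge> 1"
    and b: "\<forall>\<^sub>F \<zeta> in nhds 0. (\<lambda>m. b m * \<zeta> ^ m) sums (bdf p (1 - \<zeta>) powr of_real \<alpha>)"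
  shows "approx_coeff p \<alpha> \<sigma> h m = b m * exp (- (\<sigma> * of_real h)) ^ m"
proof -
  define e where "e = exp (- (\<sigma> * of_real h))"
  have g: "gen_fun p \<alpha> \<sigma> h \<zeta> = bdf p (1 - e * \<zeta>) powr of_real \<alpha>" for \<zeta>
    by (simp add: gen_fun_def bdf_def e_def exp_minus field_simps)
  have "filterlim (\<lambda>\<zeta>. e * \<zeta>) (nhds 0) (nhds 0)"
    using tendsto_mult[OF tendsto_const tendsto_ident_at, of e "0::complex" UNIV]
    by (intro tendsto_eq_intros) (auto intro: filterlim_ident)
  from eventually_compose_filterlim[OF b this]
  have 1: "\<forall>\<^sub>F \<zeta> in nhds 0. (\<lambda>m. (b m * e ^ m) * \<zeta> ^ m) sums gen_fun p \<alpha> \<sigma> h \<zeta>"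
    by (simp add: g power_mult_distrib mult.assoc)
  have "Abs_fps (approx_coeff p \<alpha> \<sigma> h) = Abs_fps (\<lambda>m. b m * e ^ m)"
    by (rule fps_expansion_unique_complex[of "gen_fun p \<alpha> \<sigma> h"]; rule has_fps_expansionI)
       (use approx_coeff_sums[OF p] 1 in simp_all)
  hence "fps_nth (Abs_fps (approx_coeff p \<alpha> \<sigma> h)) m = fps_nth (Abs_fps (\<lambda>m. b m * e ^ m)) m" by simp
  thus ?thesis by (simp add: e_def)
qed

text \<open>The Gamma asymptotics bound the coefficients by a multiple of
  \<open>m powr (- (\<alpha> + 1))\<close>, which is summable because \<alpha> > 0.\<close>

lemma binomial_coeff_abs_summable:
  assumes "\<alpha> > 0"
  shows "summable (\<lambda>m. norm ((complex_of_real \<alpha> gchoose m) * (- 1) ^ m))"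
proof -
  let ?g = "\<lambda>m. (\<alpha> gchoose m) / ((-1) ^ m / exp ((\<alpha> + 1) * ln (real m)))"
  have "?g \<longlonglongrightarrow> inverse (Gamma (- \<alpha>))"
    using gbinomial_asymptotic[of \<alpha>] by simp
  hence "Bseq ?g" by (intro convergent_imp_Bseq convergentI)
  then obtain K where K: "K > 0" "\<And>m. norm (?g m) \<le> K" by (elim BseqE) blast
  have bd: "norm (\<alpha> gchoose m) \<le> K * real m powr (- (\<alpha> + 1))" if "m > 0" for m
  proof -
    have "norm (?g m) = norm (\<alpha> gchoose m) * exp ((\<alpha> + 1) * ln (real m))"
      by (simp add: norm_divide norm_power abs_mult)
    moreover have "exp ((\<alpha> + 1) * ln (real m)) = real m powr (\<alpha> + 1)" using that by (simp add: powr_def)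
    ultimately have "norm (\<alpha> gchoose m) * real m powr (\<alpha> + 1) \<le> K" using K(2)[of m] by metis
    thus ?thesis using that unfolding powr_minus_divide by (simp add: pos_le_divide_eq)
  qed
  have "summable (\<lambda>m. K * real m powr (- (\<alpha> + 1)))"
    using assms by (intro summable_mult) (simp add: summable_real_powr_iff)
  hence "summable (\<lambda>m. norm (\<alpha> gchoose m))"
    by (rule summable_comparison_test_ev[rotated]) (auto intro!: eventually_mono[OF eventually_gt_at_top[of 0]] dest!: bd simp del: minus_add_distrib)
  moreover have "norm ((complex_of_real \<alpha> gchoose m) * (- 1) ^ m) = norm (\<alpha> gchoose m)" for m
  proof -
    have "complex_of_real \<alpha> gchoose m = of_real (\<alpha> gchoose m)"
      by (simp add: gbinomial_prod_rev)
    thus ?thesis by (simp add: norm_mult norm_power)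
  qed
  ultimately show ?thesis by simp
qed

lemma continuous_on_power_series_cball:
  fixes a :: "nat \<Rightarrow> complex"
  assumes "summable (\<lambda>m. norm (a m))"
  shows "continuous_on (cball 0 1) (\<lambda>\<zeta>. \<Sum>m. a m * \<zeta> ^ m)"
proof (rule uniform_limit_theorem)
  show "uniform_limit (cball 0 1) (\<lambda>n \<zeta>. \<Sum>m<n. a m * \<zeta> ^ m) (\<lambda>\<zeta>. \<Sum>m. a m * \<zeta> ^ m) sequentially"
    by (rule Weierstrass_m_test[OF _ assms]) (simp add: norm_mult norm_power power_le_one mult_left_le)
qed (auto intro!: always_eventually continuous_intros)

text \<open>Inside the disc this is the binomial theorem. Both sides extend continuously to the
  circle: the series by absolute summability, the power because \<alpha> > 0 makes it continuous at
  \<zeta> = 1.\<close>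

lemma binomial_series_cball:
  fixes \<zeta> :: complex
  assumes \<alpha>: "\<alpha> > 0" and z: "norm \<zeta> \<le> 1"
  shows "(\<lambda>m. (of_real \<alpha> gchoose m) * (- 1) ^ m * \<zeta> ^ m) sums (1 - \<zeta>) powr of_real \<alpha>"
proof -
  let ?a = "\<lambda>m. (complex_of_real \<alpha> gchoose m) * (- 1) ^ m"
  let ?f = "\<lambda>\<zeta>. (\<Sum>m. ?a m * \<zeta> ^ m)"
  have in_ball: "?f \<zeta> = (1 - \<zeta>) powr of_real \<alpha>" if "norm \<zeta> < 1" for \<zeta>
    using gen_binomial_complex[of "- \<zeta>" "of_real \<alpha>"] that
    by (simp add: sums_iff power_minus[of \<zeta>] mult.assoc)
  have "?f \<zeta> - (1 - \<zeta>) powr of_real \<alpha> = 0"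
  proof (rule continuous_constant_on_closure[where S = "ball 0 1" and f = "\<lambda>\<zeta>. ?f \<zeta> - (1 - \<zeta>) powr of_real \<alpha>"])
    show "continuous_on (closure (ball 0 1)) (\<lambda>\<zeta>. ?f \<zeta> - (1 - \<zeta>) powr of_real \<alpha>)"
    proof (rule continuous_on_diff)
      show "continuous_on (closure (ball 0 1)) ?f"
        using continuous_on_power_series_cball[OF binomial_coeff_abs_summable[OF \<alpha>]] by simp
      show "continuous_on (closure (ball (0::complex) 1)) (\<lambda>\<zeta>. (1 - \<zeta>) powr of_real \<alpha>)"
      proof (rule continuous_on_powr_complex)
        show "closure (ball (0::complex) 1) \<subseteq> {z. 0 \<le> Re (1 - z) \<or> Im (1 - z) \<noteq> 0}"
          by (auto intro: order_trans[OF complex_Re_le_cmod])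
      qed (use \<alpha> in \<open>auto intro!: continuous_intros\<close>)
    qed
    show "\<zeta> \<in> closure (ball 0 1)" using z by simp
  qed (use in_ball in simp)
  moreover have "summable (\<lambda>m. ?a m * \<zeta> ^ m)"
    by (rule summable_comparison_test'[OF binomial_coeff_abs_summable[OF \<alpha>]])
       (use z in \<open>auto simp: norm_mult norm_power power_le_one intro!: mult_left_le\<close>)
  ultimately show ?thesis by (simp add: sums_iff)
qed

text \<open>Three branches must fit. In the closed right half-plane the argument of \<open>z\<close>
  is at most \<open>pi / 2\<close>, and the imaginary parts of \<open>Ln (v z)\<close> and of
  \<open>L\<close> tend to 0; once below 1 they keep both sums of arguments below \<pi>.\<close>

lemma symbol_near_zero:
  assumes L: "isCont L 1" "L 1 = 0" and eL: "\<forall>\<^sub>F \<zeta> in nhds 1. exp (L \<zeta>) = bdf_quot p (1 - \<zeta>)"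
    and \<alpha>: "\<alpha> > 0"
  shows "\<forall>\<^sub>F z in nhds 0. Re z \<ge> 0 \<longrightarrow> (1 - exp (- z)) powr of_real \<alpha> * exp (of_real \<alpha> * L (exp (- z))) =
    z powr of_real \<alpha> * (bdf p (1 - exp (- z)) / z) powr of_real \<alpha>"
proof -
  define v where "v = (\<lambda>z::complex. (1 - exp (- z)) / z)"
  have "((\<lambda>z. 1 - exp (- z)) has_field_derivative 1) (at (0::complex))"
    by (auto intro!: derivative_eq_intros)
  hence v1: "(v \<longlongrightarrow> 1) (at 0)" unfolding has_field_derivative_iff v_def by simp
  have e1: "((\<lambda>z. exp (- z)) \<longlongrightarrow> (1::complex)) (at 0)"
    by (intro tendsto_eq_intros) auto
  have Lv: "((\<lambda>z. Im (Ln (v z))) \<longlongrightarrow> 0) (at 0)"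
    using v1 by (auto intro!: tendsto_eq_intros simp: complex_nonpos_Reals_iff)
  have LL: "((\<lambda>z. Im (L (exp (- z)))) \<longlongrightarrow> 0) (at 0)"
    using tendsto_Im[OF isCont_tendsto_compose[OF L(1) e1]] L(2) by simp
  have "\<forall>\<^sub>F z in at 0. \<bar>Im (Ln (v z))\<bar> < 1"
    using tendstoD[OF Lv, of 1] by (simp add: dist_norm)
  moreover have "\<forall>\<^sub>F z in at 0. \<bar>Im (L (exp (- z)))\<bar> < 1"
    using tendstoD[OF LL, of 1] by (simp add: dist_norm)
  moreover have "\<forall>\<^sub>F z in at 0. v z \<noteq> 0"
    using v1 by (rule tendsto_imp_eventually_ne) simp
  moreover have "\<forall>\<^sub>F z in at 0. exp (L (exp (- z))) = bdf_quot p (1 - exp (- z))"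
    by (rule eventually_compose_filterlim[OF eL e1])
  moreover have "\<forall>\<^sub>F z in at 0. z \<noteq> (0::complex)" by (rule eventually_neq_at_within)
  ultimately have "\<forall>\<^sub>F z in at 0. Re z \<ge> 0 \<longrightarrow> (1 - exp (- z)) powr of_real \<alpha> * exp (of_real \<alpha> * L (exp (- z))) =
    z powr of_real \<alpha> * (bdf p (1 - exp (- z)) / z) powr of_real \<alpha>"
  proof eventually_elim
    case (elim z)
    show ?case
    proof
      assume "Re z \<ge> 0"
      hence Lz: "\<bar>Im (Ln z)\<bar> \<le> pi / 2" using elim Re_Ln_pos_le[of z] by blast
      have "1 - exp (- z) = z * v z" using elim by (simp add: v_def)
      moreover have "(z * v z) powr of_real \<alpha> = exp (of_real \<alpha> * Ln z) * exp (of_real \<alpha> * Ln (v z))"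
        using elim Lz pi_gt3 by (intro powr_prod_Ln_eq exp_Ln) linarith+
      moreover have "bdf p (1 - exp (- z)) / z = v z * bdf_quot p (1 - exp (- z))"
        by (simp add: bdf_eq v_def)
      moreover have "(v z * bdf_quot p (1 - exp (- z))) powr of_real \<alpha> =
          exp (of_real \<alpha> * Ln (v z)) * exp (of_real \<alpha> * L (exp (- z)))"
        using elim pi_gt3 by (intro powr_prod_Ln_eq exp_Ln) linarith+
      ultimately show "(1 - exp (- z)) powr of_real \<alpha> * exp (of_real \<alpha> * L (exp (- z))) =
          z powr of_real \<alpha> * (bdf p (1 - exp (- z)) / z) powr of_real \<alpha>"
        using elim by (simp add: powr_def)
    qed
  qed
  thus ?thesis by (simp add: eventually_nhds_conv_at)
qed

text \<open>The power of 1 - \<zeta> has absolutely summable coefficients, and the exponential of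
  \<alpha> \<open>L\<close> converges on a disc of radius greater than 1. Their Cauchy product is
  absolutely summable, so the symbol is defined on the whole closed right half-plane.\<close>

lemma coeffs_fractional:
  assumes p: "p \<in> {2, 3, 4, 5}" and \<alpha>: "\<alpha> > 0"
  obtains b where "summable (\<lambda>m. norm (b m))"
    "\<forall>\<^sub>F \<zeta> in nhds 0. (\<lambda>m. b m * \<zeta> ^ m) sums (bdf p (1 - \<zeta>) powr of_real \<alpha>)"
    "\<forall>\<^sub>F z in nhds 0. z \<in> {z. Re z \<ge> 0} \<longrightarrow> (\<Sum>m. b m * exp (- z) ^ m) =
      z powr of_real \<alpha> * (bdf p (1 - exp (- z)) / z) powr of_real \<alpha>"
proof -
  obtain R L where R: "R > 1" and hol: "L holomorphic_on ball 0 R"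
    and eL: "\<And>\<zeta>. norm \<zeta> < R \<Longrightarrow> exp (L \<zeta>) = bdf_quot p (1 - \<zeta>)" and L1: "L 1 = 0" and L0: "Im (L 0) = 0"
    using bdf_quot_log[OF p] by metis
  define H where "H = (\<lambda>\<zeta>. exp (of_real \<alpha> * L \<zeta>))"
  define a where "a = (\<lambda>m. (complex_of_real \<alpha> gchoose m) * (- 1) ^ m)"
  define c where "c = (\<lambda>m. (deriv ^^ m) H 0 / fact m)"
  define b where "b = (\<lambda>n. \<Sum>i\<le>n. a i * c (n - i))"
  have holH: "H holomorphic_on ball 0 R" unfolding H_def by (intro holomorphic_intros hol)
  have cs: "(\<lambda>m. c m * \<zeta> ^ m) sums H \<zeta>" if "norm \<zeta> < R" for \<zeta>
    using holomorphic_power_series[OF holH, of \<zeta>] that by (simp add: c_def)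
  have a_abs: "summable (\<lambda>m. norm (a m))"
    unfolding a_def by (rule binomial_coeff_abs_summable[OF \<alpha>])
  obtain r where r: "1 < r" "r < R" using R dense by blast
  have "summable (\<lambda>m. c m * of_real r ^ m)"
    using cs[of "of_real r"] r by (intro sums_summable[of _ "H (of_real r)"]) simp
  from powser_insidea[OF this, of 1] have c_abs: "summable (\<lambda>m. norm (c m))"
    using r by simp
  have abs_pw: "summable (\<lambda>m. norm (d m * \<zeta> ^ m))" if "summable (\<lambda>m. norm (d m))" "norm \<zeta> \<le> 1" for d and \<zeta> :: complex
    by (rule summable_comparison_test'[OF that(1)])
       (use that(2) in \<open>auto simp: norm_mult norm_power power_le_one intro!: mult_left_le\<close>)
  have b_abs: "summable (\<lambda>m. norm (b m))"
  proof (rule summable_comparison_test')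
    show "summable (\<lambda>n. \<Sum>i\<le>n. norm (a i) * norm (c (n - i)))"
      using Cauchy_product_sums[of "\<lambda>m. norm (a m)" "\<lambda>m. norm (c m)"] a_abs c_abs by (simp add: sums_iff)
    show "norm (norm (b n)) \<le> (\<Sum>i\<le>n. norm (a i) * norm (c (n - i)))" for n
      unfolding b_def by (auto intro!: order_trans[OF norm_sum] sum_mono simp: norm_mult)
  qed
  have b_sums: "(\<lambda>m. b m * \<zeta> ^ m) sums ((1 - \<zeta>) powr of_real \<alpha> * H \<zeta>)" if "norm \<zeta> \<le> 1" for \<zeta>
  proof -
    have "(\<lambda>k. \<Sum>i\<le>k. (a i * \<zeta> ^ i) * (c (k - i) * \<zeta> ^ (k - i))) sums
        ((\<Sum>m. a m * \<zeta> ^ m) * (\<Sum>m. c m * \<zeta> ^ m))"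
      by (rule Cauchy_product_sums[OF abs_pw[OF a_abs that] abs_pw[OF c_abs that]])
    moreover have "(\<Sum>i\<le>k. (a i * \<zeta> ^ i) * (c (k - i) * \<zeta> ^ (k - i))) = b k * \<zeta> ^ k" for k
      unfolding b_def sum_distrib_right
    proof (intro sum.cong refl)
      fix i assume "i \<in> {..k}"
      hence "\<zeta> ^ i * \<zeta> ^ (k - i) = \<zeta> ^ k" by (simp flip: power_add)
      thus "(a i * \<zeta> ^ i) * (c (k - i) * \<zeta> ^ (k - i)) = a i * c (k - i) * \<zeta> ^ k" by (metis mult.assoc mult.left_commute)
    qed
    ultimately show ?thesis
      using binomial_series_cball[OF \<alpha> that] cs[of \<zeta>] that R by (simp add: sums_iff a_def)
  qed
  have contL: "isCont L \<zeta>" if "norm \<zeta> < R" for \<zeta>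
    using holomorphic_on_imp_continuous_on[OF hol] that continuous_on_eq_continuous_at[of "ball 0 R" L] by simp
  \<comment> \<open>At \<zeta> = 0 both logarithms are real, so their product is the principal
    branch nearby.\<close>
  have gen: "\<forall>\<^sub>F \<zeta> in nhds 0. (\<lambda>m. b m * \<zeta> ^ m) sums (bdf p (1 - \<zeta>) powr of_real \<alpha>)"
  proof -
    have "((\<lambda>\<zeta>. Im (Ln (1 - \<zeta>)) + Im (L \<zeta>)) \<longlongrightarrow> 0) (nhds 0)"
    proof -
      have "isCont (\<lambda>\<zeta>. Im (Ln (1 - \<zeta>)) + Im (L \<zeta>)) 0"
        using contL[of 0] R by (intro continuous_intros) (auto simp: complex_nonpos_Reals_iff)
      thus ?thesis using L0 by (simp add: isCont_def tendsto_nhds_iff)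
    qed
    from tendstoD[OF this pi_gt_zero] have "\<forall>\<^sub>F \<zeta> in nhds 0. \<bar>Im (Ln (1 - \<zeta>)) + Im (L \<zeta>)\<bar> < pi"
      by (simp add: dist_norm)
    moreover have "\<forall>\<^sub>F \<zeta> in nhds (0::complex). \<zeta> \<in> ball 0 1"
      by (intro eventually_nhds_in_open) auto
    ultimately show ?thesis
    proof eventually_elim
      case (elim \<zeta>)
      have "bdf p (1 - \<zeta>) powr of_real \<alpha> = exp (of_real \<alpha> * Ln (1 - \<zeta>)) * exp (of_real \<alpha> * L \<zeta>)"
        unfolding bdf_eq using elim eL[of \<zeta>] R by (intro powr_prod_Ln_eq exp_Ln) auto
      also have "\<dots> = (1 - \<zeta>) powr of_real \<alpha> * H \<zeta>" using elim by (auto simp: powr_def H_def)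
      finally show ?case using b_sums[of \<zeta>] elim by simp
    qed
  qed
  have "\<forall>\<^sub>F \<zeta> in nhds (1::complex). \<zeta> \<in> ball 0 R"
    using R by (intro eventually_nhds_in_open) auto
  hence "\<forall>\<^sub>F \<zeta> in nhds 1. exp (L \<zeta>) = bdf_quot p (1 - \<zeta>)"
    by eventually_elim (use eL in auto)
  from symbol_near_zero[OF contL L1 this \<alpha>] R
  have "\<forall>\<^sub>F z in nhds 0. Re z \<ge> 0 \<longrightarrow> (1 - exp (- z)) powr of_real \<alpha> * H (exp (- z)) =
    z powr of_real \<alpha> * (bdf p (1 - exp (- z)) / z) powr of_real \<alpha>" by (simp add: H_def)
  hence "\<forall>\<^sub>F z in nhds 0. z \<in> {z. Re z \<ge> 0} \<longrightarrow> (\<Sum>m. b m * exp (- z) ^ m) =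
      z powr of_real \<alpha> * (bdf p (1 - exp (- z)) / z) powr of_real \<alpha>"
    by eventually_elim (use b_sums in \<open>auto simp: sums_iff\<close>)
  from that[OF b_abs gen this] show ?thesis .
qed

text \<open>The generating function is a polynomial: finitely many coefficients admit every
  exponential weight, and no branch restricts \<open>z\<close>. This carries the case
  \<open>Re \<sigma> < 0\<close>.\<close>

lemma coeffs_integer:
  assumes n: "n > 0"
  obtains b where "\<And>s. summable (\<lambda>m. norm (b m) * exp (s * real m))"
    "\<forall>\<^sub>F \<zeta> in nhds 0. (\<lambda>m. b m * \<zeta> ^ m) sums (bdf p (1 - \<zeta>) powr of_real (real n))"
    "\<forall>\<^sub>F z in nhds 0. z \<in> Z \<longrightarrow> (\<Sum>m. b m * exp (- z) ^ m) =
      z powr of_real (real n) * (bdf p (1 - exp (- z)) / z) powr of_real (real n)"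
proof -
  define P :: "complex poly" where "P = (\<Sum>i=1..p. smult (1 / of_nat i) ([:1, -1:] ^ i)) ^ n"
  define b where "b = coeff P"
  have P: "poly P \<zeta> = bdf p (1 - \<zeta>) ^ n" for \<zeta>
    by (simp add: P_def bdf_def poly_sum poly_power)
  have b0: "b m = 0" if "m \<notin> {..degree P}" for m
    using that by (simp add: b_def coeff_eq_0)
  have sums: "(\<lambda>m. b m * \<zeta> ^ m) sums bdf p (1 - \<zeta>) ^ n" for \<zeta>
  proof -
    have "(\<lambda>m. b m * \<zeta> ^ m) sums (\<Sum>m\<le>degree P. b m * \<zeta> ^ m)"
      by (rule sums_finite) (use b0 in auto)
    thus ?thesis by (simp add: poly_altdef b_def flip: P)
  qed
  have pw: "z powr of_real (real n) = z ^ n" for z :: complex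
    using n powr_nat'[of z n] by simp
  show ?thesis
  proof (rule that)
    show "summable (\<lambda>m. norm (b m) * exp (s * real m))" for s
      by (rule summable_finite[of "{..degree P}"]) (use b0 in auto)
    show "\<forall>\<^sub>F \<zeta> in nhds 0. (\<lambda>m. b m * \<zeta> ^ m) sums (bdf p (1 - \<zeta>) powr of_real (real n))"
      unfolding pw using sums by simp
    show "\<forall>\<^sub>F z in nhds 0. z \<in> Z \<longrightarrow> (\<Sum>m. b m * exp (- z) ^ m) =
      z powr of_real (real n) * (bdf p (1 - exp (- z)) / z) powr of_real (real n)"
      \<comment> \<open>At \<open>z = 0\<close> the quotient is 0 by the convention on division, and
        both sides vanish because \<open>n > 0\<close>.\<close>
      unfolding pw using n sums_unique[OF sums, symmetric]
      by (auto simp: power_divide bdf_eq[of p 0] power_0_left)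
  qed
qed

text \<open>The number \<open>s\<close> says how far the half-plane reaches to the left of the
  imaginary axis; the weight \<open>exp (s * real m)\<close> pays for it.\<close>

theorem coeff_estimate:
  assumes p: "p \<in> {2, 3, 4, 5}" and \<alpha>: "\<alpha> > 0" and s: "s = 0 \<or> \<alpha> \<in> \<nat>"
  obtains b C where "summable (\<lambda>m. norm (b m) * exp (s * real m))"
    "\<And>\<sigma> h m. approx_coeff p \<alpha> \<sigma> h m = b m * exp (- (\<sigma> * of_real h)) ^ m"
    "\<And>z. Re z \<ge> - s \<Longrightarrow> norm ((\<Sum>m. b m * exp (- z) ^ m) - z powr of_real \<alpha>) \<le> C * norm z powr (\<alpha> + p)"
proof -
  have "\<exists>b. summable (\<lambda>m. norm (b m) * exp (s * real m)) \<and>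
    (\<forall>\<^sub>F \<zeta> in nhds 0. (\<lambda>m. b m * \<zeta> ^ m) sums (bdf p (1 - \<zeta>) powr of_real \<alpha>)) \<and>
    (\<forall>\<^sub>F z in nhds 0. z \<in> {z. Re z \<ge> - s} \<longrightarrow> (\<Sum>m. b m * exp (- z) ^ m) =
      z powr of_real \<alpha> * (bdf p (1 - exp (- z)) / z) powr of_real \<alpha>)"
  proof (cases "s = 0")
    case True
    obtain b where b: "summable (\<lambda>m. norm (b m))"
      "\<forall>\<^sub>F \<zeta> in nhds 0. (\<lambda>m. b m * \<zeta> ^ m) sums (bdf p (1 - \<zeta>) powr of_real \<alpha>)"
      "\<forall>\<^sub>F z in nhds 0. z \<in> {z. Re z \<ge> 0} \<longrightarrow> (\<Sum>m. b m * exp (- z) ^ m) =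
        z powr of_real \<alpha> * (bdf p (1 - exp (- z)) / z) powr of_real \<alpha>"
      by (rule coeffs_fractional[OF p \<alpha>])
    thus ?thesis using True by (intro exI[of _ b]) simp
  next
    case False
    then obtain n where n: "\<alpha> = real n" using s by (auto elim: Nats_cases)
    with \<alpha> have "n > 0" by simp
    then obtain b where b: "\<And>s. summable (\<lambda>m. norm (b m) * exp (s * real m))"
      "\<forall>\<^sub>F \<zeta> in nhds 0. (\<lambda>m. b m * \<zeta> ^ m) sums (bdf p (1 - \<zeta>) powr of_real (real n))"
      "\<forall>\<^sub>F z in nhds 0. z \<in> {z. Re z \<ge> - s} \<longrightarrow> (\<Sum>m. b m * exp (- z) ^ m) =
        z powr of_real (real n) * (bdf p (1 - exp (- z)) / z) powr of_real (real n)"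
      by (rule coeffs_integer[where p = p and Z = "{z. Re z \<ge> - s}"]) blast
    show ?thesis unfolding n by (intro exI[of _ b] conjI b)
  qed
  then obtain b where b: "summable (\<lambda>m. norm (b m) * exp (s * real m))"
    "\<forall>\<^sub>F \<zeta> in nhds 0. (\<lambda>m. b m * \<zeta> ^ m) sums (bdf p (1 - \<zeta>) powr of_real \<alpha>)"
    "\<forall>\<^sub>F z in nhds 0. z \<in> {z. Re z \<ge> - s} \<longrightarrow> (\<Sum>m. b m * exp (- z) ^ m) =
      z powr of_real \<alpha> * (bdf p (1 - exp (- z)) / z) powr of_real \<alpha>"
    by blast
  have p1: "p \<ge> 1" using p by auto
  have "norm (\<Sum>m. b m * exp (- z) ^ m) \<le> (\<Sum>m. norm (b m) * exp (s * real m))" if "z \<in> {z. Re z \<ge> - s}" for z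
  proof (rule norm_suminf_le[OF _ b(1)])
    fix m
    have "norm (exp (- z) ^ m) = exp (- Re z) ^ m" by (simp add: norm_power)
    also have "\<dots> \<le> exp s ^ m" using that by (intro power_mono) auto
    also have "\<dots> = exp (s * real m)" by (simp add: exp_of_nat_mult[symmetric] mult.commute)
    finally show "norm (b m * exp (- z) ^ m) \<le> norm (b m) * exp (s * real m)"
      by (simp add: norm_mult mult_left_mono)
  qed
  from symbol_estimate[OF \<alpha> p1 this b(3)] obtain C where
    "\<And>z. Re z \<ge> - s \<Longrightarrow> norm ((\<Sum>m. b m * exp (- z) ^ m) - z powr of_real \<alpha>) \<le> C * norm z powr (\<alpha> + p)"
    by auto
  from that[OF b(1) approx_coeff_eqI[OF p1 b(2)] this] show ?thesis .
qed

section \<open>The approximation error\<close>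

lemma borel_version:
  fixes g :: "real \<Rightarrow> complex"
  assumes "g \<in> borel_measurable lebesgue"
  obtains g0 where "g0 \<in> borel_measurable borel" "AE x in lebesgue. g x = g0 x"
proof -
  have m: "(\<lambda>x. Re (g x)) \<in> borel_measurable lebesgue" "(\<lambda>x. Im (g x)) \<in> borel_measurable lebesgue"
    using assms by auto
  obtain r i where ri: "r \<in> borel_measurable lborel" "AE x in lborel. Re (g x) = r x"
      "i \<in> borel_measurable lborel" "AE x in lborel. Im (g x) = i x"
    using completion_ex_borel_measurable_real[OF m(1)] completion_ex_borel_measurable_real[OF m(2)] by blast
  have "AE x in lborel. g x = Complex (r x) (i x)"
    using ri(2,4) by eventually_elim (simp add: complex_eq_iff)
  moreover have "(\<lambda>x. Complex (r x) (i x)) \<in> borel_measurable borel"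
    using ri(1,3) unfolding Complex_eq by simp
  ultimately show ?thesis using that AE_completion by blast
qed

lemma integral_lebesgue_eq_lborel:
  fixes g g0 :: "real \<Rightarrow> complex"
  assumes g: "g \<in> borel_measurable lebesgue" and g0: "g0 \<in> borel_measurable borel"
    and ae: "AE x in lebesgue. g x = g0 x"
  shows "(LINT x|lebesgue. g x) = (LINT x|lborel. g0 x)"
    and "integrable lebesgue g \<longleftrightarrow> integrable lborel g0"
proof -
  have m: "g0 \<in> borel_measurable lebesgue" using g0 by (intro measurable_completion) simp
  have "(LINT x|lebesgue. g x) = (LINT x|lebesgue. g0 x)" by (rule integral_cong_AE[OF g m ae])
  also have "\<dots> = (LINT x|lborel. g0 x)" using g0 by (intro integral_completion) simp
  finally show "(LINT x|lebesgue. g x) = (LINT x|lborel. g0 x)" .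
  have "integrable lebesgue g \<longleftrightarrow> integrable lebesgue g0" by (rule integrable_cong_AE[OF g m ae])
  also have "\<dots> \<longleftrightarrow> integrable lborel g0" using g0 by (intro integrable_completion) simp
  finally show "integrable lebesgue g \<longleftrightarrow> integrable lborel g0" .
qed

lemma fourier_eq_ft:
  assumes "f \<in> borel_measurable lebesgue" "f0 \<in> borel_measurable borel" "AE x in lebesgue. f x = f0 x"
  shows "fourier f = ft f0"
proof
  fix \<omega>
  have e: "(\<lambda>x. iexp (\<omega> * x)) \<in> borel_measurable borel" by simp
  have "(\<lambda>x. iexp (\<omega> * x)) \<in> borel_measurable lebesgue" by (rule measurable_completion) simp
  hence "(\<lambda>x. iexp (\<omega> * x) * f x) \<in> borel_measurable lebesgue" using assms(1) by (rule borel_measurable_times)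
  moreover have "(\<lambda>x. iexp (\<omega> * x) * f0 x) \<in> borel_measurable borel" using e assms(2) by (rule borel_measurable_times)
  moreover have "AE x in lebesgue. iexp (\<omega> * x) * f x = iexp (\<omega> * x) * f0 x"
    using assms(3) by eventually_elim simp
  ultimately show "fourier f \<omega> = ft f0 \<omega>"
    unfolding fourier_def ft_def by (rule integral_lebesgue_eq_lborel(1))
qed

lemma subst_integral_eq_conv:
  assumes f: "f \<in> borel_measurable lebesgue" and f0: "f0 \<in> borel_measurable borel"
    and ae: "AE x in lebesgue. f x = f0 x" and \<nu>: "\<nu> > 0"
  shows "subst_integral \<sigma> \<nu> f x = conv (frac_kernel \<sigma> \<nu>) f0 x"
    and "set_integrable lebesgue {..x} (subst_integrand \<sigma> \<nu> f x) \<longleftrightarrow>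
      integrable lborel (\<lambda>t. frac_kernel \<sigma> \<nu> (x - t) * f0 t)"
proof -
  have G: "Gamma \<nu> > 0" using \<nu> by simp
  have fm [measurable]: "frac_kernel \<sigma> \<nu> \<in> borel_measurable borel"
    unfolding frac_kernel_def by measurable
  have k: "(\<lambda>t. of_real (Gamma \<nu>) * frac_kernel \<sigma> \<nu> (x - t)) \<in> borel_measurable borel" by simp
  have eq: "indicator {..x} t *\<^sub>R subst_integrand \<sigma> \<nu> f x t = of_real (Gamma \<nu>) * frac_kernel \<sigma> \<nu> (x - t) * f t" for t
    using G by (auto simp: indicator_def subst_integrand_def frac_kernel_def tpow_def max_def)
  have kl: "(\<lambda>t. of_real (Gamma \<nu>) * frac_kernel \<sigma> \<nu> (x - t)) \<in> borel_measurable lebesgue"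
    by (rule measurable_completion) (use k in simp)
  have 1: "(\<lambda>t. of_real (Gamma \<nu>) * frac_kernel \<sigma> \<nu> (x - t) * f t) \<in> borel_measurable lebesgue"
    using kl f by (rule borel_measurable_times)
  have 2: "(\<lambda>t. of_real (Gamma \<nu>) * frac_kernel \<sigma> \<nu> (x - t) * f0 t) \<in> borel_measurable borel"
    using k f0 by (rule borel_measurable_times)
  have 3: "AE t in lebesgue. of_real (Gamma \<nu>) * frac_kernel \<sigma> \<nu> (x - t) * f t = of_real (Gamma \<nu>) * frac_kernel \<sigma> \<nu> (x - t) * f0 t"
    using ae by eventually_elim simp
  note R = integral_lebesgue_eq_lborel[OF 1 2 3]
  show "subst_integral \<sigma> \<nu> f x = conv (frac_kernel \<sigma> \<nu>) f0 x"
  proof -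
    have "(LINT t|lebesgue. of_real (Gamma \<nu>) * frac_kernel \<sigma> \<nu> (x - t) * f t) = of_real (Gamma \<nu>) * conv (frac_kernel \<sigma> \<nu>) f0 x"
      unfolding R(1) by (simp add: conv_def mult.assoc)
    thus ?thesis unfolding subst_integral_def set_lebesgue_integral_def eq using G by simp
  qed
  show "set_integrable lebesgue {..x} (subst_integrand \<sigma> \<nu> f x) \<longleftrightarrow>
      integrable lborel (\<lambda>t. frac_kernel \<sigma> \<nu> (x - t) * f0 t)"
    unfolding set_integrable_def eq R(2)
  proof
    assume "integrable lborel (\<lambda>t. of_real (Gamma \<nu>) * frac_kernel \<sigma> \<nu> (x - t) * f0 t)"
    hence "integrable lborel (\<lambda>t. of_real (1 / Gamma \<nu>) * (of_real (Gamma \<nu>) * frac_kernel \<sigma> \<nu> (x - t) * f0 t))"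
      by (rule integrable_mult_right)
    thus "integrable lborel (\<lambda>t. frac_kernel \<sigma> \<nu> (x - t) * f0 t)" using G by simp
  next
    assume "integrable lborel (\<lambda>t. frac_kernel \<sigma> \<nu> (x - t) * f0 t)"
    thus "integrable lborel (\<lambda>t. of_real (Gamma \<nu>) * frac_kernel \<sigma> \<nu> (x - t) * f0 t)"
      unfolding mult.assoc by (rule integrable_mult_right)
  qed
qed

text \<open>The order strictly exceeds \<alpha>, so the distance between them lies in (0, 1] and
  equals 1 precisely for integer \<alpha>.\<close>

lemma subst_order_bounds:
  assumes "\<alpha> > 0"
  shows "\<alpha> < real (subst_order \<alpha>)" "real (subst_order \<alpha>) \<le> \<alpha> + 1" "subst_order \<alpha> \<ge> 1"
proof -
  have "\<exists>m. \<alpha> < real m" by (rule reals_Archimedean2)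
  thus 1: "\<alpha> < real (subst_order \<alpha>)" unfolding subst_order_def by (rule LeastI_ex)
  thus 2: "subst_order \<alpha> \<ge> 1" using assms by (cases "subst_order \<alpha>") auto
  have "\<not> \<alpha> < real (subst_order \<alpha> - 1)"
    unfolding subst_order_def by (rule not_less_Least) (use 2 in \<open>simp add: subst_order_def\<close>)
  thus "real (subst_order \<alpha>) \<le> \<alpha> + 1" using 2 by (simp add: of_nat_diff)
qed

lemma subst_order_eqI:
  assumes "\<beta> < real m" "real m \<le> \<beta> + 1"
  shows "subst_order \<beta> = m"
  unfolding subst_order_def by (rule Least_equality) (use assms in auto)

text \<open>Countably many translates of a null set form a null set, so for fixed \<open>h\<close>
  almost every \<open>x\<close> is good for all terms of the series at once.\<close>

lemma AE_lborel_all_shifts: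
  assumes "AE x in lborel. P x"
  shows "AE x in lebesgue. \<forall>m::nat. P (x - real m * h)"
proof -
  obtain N where N: "{x. \<not> P x} \<subseteq> N" "N \<in> null_sets lborel"
    using assms by (auto simp: eventually_ae_filter)
  have Nb: "N \<in> sets borel" using N(2) by auto
  have "AE x in lborel. x \<notin> N" by (rule AE_not_in[OF N(2)])
  hence "AE x in lborel. - (real m * h) + 1 * x \<notin> N" for m :: nat
    using Nb by (intro AE_borel_affine) auto
  hence "AE x in lborel. \<forall>m::nat. x - real m * h \<notin> N"
    by (simp add: AE_all_countable)
  hence "AE x in lborel. \<forall>m::nat. P (x - real m * h)"
    by eventually_elim (use N(1) in blast)
  thus ?thesis by (rule AE_completion)
qed

section \<open>The error bound in Fourier space\<close>

lemma powr_times_of_real_pos: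
  fixes z :: complex
  assumes "h > 0"
  shows "(z * of_real h) powr of_real \<alpha> = z powr of_real \<alpha> * of_real (h powr \<alpha>)"
proof (cases "z = 0")
  case False
  have "Ln (of_real h * z) = of_real (ln h) + Ln z" using Ln_times_of_real[OF assms False] Ln_of_real[OF assms] by simp
  thus ?thesis using assms False
    by (simp add: powr_def mult.commute[of z] distrib_left exp_add flip: exp_of_real)
qed simp

text \<open>The symbols differ by at most \<open>C * h ^ p * norm z powr (\<alpha> + p)\<close>, and
  this power times \<open>ft f0\<close> has the modulus of \<open>W\<close>. The function
  \<open>f\<close> enters its own series only through the grid \<open>x - m h\<close>, so the lemma
  serves almost every \<open>x\<close> and, for continuous \<open>f\<close>, every
  \<open>x\<close>.\<close>

lemma approx_within_of_representation:
  fixes \<alpha> :: real and \<sigma> :: complex and f f0 :: "real \<Rightarrow> complex"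
  defines "z \<equiv> \<lambda>\<omega>. \<sigma> - \<i> * of_real \<omega>"
  assumes s: "s \<ge> 0" "Re \<sigma> \<ge> - s" and h: "0 < h" "h \<le> 1" and C: "C \<ge> 0"
    and b: "summable (\<lambda>m. norm (b m) * exp (s * real m))"
    and coeff: "\<And>m. approx_coeff p \<alpha> \<sigma> h m = b m * exp (- (\<sigma> * of_real h)) ^ m"
    and est: "\<And>z. Re z \<ge> - s \<Longrightarrow> norm ((\<Sum>m. b m * exp (- z) ^ m) - z powr of_real \<alpha>) \<le> C * norm z powr (\<alpha> + p)"
    and F: "integrable lborel (ft f0)" and W: "integrable lborel W"
    and int: "integrable lborel (\<lambda>\<omega>. z \<omega> powr of_real \<alpha> * ft f0 \<omega>)"
    and star: "AE \<omega> in lborel. W \<omega> = z \<omega> powr of_real (\<alpha> + real p) * ft f0 \<omega>"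
    and D: "subst_frac_deriv \<sigma> \<alpha> f x = ift (\<lambda>\<omega>. z \<omega> powr of_real \<alpha> * ft f0 \<omega>) x"
    and fx: "\<And>m::nat. f (x - real m * h) = ift (ft f0) (x - real m * h)"
  shows "approx_within p \<alpha> \<sigma> f h x (1 / (2 * pi) * C * (LINT \<omega>|lborel. norm (W \<omega>)) * h ^ p)"
proof -
  let ?E = "exp (- (\<sigma> * of_real h))"
  have [measurable]: "ft f0 \<in> borel_measurable borel" "W \<in> borel_measurable borel" using F W by auto
  define G where "G = (\<lambda>z. \<Sum>m. b m * exp (- z) ^ m)"
  define T where "T = (\<lambda>m \<omega>. iexp (- (\<omega> * x)) * (b m * exp (- (z \<omega> * of_real h)) ^ m * ft f0 \<omega>))"
  \<comment> \<open>Here \<open>h \<le> 1\<close> matters: the scaled line stays in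
    \<open>Re z \<ge> - s\<close>, so one summable majorant serves all steps.\<close>
  have Enorm: "norm (exp (- (z \<omega> * of_real h))) ^ m \<le> exp (s * real m)" for m \<omega>
  proof -
    have "- Re \<sigma> * h \<le> s * h" using s h by (intro mult_right_mono) auto
    also have "s * h \<le> s" using s h by (simp add: mult_left_le)
    finally have "exp (- Re \<sigma> * h) ^ m \<le> exp s ^ m" by (intro power_mono) auto
    moreover have "norm (exp (- (z \<omega> * of_real h))) = exp (- Re \<sigma> * h)" by (simp add: z_def)
    ultimately show ?thesis by (simp only: exp_of_nat2_mult)
  qed
  have Tnorm: "norm (T m \<omega>) \<le> norm (b m) * exp (s * real m) * norm (ft f0 \<omega>)" for m \<omega>
  proof -
    have "norm (T m \<omega>) = norm (b m) * norm (exp (- (z \<omega> * of_real h))) ^ m * norm (ft f0 \<omega>)"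
      by (simp only: T_def norm_mult norm_power norm_iexp mult_1)
    also have "\<dots> \<le> norm (b m) * exp (s * real m) * norm (ft f0 \<omega>)"
      by (intro mult_right_mono mult_left_mono Enorm) auto
    finally show ?thesis .
  qed
  have Tm [measurable]: "T m \<in> borel_measurable borel" for m unfolding T_def z_def by measurable
  have Tint: "integrable lborel (T m)" for m
  proof (rule Bochner_Integration.integrable_bound)
    show "integrable lborel (\<lambda>\<omega>. norm (b m) * exp (s * real m) * norm (ft f0 \<omega>))" using F by simp
    show "AE \<omega> in lborel. norm (T m \<omega>) \<le> norm (norm (b m) * exp (s * real m) * norm (ft f0 \<omega>))"
      using Tnorm by (intro AE_I2) (simp add: abs_mult)
  qed simp
  have Tsum: "summable (\<lambda>m. norm (T m \<omega>))" for \<omega>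
    by (rule summable_comparison_test'[OF summable_mult2[OF b, of "norm (ft f0 \<omega>)"]]) (use Tnorm in simp)
  have Tsumint: "summable (\<lambda>m. LINT \<omega>|lborel. norm (T m \<omega>))"
  proof (rule summable_comparison_test'[OF summable_mult2[OF b, of "LINT \<omega>|lborel. norm (ft f0 \<omega>)"]])
    fix m
    have "(LINT \<omega>|lborel. norm (T m \<omega>)) \<le> (LINT \<omega>|lborel. norm (b m) * exp (s * real m) * norm (ft f0 \<omega>))"
      using Tint F by (intro integral_mono Tnorm) auto
    thus "norm (LINT \<omega>|lborel. norm (T m \<omega>)) \<le> norm (b m) * exp (s * real m) * (LINT \<omega>|lborel. norm (ft f0 \<omega>))"
      by simp
  qed
  have termT: "approx_term p \<alpha> \<sigma> h f x m = of_real (1 / (2 * pi)) * (LINT \<omega>|lborel. T m \<omega>)" for m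
  proof -
    have e1: "exp (- (z \<omega> * of_real h)) = ?E * iexp (\<omega> * h)" for \<omega>
      unfolding exp_add[symmetric] z_def by (simp add: algebra_simps)
    have e2: "iexp (- (\<omega> * (x - real m * h))) = iexp (- (\<omega> * x)) * iexp (\<omega> * h) ^ m" for \<omega>
      unfolding exp_of_nat_mult[symmetric] exp_add[symmetric] by (simp add: algebra_simps)
    have "b m * ?E ^ m * (iexp (- (\<omega> * (x - real m * h))) * ft f0 \<omega>) = T m \<omega>" for \<omega>
      unfolding T_def e1 e2 power_mult_distrib by (simp only: mult_ac)
    hence "b m * ?E ^ m * (LINT \<omega>|lborel. iexp (- (\<omega> * (x - real m * h))) * ft f0 \<omega>) = (LINT \<omega>|lborel. T m \<omega>)"
      unfolding integral_mult_right_zero[symmetric] by presburger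
    thus ?thesis unfolding approx_term_def coeff fx ift_def by (simp only: mult.left_commute)
  qed
  have "summable (\<lambda>m. norm (LINT \<omega>|lborel. T m \<omega>))"
    by (rule summable_comparison_test'[OF Tsumint]) (simp add: integral_norm_bound)
  hence sumT: "summable (\<lambda>m. LINT \<omega>|lborel. T m \<omega>)" by (rule summable_norm_cancel)
  hence sm: "summable (approx_term p \<alpha> \<sigma> h f x)"
    unfolding termT[abs_def] by (rule summable_mult)
  define P where "P = (\<lambda>\<omega>. iexp (- (\<omega> * x)) * (z \<omega> powr of_real \<alpha> * ft f0 \<omega>))"
  define Q where "Q = (\<lambda>\<omega>. iexp (- (\<omega> * x)) * (G (z \<omega> * of_real h) * ft f0 \<omega>))"
  have sumG: "(\<Sum>m. T m \<omega>) = Q \<omega>" for \<omega>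
  proof -
    have "summable (\<lambda>m. norm (b m * exp (- (z \<omega> * of_real h)) ^ m))"
      by (rule summable_comparison_test'[OF b])
         (use Enorm in \<open>auto simp: norm_mult norm_power intro!: mult_left_mono\<close>)
    hence "summable (\<lambda>m. b m * exp (- (z \<omega> * of_real h)) ^ m)" by (rule summable_norm_cancel)
    thus ?thesis unfolding T_def G_def Q_def by (simp add: suminf_mult suminf_mult2 summable_mult2)
  qed
  have aeS: "AE \<omega> in lborel. summable (\<lambda>m. norm (T m \<omega>))" using Tsum by simp
  have Gint: "integrable lborel Q"
    using integrable_suminf[OF Tint aeS Tsumint] unfolding sumG by simp
  have A: "approx_A p \<alpha> \<sigma> h f x = of_real (1 / (2 * pi)) *
      (LINT \<omega>|lborel. of_real (1 / h powr \<alpha>) * Q \<omega>)"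
  proof -
    have "(\<Sum>m. approx_term p \<alpha> \<sigma> h f x m) = of_real (1 / (2 * pi)) * (\<Sum>m. LINT \<omega>|lborel. T m \<omega>)"
      unfolding termT by (rule suminf_mult[OF sumT])
    also have "(\<Sum>m. LINT \<omega>|lborel. T m \<omega>) = (LINT \<omega>|lborel. (\<Sum>m. T m \<omega>))"
      by (rule integral_suminf[OF Tint aeS Tsumint, symmetric])
    finally show ?thesis unfolding approx_A_def sumG integral_mult_right_zero by (simp only: mult.left_commute)
  qed
  have Dint: "integrable lborel P"
    unfolding P_def using integrable_iexp_mult(2)[OF int, of x] by (simp only: mult.commute[of x])
  have Gint': "integrable lborel (\<lambda>\<omega>. of_real (1 / h powr \<alpha>) * Q \<omega>)"
    by (rule integrable_mult_right[OF Gint])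
  have diff: "subst_frac_deriv \<sigma> \<alpha> f x - approx_A p \<alpha> \<sigma> h f x = of_real (1 / (2 * pi)) *
      (LINT \<omega>|lborel. P \<omega> - of_real (1 / h powr \<alpha>) * Q \<omega>)"
  proof -
    have "ift (\<lambda>\<omega>. z \<omega> powr of_real \<alpha> * ft f0 \<omega>) x = of_real (1 / (2 * pi)) * (LINT \<omega>|lborel. P \<omega>)"
      unfolding ift_def P_def ..
    thus ?thesis unfolding D A Bochner_Integration.integral_diff[OF Dint Gint'] by (simp only: right_diff_distrib)
  qed
  have "norm (subst_frac_deriv \<sigma> \<alpha> f x - approx_A p \<alpha> \<sigma> h f x) \<le> 1 / (2 * pi) * (LINT \<omega>|lborel. C * h ^ p * norm (W \<omega>))"
  proof -
    have "norm (LINT \<omega>|lborel. P \<omega> - of_real (1 / h powr \<alpha>) * Q \<omega>)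
      \<le> (LINT \<omega>|lborel. norm (P \<omega> - of_real (1 / h powr \<alpha>) * Q \<omega>))"
      by (rule integral_norm_bound)
    also have "\<dots> \<le> (LINT \<omega>|lborel. C * h ^ p * norm (W \<omega>))"
    proof (rule integral_mono_AE)
      show "AE \<omega> in lborel. norm (P \<omega> - of_real (1 / h powr \<alpha>) * Q \<omega>) \<le> C * h ^ p * norm (W \<omega>)"
        using star
      proof eventually_elim
        case (elim \<omega>)
        let ?u = "z \<omega> * of_real h"
        have "Re ?u \<ge> - s"
        proof -
          have "s * h \<le> s" using s h by (simp add: mult_left_le)
          moreover have "- s * h \<le> Re \<sigma> * h" using s h by (intro mult_right_mono) auto
          ultimately show ?thesis by (simp add: z_def)
        qed
        hence "norm (G ?u - ?u powr of_real \<alpha>) \<le> C * norm ?u powr (\<alpha> + p)"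
          unfolding G_def by (rule est)
        also have "\<dots> = C * (norm (z \<omega>) powr (\<alpha> + p) * (h powr \<alpha> * h ^ p))"
          using h by (simp add: norm_mult powr_mult powr_add powr_realpow)
        finally have 1: "norm (?u powr of_real \<alpha> - G ?u) \<le> C * (norm (z \<omega>) powr (\<alpha> + p) * (h powr \<alpha> * h ^ p))"
          by (simp add: norm_minus_commute)
        \<comment> \<open>The positive scale \<open>h\<close> leaves the branch unchanged and
          factors out, so only \<open>h ^ p\<close> survives of the error.\<close>
        have "z \<omega> powr of_real \<alpha> - of_real (1 / h powr \<alpha>) * G ?u = of_real (1 / h powr \<alpha>) * (?u powr of_real \<alpha> - G ?u)"
          unfolding powr_times_of_real_pos[OF h(1)] using h by (simp add: right_diff_distrib)
        hence "norm (z \<omega> powr of_real \<alpha> - of_real (1 / h powr \<alpha>) * G ?u) = 1 / h powr \<alpha> * norm (?u powr of_real \<alpha> - G ?u)"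
          by (simp only: norm_mult norm_of_real) simp
        also have "\<dots> \<le> 1 / h powr \<alpha> * (C * (norm (z \<omega>) powr (\<alpha> + p) * (h powr \<alpha> * h ^ p)))"
          by (intro mult_left_mono 1) simp
        also have "\<dots> = C * h ^ p * norm (z \<omega>) powr (\<alpha> + p)" using h by simp
        finally have 2: "norm (z \<omega> powr of_real \<alpha> - of_real (1 / h powr \<alpha>) * G ?u) \<le> C * h ^ p * norm (z \<omega>) powr (\<alpha> + p)" .
        have "P \<omega> - of_real (1 / h powr \<alpha>) * Q \<omega>
            = iexp (- (\<omega> * x)) * ((z \<omega> powr of_real \<alpha> - of_real (1 / h powr \<alpha>) * G ?u) * ft f0 \<omega>)"
          unfolding P_def Q_def by (simp only: left_diff_distrib right_diff_distrib mult_ac)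
        hence "norm (P \<omega> - of_real (1 / h powr \<alpha>) * Q \<omega>)
            = norm (z \<omega> powr of_real \<alpha> - of_real (1 / h powr \<alpha>) * G ?u) * norm (ft f0 \<omega>)"
          by (simp only: norm_mult norm_iexp mult_1)
        also have "\<dots> \<le> (C * h ^ p * norm (z \<omega>) powr (\<alpha> + p)) * norm (ft f0 \<omega>)"
          by (intro mult_right_mono 2) simp
        also have "\<dots> = C * h ^ p * norm (W \<omega>)"
          unfolding elim norm_mult norm_powr_of_real by simp
        finally show ?case .
      qed
    next
      show "integrable lborel (\<lambda>\<omega>. norm (P \<omega> - of_real (1 / h powr \<alpha>) * Q \<omega>))"
        by (intro integrable_norm Bochner_Integration.integrable_diff Dint Gint')
      show "integrable lborel (\<lambda>\<omega>. C * h ^ p * norm (W \<omega>))"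
        by (intro integrable_mult_right integrable_norm W)
    qed
    finally have bound: "norm (LINT \<omega>|lborel. P \<omega> - of_real (1 / h powr \<alpha>) * Q \<omega>)
      \<le> (LINT \<omega>|lborel. C * h ^ p * norm (W \<omega>))" .
    show ?thesis unfolding diff norm_mult[of "of_real (1 / (2 * pi))"] norm_of_real by (rule mult_mono[OF _ bound]) simp_all
  qed
  also have "\<dots> = 1 / (2 * pi) * C * (LINT \<omega>|lborel. norm (W \<omega>)) * h ^ p" by simp
  finally show ?thesis using sm unfolding approx_within_def by blast
qed

text \<open>The counterpart of \<open>tmean_continuous_integrable\<close> for a merely integrable
  \<open>w\<close>: the kernel is bounded.\<close>

lemma diff_kernel_mult_integrable:
  assumes w: "integrable lborel w" and \<delta>: "\<delta> > 0"
  shows "integrable lborel (\<lambda>t. diff_kernel \<sigma> 1 \<delta> (x - t) * w t)"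
proof (rule integrable_bounded_mult[OF w])
  show "norm (diff_kernel \<sigma> 1 \<delta> (x - t)) \<le> exp (\<bar>Re \<sigma>\<bar> * \<delta>)" for t
  proof (cases "0 < x - t \<and> x - t \<le> \<delta>")
    case True
    have "- Re \<sigma> * (x - t) \<le> \<bar>Re \<sigma>\<bar> * (x - t)" using True by (intro mult_right_mono) auto
    also have "\<dots> \<le> \<bar>Re \<sigma>\<bar> * \<delta>" using True by (intro mult_left_mono) auto
    finally show ?thesis using True by (simp add: diff_kernel_def kap_one[OF \<delta>])
  next
    case False
    hence "kap 1 \<delta> (x - t) = 0" by (simp add: kap_one[OF \<delta>])
    thus ?thesis by (simp add: diff_kernel_def)
  qed
qed simp

lemma subst_D_funpow_zero: "(subst_D \<sigma> ^^ k) (\<lambda>x. 0) = (\<lambda>x. 0)"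
  by (induction k) (auto simp: subst_D_def)

theorem theorem3p4:
  fixes p :: nat and \<alpha> :: real and \<sigma> :: complex and f :: "real \<Rightarrow> complex"
  assumes "p \<in> {2, 3, 4, 5}" and "\<alpha> > 0"
    and "integrable lebesgue f"
    and "integrable lebesgue (fourier f)"
    and "has_subst_frac_deriv \<sigma> (\<alpha> + real p) f"
    and "integrable lebesgue (subst_frac_deriv \<sigma> (\<alpha> + real p) f)"
    and "integrable lebesgue (fourier (subst_frac_deriv \<sigma> (\<alpha> + real p) f))"
  shows "\<exists>C. \<forall>\<^sub>F h in at_right 0.
           (AE x in lebesgue. approx_within p \<alpha> \<sigma> f h x (C * h ^ p)) \<and>
           (continuous_on UNIV f \<longrightarrow> (\<forall>x. approx_within p \<alpha> \<sigma> f h x (C * h ^ p)))"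
proof -
  define n where "n = subst_order \<alpha>"
  define \<nu> where "\<nu> = real n - \<alpha>"
  have n: "n \<ge> 1" and \<nu>: "0 < \<nu>" "\<nu> \<le> 1" and \<alpha>: "real n - \<nu> = \<alpha>"
    using subst_order_bounds[OF assms(2)] by (auto simp: n_def \<nu>_def)
  have p: "p \<ge> 1" using assms(1) by auto
  have np: "subst_order (\<alpha> + real p) = n + p"
    using \<nu> by (intro subst_order_eqI) (auto simp: \<nu>_def)
  have \<nu>p: "real (n + p) - (\<alpha> + real p) = \<nu>" by (simp add: \<nu>_def)
  define \<psi> where "\<psi> = (\<lambda>k. (subst_D \<sigma> ^^ k) (subst_integral \<sigma> \<nu> f))"
  have \<psi>n: "subst_frac_deriv \<sigma> \<alpha> f = \<psi> n"
    by (simp add: subst_frac_deriv_def \<psi>_def flip: n_def \<nu>_def)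
  have \<psi>np: "subst_frac_deriv \<sigma> (\<alpha> + real p) f = \<psi> (n + p)"
    unfolding subst_frac_deriv_def np \<nu>p \<psi>_def ..
  have "(\<forall>x. set_integrable lebesgue {..x} (subst_integrand \<sigma> \<nu> f x)) \<and> (\<forall>k<n + p. \<forall>x. \<psi> k differentiable (at x))"
    using assms(5) unfolding has_subst_frac_deriv_def Let_def np \<nu>p \<psi>_def .
  hence ex: "set_integrable lebesgue {..x} (subst_integrand \<sigma> \<nu> f x)"
    and dif: "k < n + p \<Longrightarrow> \<psi> k differentiable (at x)" for k x
    by auto
  have ch: "D_chain \<sigma> (n + p) \<psi>"
    unfolding D_chain_def
  proof (intro allI impI)
    fix k t assume "k < n + p"
    from dif[OF this, of t] have "(\<psi> k has_vector_derivative vector_derivative (\<psi> k) (at t)) (at t)"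
      by (simp add: vector_derivative_works)
    thus "(\<psi> k has_vector_derivative (\<psi> (Suc k) t - \<sigma> * \<psi> k t)) (at t)"
      by (simp add: \<psi>_def subst_D_def)
  qed
  have fm: "f \<in> borel_measurable lebesgue" using assms(3) by auto
  obtain f0 where f0: "f0 \<in> borel_measurable borel" "AE x in lebesgue. f x = f0 x"
    by (rule borel_version[OF fm])
  have wm: "\<psi> (n + p) \<in> borel_measurable lebesgue" using assms(6) unfolding \<psi>np by auto
  obtain w where w: "w \<in> borel_measurable borel" "AE x in lebesgue. \<psi> (n + p) x = w x"
    by (rule borel_version[OF wm])
  have f0i: "integrable lborel f0"
    using assms(3) integral_lebesgue_eq_lborel(2)[OF fm f0] by simp
  have wi: "integrable lborel w"
    using assms(6) integral_lebesgue_eq_lborel(2)[OF wm w] unfolding \<psi>np by simp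
  have leb: "integrable lebesgue (ft g) \<Longrightarrow> integrable lborel (ft g)" if "g \<in> borel_measurable borel" for g
    using that by (subst (asm) integrable_completion) auto
  have f0F: "integrable lborel (ft f0)"
    using assms(4) unfolding fourier_eq_ft[OF fm f0] by (rule leb[OF f0(1)])
  have wF: "integrable lborel (ft w)"
    using assms(7) unfolding \<psi>np fourier_eq_ft[OF wm w] by (rule leb[OF w(1)])
  have conv: "integrable lborel (\<lambda>t. frac_kernel \<sigma> \<nu> (x - t) * f0 t)" for x
    using ex[of x] unfolding subst_integral_eq_conv(2)[OF fm f0 \<nu>(1)] .
  have \<psi>0: "\<psi> 0 = conv (frac_kernel \<sigma> \<nu>) f0"
    using subst_integral_eq_conv(1)[OF fm f0 \<nu>(1)] by (auto simp: \<psi>_def)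
  \<comment> \<open>The step to the top derivative, which is only integrable, is where its Borel
    version \<open>w\<close> replaces it.\<close>
  have last: "tdiff \<sigma> \<delta> (\<psi> (n + p - 1)) = tmean \<sigma> \<delta> w" if "\<delta> > 0" for \<delta>
  proof (rule tdiff_eq_tmean[OF _ wm w that diff_kernel_mult_integrable[OF wi that]])
    have k: "Suc (n + p - 1) = n + p" "n + p - 1 < n + p" using n by auto
    show "(\<psi> (n + p - 1) has_vector_derivative (\<psi> (n + p) t - \<sigma> * \<psi> (n + p - 1) t)) (at t)" for t
      using ch[unfolded D_chain_def, rule_format, OF k(2), of t] unfolding k(1) .
  qed
  have h01: "\<forall>\<^sub>F h in at_right 0. h \<in> {0<..<(1::real)}"
    by (intro eventually_at_right_real) simp
  show ?thesis
  \<comment> \<open>Here \<nu> = 1 means integer order, where the differenced kernel has bounded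
    support and the growth of the exponential is harmless.\<close>
  proof (cases "Re \<sigma> \<ge> 0 \<or> \<nu> = 1")
    case True
    \<comment> \<open>The least admissible \<open>s\<close>: positive only for
      \<open>Re \<sigma> < 0\<close>, when the case assumption makes \<alpha> an integer.\<close>
    define s where "s = max 0 (- Re \<sigma>)"
    have s: "s \<ge> 0" "Re \<sigma> \<ge> - s" by (auto simp: s_def)
    have sN: "s = 0 \<or> \<alpha> \<in> \<nat>"
    proof (cases "Re \<sigma> \<ge> 0")
      case False
      hence "\<alpha> = real (n - 1)" using True n by (auto simp: \<nu>_def of_nat_diff)
      thus ?thesis by simp
    qed (simp add: s_def)
    obtain b C where
      b: "summable (\<lambda>m. norm (b m) * exp (s * real m))"
      and coeff: "\<And>\<sigma> h m. approx_coeff p \<alpha> \<sigma> h m = b m * exp (- (\<sigma> * of_real h)) ^ m"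
      and est: "\<And>z. Re z \<ge> - s \<Longrightarrow> norm ((\<Sum>m. b m * exp (- z) ^ m) - z powr of_real \<alpha>) \<le> C * norm z powr (\<alpha> + p)"
      by (rule coeff_estimate[OF assms(1,2) sN]) blast
    \<comment> \<open>The estimate does not record the sign of \<open>C\<close>, but the integral
      bound needs a nonnegative constant.\<close>
    have est': "norm ((\<Sum>m. b m * exp (- z) ^ m) - z powr of_real \<alpha>) \<le> max 0 C * norm z powr (\<alpha> + p)"
      if "Re z \<ge> - s" for z
      by (rule order_trans[OF est[OF that]]) (intro mult_right_mono, auto)
    note rep = frac_deriv_representation[OF \<nu> True n p f0i f0F conv ch \<psi>0 last wi wF, unfolded \<alpha>]
    define K where "K = 1 / (2 * pi) * max 0 C * (LINT \<omega>|lborel. norm (ft w \<omega>))"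
    have main: "approx_within p \<alpha> \<sigma> f h x (K * h ^ p)"
      if "h \<in> {0<..<1}" "\<And>m::nat. f (x - real m * h) = ift (ft f0) (x - real m * h)" for h x
      unfolding K_def
      by (rule approx_within_of_representation[OF s _ _ _ b coeff est' f0F wF rep(2,1) _ that(2)])
         (use that(1) rep(3) \<psi>n in auto)
    have ae: "AE x in lborel. f x = ift (ft f0) x"
      using ft_inversion_AE[OF f0i f0F] f0(2)[unfolded AE_completion_iff] by eventually_elim simp
    have ct: "f x = ift (ft f0) x" if "continuous_on UNIV f" for x
    proof -
      have "continuous_on UNIV (\<lambda>x. f x - ift (ft f0) x)"
        using isCont_ift[OF f0F] by (intro continuous_on_diff that) (simp add: continuous_at_imp_continuous_on)
      moreover have "AE x in lborel. f x - ift (ft f0) x = 0" using ae by eventually_elim simp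
      ultimately have "f x - ift (ft f0) x = 0" by (intro continuous_AE_zero_imp_zero)
      thus ?thesis by simp
    qed
    show ?thesis
    proof (rule exI[of _ K], rule eventually_mono[OF h01], rule conjI)
      fix h :: real assume h: "h \<in> {0<..<1}"
      show "AE x in lebesgue. approx_within p \<alpha> \<sigma> f h x (K * h ^ p)"
        using AE_lborel_all_shifts[OF ae, of h] by eventually_elim (rule main[OF h], blast)
      show "continuous_on UNIV f \<longrightarrow> (\<forall>x. approx_within p \<alpha> \<sigma> f h x (K * h ^ p))"
        using main[OF h ct] by blast
    qed
  next
    case False
    \<comment> \<open>Fractional order with a growing kernel: the function, its derivative and all
      its approximations vanish, so the constant 0 serves.\<close>
    have z: "AE x in lborel. f0 x = 0"
      by (rule frac_deriv_degenerate[OF \<nu>(1) _ _ _ f0i conv ch \<psi>0 last[OF zero_less_one] wi]) (use False \<nu> n in auto)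
    have ae: "AE x in lborel. f x = 0"
      using z f0(2)[unfolded AE_completion_iff] by eventually_elim simp
    have "conv (frac_kernel \<sigma> \<nu>) f0 x = 0" for x
    proof -
      have "AE t in lborel. frac_kernel \<sigma> \<nu> (x - t) * f0 t = 0" using z by eventually_elim simp
      thus ?thesis unfolding conv_def by (rule integral_eq_zero_AE)
    qed
    hence "subst_integral \<sigma> \<nu> f = (\<lambda>x. 0)" using \<psi>0 by (auto simp: \<psi>_def)
    hence D0: "subst_frac_deriv \<sigma> \<alpha> f x = 0" for x
      unfolding \<psi>n \<psi>_def by (simp add: subst_D_funpow_zero)
    have main: "approx_within p \<alpha> \<sigma> f h x (0 * h ^ p)" if "\<And>m::nat. f (x - real m * h) = 0" for h x
    proof -
      have "approx_term p \<alpha> \<sigma> h f x = (\<lambda>m. 0)" by (simp add: fun_eq_iff approx_term_def that)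
      thus ?thesis by (simp add: approx_within_def approx_A_def D0)
    qed
    show ?thesis
    proof (rule exI[of _ 0], rule always_eventually, rule allI, rule conjI)
      fix h
      show "AE x in lebesgue. approx_within p \<alpha> \<sigma> f h x (0 * h ^ p)"
        using AE_lborel_all_shifts[OF ae, of h] by eventually_elim (rule main, blast)
      show "continuous_on UNIV f \<longrightarrow> (\<forall>x. approx_within p \<alpha> \<sigma> f h x (0 * h ^ p))"
        using main continuous_AE_zero_imp_zero[OF ae] by blast
    qed
  qed
qed

end
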